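(* Let $G$ be a locally compact group acting (continuously) without inversion on a tree $\mathcal{T}$, with all vertex-stabilizers having Kazhdan's Property (T); let $M$ be a unitary $G$-module. Let $V$ be the vertex set and $A$ an orientation of the edge set of the quotient graph $X=G\backslash\mathcal{T}$, let $G_v$, $G_e$ be the associated vertex and edge groups, and let $\iota:\prod_{v\in V}M^{G_v}\to\prod_{e\in A}M^{G_e}$ be the map $(\iota f)_e=f_{e_+}-t_e^{-1}f_{e_-}$. Then: (i) $H^1(G,M)=0$ if and only if $\iota$ is onto; (ii) $\overline{H}^1(G,M)=0$ if and only if $\iota$ has dense image, where $\prod_{v\in V}M^{G_v}$ and $\prod_{e\in A}M^{G_e}$ are endowed with the product topology.
   Context: Bass–Serre data: graphs have oriented edges $e$ with initial vertex $e_-$, terminal vertex $e_+$ and reverse edge $\overline e$; an orientation $A$ contains exactly one of $e,\overline e$ for each edge. Given $G$ acting without inversion on the tree $\mathcal T$ with quotient graph $X=G\backslash\mathcal T=(V,E)$, fix a maximal tree $T\subset X$, an orientation $A$ of $X$, and lifts $v\mapsto\widetilde v$, $e\mapsto\widetilde e$ ($v\in V$, $e\in A$) to $\mathcal T$ such that $T$ lifts to a subtree $\widetilde T$ of $\mathcal T$ and $(\widetilde e)_+=\widetilde{e_+}$ for all $e\in A$. Choose $t_e\in G$ ($e\in A$) with $(\widetilde e)_-=t_e^{-1}\widetilde{e_-}$, and $t_e=1$ if $e$ is an edge of $T$. Set $G_v=\mathrm{Stab}_G(\widetilde v)$ and $G_e=\mathrm{Stab}_G(\widetilde e)$; thus $G_e\subset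 G_{e_+}$ and $t_eG_et_e^{-1}\subset G_{e_-}$. For a topological group $G$, a unitary $G$-module $M$ is a Hilbert space with a strongly continuous unitary representation of $G$; $M^H$ denotes the $H$-fixed vectors for a subgroup $H$. $H^1(G,M)=Z^1(G,M)/B^1(G,M)$ (continuous 1-cocycles modulo 1-coboundaries), and $\overline{H}^1(G,M)=Z^1(G,M)/\overline{B^1(G,M)}$, the closure being for uniform convergence on compact subsets of $G$. Continuity of the action on the tree means that vertex stabilizers are open. *)

theory Defs
  imports
    "HOL-Analysis.Analysis"
    "HOL-Algebra.Elementary_Groups"
    "HOL-Algebra.Group_Action"
    "HOL-Algebra.Module"
    "Graph_Theory.Digraph_Component"
begin

section \<open>Topological groups\<close>

locale topological_group = group G
  for G :: "('g, 'x) monoid_scheme" (structure) and T :: "'g topology" +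
  assumes topspace_eq: "topspace T = carrier G"
    and mult_continuous: "continuous_map (prod_topology T T) T (\<lambda>(g, h). g \<otimes> h)"
    and inv_continuous: "continuous_map T T (\<lambda>g. inv g)"

locale locally_compact_group = topological_group +
  assumes Hausdorff: "Hausdorff_space T"
    and locally_compact: "locally_compact_space T"

lemma (in topological_group) subgroup_topological_group:
  assumes "subgroup K G"
  shows "topological_group (G\<lparr>carrier := K\<rparr>) (subtopology T K)"
proof -
  interpret K: group "G\<lparr>carrier := K\<rparr>"
    using assms by (simp add: subgroup.subgroup_is_group is_group)
  have sub: "K \<subseteq> carrier G"
    using assms by (rule subgroup.subset)
  have prod: "prod_topology (subtopology T K) (subtopology T K)
      = subtopology (prod_topology T T) (K \<times> K)"
    by (simp add: subtopology_Times)
  show ?thesis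
  proof unfold_locales
    show "topspace (subtopology T K) = carrier (G\<lparr>carrier := K\<rparr>)"
      using sub topspace_eq by auto
    show "continuous_map (prod_topology (subtopology T K) (subtopology T K)) (subtopology T K)
        (\<lambda>(g, h). g \<otimes>\<^bsub>G\<lparr>carrier := K\<rparr>\<^esub> h)"
      unfolding prod continuous_map_in_subtopology
      using continuous_map_from_subtopology[OF mult_continuous] subgroup.m_closed[OF assms]
      by auto
    have "continuous_map (subtopology T K) (subtopology T K) (\<lambda>g. inv g)"
      unfolding continuous_map_in_subtopology
      using continuous_map_from_subtopology[OF inv_continuous] subgroup.m_inv_closed[OF assms]
      by auto
    then show "continuous_map (subtopology T K) (subtopology T K) (\<lambda>g. inv\<^bsub>G\<lparr>carrier := K\<rparr>\<^esub> g)"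
      by (rule continuous_map_eq) (auto simp: m_inv_consistent[OF assms])
  qed
qed


section \<open>Complex Hilbert spaces on a carrier set\<close>

text \<open>
  Property (T) quantifies over all Hilbert spaces, so it needs Hilbert spaces as objects. Of the
  fields inherited from \<^type>\<open>module\<close>, the multiplication and its unit play no role.
\<close>

definition complex_ring :: "complex ring" where
  "complex_ring = \<lparr>carrier = UNIV, monoid.mult = (*), one = 1, ring.zero = 0, add = (+)\<rparr>"

lemma complex_ring_cring: "cring complex_ring"
proof (rule cringI)
  show "abelian_group complex_ring"
  proof (rule abelian_groupI)
    fix x :: complex assume "x \<in> carrier complex_ring"
    show "\<exists>y\<in>carrier complex_ring. y \<oplus>\<^bsub>complex_ring\<^esub> x = \<zero>\<^bsub>complex_ring\<^esub>"
      by (rule bexI[of _ "- x"]) (auto simp: complex_ring_def)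
  qed (auto simp: complex_ring_def)
  show "Group.comm_monoid complex_ring"
    by unfold_locales (auto simp: complex_ring_def)
qed (auto simp: complex_ring_def algebra_simps)

record 'h hilbert = "(complex, 'h) module" +
  hinner :: "'h \<Rightarrow> 'h \<Rightarrow> complex"

definition hnorm :: "('h, 'x) hilbert_scheme \<Rightarrow> 'h \<Rightarrow> real" where
  "hnorm H x = sqrt (Re (hinner H x x))"

text \<open>
  The locale \<^locale>\<open>Metric_space\<close> wants distances to be nonnegative and symmetric off the
  carrier as well.
\<close>

definition hdist :: "('h, 'x) hilbert_scheme \<Rightarrow> 'h \<Rightarrow> 'h \<Rightarrow> real" where
  "hdist H x y =
     (if x \<in> carrier H \<and> y \<in> carrier H then hnorm H (x \<ominus>\<^bsub>H\<^esub> y) else 0)"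

abbreviation htopology :: "('h, 'x) hilbert_scheme \<Rightarrow> 'h topology" where
  "htopology H \<equiv> Metric_space.mtopology (carrier H) (hdist H)"

locale inner_product_space = Module.module complex_ring H
  for H :: "('h, 'x) hilbert_scheme" (structure) +
  assumes hinner_commute:
      "\<lbrakk>x \<in> carrier H; y \<in> carrier H\<rbrakk> \<Longrightarrow> hinner H x y = cnj (hinner H y x)"
    and hinner_add_right:
      "\<lbrakk>x \<in> carrier H; y \<in> carrier H; z \<in> carrier H\<rbrakk>
        \<Longrightarrow> hinner H x (y \<oplus> z) = hinner H x y + hinner H x z"
    and hinner_smult_right:
      "\<lbrakk>x \<in> carrier H; y \<in> carrier H\<rbrakk> \<Longrightarrow> hinner H x (c \<odot> y) = c * hinner H x y"
    and hinner_pos: "\<lbrakk>x \<in> carrier H; x \<noteq> \<zero>\<rbrakk> \<Longrightarrow> 0 < Re (hinner H x x)"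

context inner_product_space
begin

lemma hinner_zero_right: "x \<in> carrier H \<Longrightarrow> hinner H x \<zero> = 0"
  using hinner_add_right[of x \<zero> \<zero>] by simp

lemma hinner_minus_right:
  assumes "x \<in> carrier H" "y \<in> carrier H" "z \<in> carrier H"
  shows "hinner H x (y \<ominus> z) = hinner H x y - hinner H x z"
proof -
  have "y \<ominus> z \<oplus> z = y"
    using assms by (simp add: a_minus_def a_assoc l_neg)
  then show ?thesis
    using assms hinner_add_right[of x "y \<ominus> z" z] by simp
qed

lemma hinner_add_left:
  "\<lbrakk>x \<in> carrier H; y \<in> carrier H; z \<in> carrier H\<rbrakk>
    \<Longrightarrow> hinner H (x \<oplus> y) z = hinner H x z + hinner H y z"
  using hinner_commute[of "x \<oplus> y" z] hinner_commute[of x z] hinner_commute[of y z]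
  by (simp add: hinner_add_right)

lemma smult_carrier: "x \<in> carrier H \<Longrightarrow> c \<odot> x \<in> carrier H"
  using smult_closed[of c x] by (simp add: complex_ring_def)

lemma hinner_smult_left:
  "\<lbrakk>x \<in> carrier H; y \<in> carrier H\<rbrakk> \<Longrightarrow> hinner H (c \<odot> x) y = cnj c * hinner H x y"
  using hinner_commute[of "c \<odot> x" y] hinner_commute[of x y]
  by (simp add: hinner_smult_right smult_carrier)

lemma hinner_self: "x \<in> carrier H \<Longrightarrow> hinner H x x = complex_of_real ((hnorm H x)\<^sup>2)"
proof -
  assume x: "x \<in> carrier H"
  have "Re (hinner H x x) \<ge> 0"
    using hinner_pos[OF x] hinner_zero_right[OF x] by (cases "x = \<zero>") auto
  moreover have "Im (hinner H x x) = 0"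
    using hinner_commute[OF x x] by (metis complex_cnj_cancel_iff Reals_cnj_iff complex_is_Real_iff)
  ultimately show ?thesis
    by (simp add: hnorm_def complex_eq_iff)
qed

lemma hnorm_nonneg: "x \<in> carrier H \<Longrightarrow> 0 \<le> hnorm H x"
  using hinner_pos[of x] hinner_zero_right[of x] by (cases "x = \<zero>") (auto simp: hnorm_def)

lemma hnorm_eq_0: "x \<in> carrier H \<Longrightarrow> hnorm H x = 0 \<longleftrightarrow> x = \<zero>"
  using hinner_pos[of x] hinner_zero_right[of x] by (cases "x = \<zero>") (auto simp: hnorm_def)

lemma hnorm_smult: "x \<in> carrier H \<Longrightarrow> hnorm H (c \<odot> x) = cmod c * hnorm H x"
proof -
  assume x: "x \<in> carrier H"
  have "hinner H (c \<odot> x) (c \<odot> x) = (c * cnj c) * hinner H x x"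
    using x by (simp add: hinner_smult_left hinner_smult_right smult_carrier mult_ac)
  also have "\<dots> = complex_of_real ((cmod c * hnorm H x)\<^sup>2)"
    using x by (simp add: hinner_self power_mult_distrib flip: complex_norm_square)
  finally have "(hnorm H (c \<odot> x))\<^sup>2 = (cmod c * hnorm H x)\<^sup>2"
    using hinner_self[OF smult_carrier[OF x]] by (metis of_real_eq_iff)
  then show ?thesis
    using hnorm_nonneg smult_carrier x by (simp add: power2_eq_iff_nonneg)
qed

lemma hnorm_add_sq:
  "\<lbrakk>x \<in> carrier H; y \<in> carrier H\<rbrakk>
    \<Longrightarrow> (hnorm H (x \<oplus> y))\<^sup>2 = (hnorm H x)\<^sup>2 + 2 * Re (hinner H x y) + (hnorm H y)\<^sup>2"
proof -
  assume xy: "x \<in> carrier H" "y \<in> carrier H"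
  have "hinner H (x \<oplus> y) (x \<oplus> y)
      = hinner H x x + hinner H x y + cnj (hinner H x y) + hinner H y y"
    using xy hinner_commute[of y x] by (simp add: hinner_add_left hinner_add_right)
  then have "Re (hinner H (x \<oplus> y) (x \<oplus> y))
      = Re (hinner H x x) + 2 * Re (hinner H x y) + Re (hinner H y y)"
    by simp
  then show ?thesis
    using xy by (simp add: hinner_self)
qed

lemma cauchy_schwarz:
  assumes xy: "x \<in> carrier H" "y \<in> carrier H"
  shows "cmod (hinner H x y) \<le> hnorm H x * hnorm H y"
proof (cases "y = \<zero>")
  case True
  with xy show ?thesis by (simp add: hinner_zero_right hnorm_nonneg)
next
  case False
  define p where "p = hinner H x y"
  define n where "n = hnorm H y"
  have n: "n > 0"
    using False xy hnorm_nonneg hnorm_eq_0 unfolding n_def by (metis less_eq_real_def)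
  define c where "c = - cnj p / of_real (n\<^sup>2)"
  have "0 \<le> (hnorm H (x \<oplus> c \<odot> y))\<^sup>2" by simp
  also have "\<dots> = (hnorm H x)\<^sup>2 + 2 * Re (c * p) + (cmod c * n)\<^sup>2"
    using xy by (simp add: hnorm_add_sq smult_carrier hinner_smult_right hnorm_smult p_def n_def)
  also have "Re (c * p) = - (cmod p)\<^sup>2 / n\<^sup>2"
  proof -
    have "c * p = of_real (- (cmod p)\<^sup>2 / n\<^sup>2)"
      unfolding c_def using complex_norm_square[of p] by (simp add: mult.commute)
    then show ?thesis by (metis Re_complex_of_real)
  qed
  also have "cmod c * n = cmod p / n"
    using n by (simp add: c_def norm_divide norm_mult power2_eq_square)
  also have "(hnorm H x)\<^sup>2 + 2 * (- (cmod p)\<^sup>2 / n\<^sup>2) + (cmod p / n)\<^sup>2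
      = (hnorm H x)\<^sup>2 - (cmod p / n)\<^sup>2"
    by (simp add: power_divide)
  finally have "(cmod p / n)\<^sup>2 \<le> (hnorm H x)\<^sup>2" by simp
  then have "cmod p / n \<le> hnorm H x"
    using xy hnorm_nonneg power2_le_imp_le by blast
  then show ?thesis
    using n by (simp add: divide_le_eq p_def n_def)
qed

lemma hnorm_triangle:
  assumes xy: "x \<in> carrier H" "y \<in> carrier H"
  shows "hnorm H (x \<oplus> y) \<le> hnorm H x + hnorm H y"
proof (rule power2_le_imp_le)
  have "Re (hinner H x y) \<le> hnorm H x * hnorm H y"
    using cauchy_schwarz[OF xy] complex_Re_le_cmod order_trans by blast
  then show "(hnorm H (x \<oplus> y))\<^sup>2 \<le> (hnorm H x + hnorm H y)\<^sup>2"
    using xy by (simp add: hnorm_add_sq power2_sum)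
qed (use xy hnorm_nonneg in auto)

lemma Metric_space_hdist: "Metric_space (carrier H) (hdist H)"
proof
  fix x y
  show "0 \<le> hdist H x y"
    by (simp add: hdist_def hnorm_nonneg)
  show "hdist H x y = hdist H y x"
  proof (cases "x \<in> carrier H \<and> y \<in> carrier H")
    case True
    then have "hinner H (x \<ominus> y) (x \<ominus> y) = hinner H (y \<ominus> x) (y \<ominus> x)"
      using hinner_commute[of "x \<ominus> y" x] hinner_commute[of "x \<ominus> y" y]
        hinner_commute[of "y \<ominus> x" x] hinner_commute[of "y \<ominus> x" y]
      by (simp add: hinner_minus_right)
    with True show ?thesis
      by (simp add: hdist_def hnorm_def)
  qed (auto simp: hdist_def)
next
  fix x y assume xy: "x \<in> carrier H" "y \<in> carrier H"
  have "x \<ominus> y \<oplus> y = x"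
    using xy by (simp add: a_minus_def a_assoc l_neg)
  then have "x \<ominus> y = \<zero> \<longleftrightarrow> x = y"
    using xy by (auto simp: a_minus_def r_neg)
  then show "hdist H x y = 0 \<longleftrightarrow> x = y"
    using xy by (auto simp: hdist_def hnorm_eq_0)
next
  fix x y z assume xyz: "x \<in> carrier H" "y \<in> carrier H" "z \<in> carrier H"
  have "(x \<ominus> y) \<oplus> (y \<ominus> z) = x \<ominus> z"
    using xyz by (simp add: a_minus_def a_ac r_neg2 l_neg r_neg)
  then show "hdist H x z \<le> hdist H x y + hdist H y z"
    using hnorm_triangle[of "x \<ominus> y" "y \<ominus> z"] xyz by (simp add: hdist_def)
qed

end

locale hilbert_space = inner_product_space +
  assumes complete: "Metric_space.mcomplete (carrier H) (hdist H)"


section \<open>Unitary representations\<close>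

locale unitary_rep = topological_group G T + hilbert_space H
  for G :: "('g, 'x) monoid_scheme" (structure) and T :: "'g topology"
    and H :: "('h, 'y) hilbert_scheme" and \<pi> :: "'g \<Rightarrow> 'h \<Rightarrow> 'h" +
  assumes rep_closed: "\<lbrakk>g \<in> carrier G; x \<in> carrier H\<rbrakk> \<Longrightarrow> \<pi> g x \<in> carrier H"
    and rep_add: "\<lbrakk>g \<in> carrier G; x \<in> carrier H; y \<in> carrier H\<rbrakk>
      \<Longrightarrow> \<pi> g (x \<oplus>\<^bsub>H\<^esub> y) = \<pi> g x \<oplus>\<^bsub>H\<^esub> \<pi> g y"
    and rep_smult: "\<lbrakk>g \<in> carrier G; x \<in> carrier H\<rbrakk> \<Longrightarrow> \<pi> g (c \<odot>\<^bsub>H\<^esub> x) = c \<odot>\<^bsub>H\<^esub> \<pi> g x"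
    and rep_hinner: "\<lbrakk>g \<in> carrier G; x \<in> carrier H; y \<in> carrier H\<rbrakk>
      \<Longrightarrow> hinner H (\<pi> g x) (\<pi> g y) = hinner H x y"
    and rep_one: "x \<in> carrier H \<Longrightarrow> \<pi> \<one> x = x"
    and rep_mult: "\<lbrakk>g \<in> carrier G; h \<in> carrier G; x \<in> carrier H\<rbrakk>
      \<Longrightarrow> \<pi> (g \<otimes> h) x = \<pi> g (\<pi> h x)"
    and rep_continuous: "x \<in> carrier H \<Longrightarrow> continuous_map T (htopology H) (\<lambda>g. \<pi> g x)"


section \<open>Kazhdan's Property (T)\<close>

definition kazhdan_pair ::
  "'h itself \<Rightarrow> ('g, 'x) monoid_scheme \<Rightarrow> 'g topology \<Rightarrow> 'g set \<Rightarrow> real \<Rightarrow> bool" where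
  "kazhdan_pair _ G T Q \<epsilon> \<longleftrightarrow>
     (\<forall>(H :: 'h hilbert) \<pi>. unitary_rep G T H \<pi> \<longrightarrow>
        (\<exists>x \<in> carrier H. x \<noteq> \<zero>\<^bsub>H\<^esub> \<and> (\<forall>g\<in>Q. hdist H (\<pi> g x) x < \<epsilon> * hnorm H x)) \<longrightarrow>
        (\<exists>y \<in> carrier H. y \<noteq> \<zero>\<^bsub>H\<^esub> \<and> (\<forall>g\<in>carrier G. \<pi> g y = y)))"

text \<open>
  A Kazhdan pair is about all unitary representations, on Hilbert spaces of any type. Those carried
  by sets of complex functions on the group suffice: the representation generated by one vector
  embeds there through its matrix coefficients. This is proved as \<open>kazhdan_pair_any_type\<close> below.
\<close>

definition property_T :: "('g, 'x) monoid_scheme \<Rightarrow> 'g topology \<Rightarrow> bool" where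
  "property_T G T \<longleftrightarrow>
     (\<exists>Q \<epsilon>. compactin T Q \<and> \<epsilon> > 0 \<and> kazhdan_pair TYPE('g \<Rightarrow> complex) G T Q \<epsilon>)"


lemma unitary_rep_transport:
  fixes H :: "('h, 'y) hilbert_scheme" and \<Phi> :: "'h \<Rightarrow> 'k"
  assumes rep: "unitary_rep G T H \<pi>"
    and C: "C \<subseteq> carrier H" "\<zero>\<^bsub>H\<^esub> \<in> C" "closedin (htopology H) C"
    and C_add: "\<And>x y. x \<in> C \<Longrightarrow> y \<in> C \<Longrightarrow> x \<oplus>\<^bsub>H\<^esub> y \<in> C"
    and C_smult: "\<And>c x. x \<in> C \<Longrightarrow> c \<odot>\<^bsub>H\<^esub> x \<in> C"
    and C_inv: "\<And>g x. g \<in> carrier G \<Longrightarrow> x \<in> C \<Longrightarrow> \<pi> g x \<in> C"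
    and inj: "inj_on \<Phi> C"
  shows "\<exists>(K :: 'k hilbert) \<rho>. unitary_rep G T K \<rho> \<and> carrier K = \<Phi> ` C \<and> \<zero>\<^bsub>K\<^esub> = \<Phi> \<zero>\<^bsub>H\<^esub> \<and>
    (\<forall>x\<in>C. hnorm K (\<Phi> x) = hnorm H x) \<and>
    (\<forall>x\<in>C. \<forall>y\<in>C. hdist K (\<Phi> x) (\<Phi> y) = hdist H x y) \<and>
    (\<forall>g\<in>carrier G. \<forall>x\<in>C. \<rho> g (\<Phi> x) = \<Phi> (\<pi> g x))"
proof -
  interpret rep: unitary_rep G T H \<pi> by (fact rep)
  define \<Psi> where "\<Psi> = inv_into C \<Phi>"
  have \<Psi> [simp]: "\<Psi> (\<Phi> x) = x" if "x \<in> C" for x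
    using that inj by (simp add: \<Psi>_def)
  have CH: "x \<in> carrier H" if "x \<in> C" for x
    using that C by auto
  note [simp] = CH C_add C_smult C_inv C(2)
  define K :: "'k hilbert" where
    "K = \<lparr>carrier = \<Phi> ` C, monoid.mult = undefined, one = undefined, ring.zero = \<Phi> \<zero>\<^bsub>H\<^esub>,
      add = (\<lambda>x y. \<Phi> (\<Psi> x \<oplus>\<^bsub>H\<^esub> \<Psi> y)), smult = (\<lambda>c x. \<Phi> (c \<odot>\<^bsub>H\<^esub> \<Psi> x)),
      hinner = (\<lambda>x y. hinner H (\<Psi> x) (\<Psi> y))\<rparr>"
  define \<rho> where "\<rho> = (\<lambda>g x. \<Phi> (\<pi> g (\<Psi> x)))"
  have K [simp]: "carrier K = \<Phi> ` C" "\<zero>\<^bsub>K\<^esub> = \<Phi> \<zero>\<^bsub>H\<^esub>"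
    "x \<oplus>\<^bsub>K\<^esub> y = \<Phi> (\<Psi> x \<oplus>\<^bsub>H\<^esub> \<Psi> y)" "c \<odot>\<^bsub>K\<^esub> x = \<Phi> (c \<odot>\<^bsub>H\<^esub> \<Psi> x)"
    "hinner K x y = hinner H (\<Psi> x) (\<Psi> y)" for x y c
    by (auto simp: K_def)
  have neg: "\<ominus>\<^bsub>H\<^esub> x = (-1) \<odot>\<^bsub>H\<^esub> x" if "x \<in> carrier H" for x
  proof (rule rep.minus_equality)
    have "((-1) + 1 :: complex) \<odot>\<^bsub>H\<^esub> x = (-1) \<odot>\<^bsub>H\<^esub> x \<oplus>\<^bsub>H\<^esub> 1 \<odot>\<^bsub>H\<^esub> x"
      using rep.smult_l_distr[of "-1" 1 x] that by (simp add: complex_ring_def)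
    then show "(-1) \<odot>\<^bsub>H\<^esub> x \<oplus>\<^bsub>H\<^esub> x = \<zero>\<^bsub>H\<^esub>"
      using rep.smult_one[OF that] rep.smult_l_null[OF that] by (simp add: complex_ring_def)
  qed (use that rep.smult_carrier in auto)
  have ab: "abelian_group K"
  proof (rule abelian_groupI)
    fix x assume "x \<in> carrier K"
    then obtain y where y: "x = \<Phi> y" "y \<in> C" by auto
    have "(-1) \<odot>\<^bsub>H\<^esub> y \<oplus>\<^bsub>H\<^esub> y = \<zero>\<^bsub>H\<^esub>"
      using neg[of y] y rep.l_neg[of y] by simp
    then show "\<exists>y\<in>carrier K. y \<oplus>\<^bsub>K\<^esub> x = \<zero>\<^bsub>K\<^esub>"
      using y by (intro bexI[of _ "\<Phi> ((-1) \<odot>\<^bsub>H\<^esub> y)"]) auto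
  qed (auto simp: rep.a_ac)
  have mod: "Module.module complex_ring K"
  proof (intro Module.module.intro complex_ring_cring ab Module.module_axioms.intro)
    fix a b x assume "x \<in> carrier K"
    then show "(a \<oplus>\<^bsub>complex_ring\<^esub> b) \<odot>\<^bsub>K\<^esub> x = a \<odot>\<^bsub>K\<^esub> x \<oplus>\<^bsub>K\<^esub> b \<odot>\<^bsub>K\<^esub> x"
      "(a \<otimes>\<^bsub>complex_ring\<^esub> b) \<odot>\<^bsub>K\<^esub> x = a \<odot>\<^bsub>K\<^esub> (b \<odot>\<^bsub>K\<^esub> x)"
      "\<one>\<^bsub>complex_ring\<^esub> \<odot>\<^bsub>K\<^esub> x = x"
      using rep.smult_l_distr[of a b "\<Psi> x"] rep.smult_assoc1[of a b "\<Psi> x"]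
        rep.smult_one[of "\<Psi> x"] by (auto simp: complex_ring_def)
  next
    fix a x y assume "x \<in> carrier K" "y \<in> carrier K"
    then show "a \<odot>\<^bsub>K\<^esub> (x \<oplus>\<^bsub>K\<^esub> y) = a \<odot>\<^bsub>K\<^esub> x \<oplus>\<^bsub>K\<^esub> a \<odot>\<^bsub>K\<^esub> y"
      using rep.smult_r_distr[of a "\<Psi> x" "\<Psi> y"] by (auto simp: complex_ring_def)
  qed auto
  have ips: "inner_product_space K"
  proof (rule inner_product_space.intro[OF mod], unfold_locales)
    fix x y assume "x \<in> carrier K" "y \<in> carrier K"
    then show "hinner K x y = cnj (hinner K y x)"
      using rep.hinner_commute[of "\<Psi> x" "\<Psi> y"] by auto
  next
    fix x assume "x \<in> carrier K" "x \<noteq> \<zero>\<^bsub>K\<^esub>"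
    then obtain y where "x = \<Phi> y" "y \<in> C" "y \<noteq> \<zero>\<^bsub>H\<^esub>" by auto
    then show "0 < Re (hinner K x x)"
      using rep.hinner_pos[of y] by simp
  qed (auto simp: rep.hinner_add_right rep.hinner_smult_right)
  interpret K: inner_product_space K by (fact ips)
  have C_minus: "x \<ominus>\<^bsub>H\<^esub> y \<in> C" if "x \<in> C" "y \<in> C" for x y
    using that neg[of y] by (simp add: a_minus_def)
  have minus: "\<Phi> x \<ominus>\<^bsub>K\<^esub> \<Phi> y = \<Phi> (x \<ominus>\<^bsub>H\<^esub> y)" if "x \<in> C" "y \<in> C" for x y
  proof -
    have "\<ominus>\<^bsub>K\<^esub> (\<Phi> y) = \<Phi> (\<ominus>\<^bsub>H\<^esub> y)"
      using that neg[of y] rep.l_neg[of y] by (intro K.minus_equality) auto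
    then show ?thesis
      using that neg[of y] by (simp add: a_minus_def)
  qed
  have norm: "hnorm K (\<Phi> x) = hnorm H x" if "x \<in> C" for x
    using that by (simp add: hnorm_def)
  have dist: "hdist K (\<Phi> x) (\<Phi> y) = hdist H x y" if "x \<in> C" "y \<in> C" for x y
    using that C_minus by (simp add: hdist_def minus norm)
  interpret HM: Metric_space "carrier H" "hdist H" by (rule rep.Metric_space_hdist)
  interpret KM: Metric_space "carrier K" "hdist K" by (rule K.Metric_space_hdist)
  have "KM.mcomplete"
    unfolding KM.mcomplete_def
  proof (intro allI impI)
    fix \<sigma> assume \<sigma>: "KM.MCauchy \<sigma>"
    then have "range \<sigma> \<subseteq> \<Phi> ` C"
      unfolding KM.MCauchy_def by simp
    then have "\<exists>x\<in>C. \<sigma> n = \<Phi> x" for n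
      by blast
    then obtain s where s: "\<And>n. s n \<in> C" "\<sigma> = (\<lambda>n. \<Phi> (s n))"
      by metis
    have "HM.MCauchy s"
      using \<sigma> s unfolding KM.MCauchy_def HM.MCauchy_def by (auto simp: dist)
    then obtain l where l: "limitin HM.mtopology s l sequentially"
      using rep.complete unfolding HM.mcomplete_def by blast
    then have "l \<in> C"
      using C(3) s unfolding HM.metric_closedin_iff_sequentially_closed by blast
    with l s show "\<exists>x. limitin KM.mtopology \<sigma> x sequentially"
      unfolding HM.limit_metric_sequentially KM.limit_metric_sequentially
      by (intro exI[of _ "\<Phi> l"]) (auto simp: dist)
  qed
  then have hs: "hilbert_space K"
    by (intro hilbert_space.intro ips hilbert_space_axioms.intro)
  have "unitary_rep G T K \<rho>"
  proof (intro unitary_rep.intro unitary_rep_axioms.intro rep.topological_group_axioms hs)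
    fix x assume "x \<in> carrier K"
    then obtain y where y: "x = \<Phi> y" "y \<in> C" by auto
    have "continuous_map T HM.mtopology (\<lambda>g. \<pi> g y)"
      using y rep.rep_continuous by auto
    moreover have "\<rho> h x \<in> KM.mball (\<rho> g x) e \<longleftrightarrow> \<pi> h y \<in> HM.mball (\<pi> g y) e"
      if "g \<in> topspace T" "h \<in> topspace T" for g h e
      unfolding KM.in_mball HM.in_mball using that y by (simp add: \<rho>_def dist rep.topspace_eq)
    ultimately show "continuous_map T KM.mtopology (\<lambda>g. \<rho> g x)"
      unfolding HM.continuous_map_to_metric KM.continuous_map_to_metric
      by (meson openin_subset subsetD)
  qed (auto simp: \<rho>_def rep.rep_add rep.rep_smult rep.rep_hinner rep.rep_one rep.rep_mult)
  then show ?thesis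
    using norm dist by (intro exI[of _ K] exI[of _ \<rho>]) (auto simp: \<rho>_def)
qed

lemma kazhdan_pair_any_type:
  assumes "kazhdan_pair TYPE('g \<Rightarrow> complex) (G :: ('g, 'x) monoid_scheme) T Q \<epsilon>"
    and Q: "Q \<subseteq> carrier G"
  shows "kazhdan_pair TYPE('h) G T Q \<epsilon>"
  unfolding kazhdan_pair_def
proof (intro allI impI)
  fix H :: "'h hilbert" and \<pi>
  assume rep: "unitary_rep G T H \<pi>"
    and "\<exists>x \<in> carrier H. x \<noteq> \<zero>\<^bsub>H\<^esub> \<and> (\<forall>g\<in>Q. hdist H (\<pi> g x) x < \<epsilon> * hnorm H x)"
  then obtain x where x: "x \<in> carrier H" "x \<noteq> \<zero>\<^bsub>H\<^esub>"
    "\<And>g. g \<in> Q \<Longrightarrow> hdist H (\<pi> g x) x < \<epsilon> * hnorm H x" by blast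
  interpret rep: unitary_rep G T H \<pi> by (fact rep)
  interpret HM: Metric_space "carrier H" "hdist H" by (rule rep.Metric_space_hdist)
  define orth where "orth = {z \<in> carrier H. \<forall>g\<in>carrier G. hinner H z (\<pi> g x) = 0}"
  define C where "C = {y \<in> carrier H. \<forall>z\<in>orth. hinner H z y = 0}"
  define \<Phi> where "\<Phi> = (\<lambda>y g. if g \<in> carrier G then hinner H (\<pi> g x) y else 0)"
  note [simp] = rep.rep_closed rep.smult_carrier rep.hinner_zero_right
  have adj: "hinner H z (\<pi> g y) = hinner H (\<pi> (inv\<^bsub>G\<^esub> g) z) y"
    if "g \<in> carrier G" "z \<in> carrier H" "y \<in> carrier H" for g y z
  proof -
    have "\<pi> g (\<pi> (inv\<^bsub>G\<^esub> g) z) = z"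
      using that rep.rep_mult[of g "inv\<^bsub>G\<^esub> g" z] rep.rep_one by simp
    then show ?thesis
      using that rep.rep_hinner[of g "\<pi> (inv\<^bsub>G\<^esub> g) z" y] by simp
  qed
  have C_closed: "closedin HM.mtopology C"
    unfolding HM.metric_closedin_iff_sequentially_closed
  proof (intro conjI allI impI)
    fix s l assume s: "range s \<subseteq> C \<and> limitin HM.mtopology s l sequentially"
    then have l: "l \<in> carrier H"
      unfolding HM.limit_metric_sequentially by blast
    have "hinner H z l = 0" if z: "z \<in> orth" for z
    proof (rule ccontr)
      assume nz: "hinner H z l \<noteq> 0"
      have zH: "z \<in> carrier H" using z by (simp add: orth_def)
      have bound: "cmod (hinner H z l) \<le> hnorm H z * hdist H (s n) l" for n
      proof -
        have sn: "s n \<in> C" using s by auto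
        then have snH: "s n \<in> carrier H" "hinner H z (s n) = 0"
          using z by (auto simp: C_def)
        have "hinner H z (s n \<ominus>\<^bsub>H\<^esub> l) = - hinner H z l"
          using snH zH l by (simp add: rep.hinner_minus_right)
        then have "cmod (hinner H z l) = cmod (hinner H z (s n \<ominus>\<^bsub>H\<^esub> l))"
          by simp
        also have "\<dots> \<le> hnorm H z * hnorm H (s n \<ominus>\<^bsub>H\<^esub> l)"
          using snH zH l by (intro rep.cauchy_schwarz) auto
        finally show ?thesis
          using snH l by (simp add: hdist_def)
      qed
      then have pos: "0 < hnorm H z"
        using nz rep.hnorm_nonneg[OF zH] by (metis less_eq_real_def mult_zero_left norm_le_zero_iff)
      then have "0 < cmod (hinner H z l) / hnorm H z"
        using nz by simp
      then obtain n where "hdist H (s n) l < cmod (hinner H z l) / hnorm H z"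
        using s unfolding HM.limit_metric_sequentially by blast
      then show False
        using bound[of n] pos by (simp add: less_divide_eq mult.commute)
    qed
    with l show "l \<in> C" by (simp add: C_def)
  qed (auto simp: C_def)
  have C_inv: "\<pi> g y \<in> C" if g: "g \<in> carrier G" and y: "y \<in> C" for g y
  proof -
    have "\<pi> (inv\<^bsub>G\<^esub> g) z \<in> orth" if "z \<in> orth" for z
    proof -
      have "hinner H (\<pi> (inv\<^bsub>G\<^esub> g) z) (\<pi> h x) = 0" if h: "h \<in> carrier G" for h
      proof -
        have "hinner H z (\<pi> (g \<otimes>\<^bsub>G\<^esub> h) x) = 0" "z \<in> carrier H"
          using g h \<open>z \<in> orth\<close> by (auto simp: orth_def)
        then show ?thesis
          using adj[of g z "\<pi> h x"] rep.rep_mult[of g h x] g h x by simp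
      qed
      with that g show ?thesis by (simp add: orth_def)
    qed
    then show ?thesis
      using g y adj[of g _ y] by (auto simp: C_def orth_def)
  qed
  have C_inj: "inj_on \<Phi> C"
  proof (rule inj_onI)
    fix y z assume yz: "y \<in> C" "z \<in> C" "\<Phi> y = \<Phi> z"
    then have yzH: "y \<in> carrier H" "z \<in> carrier H" by (auto simp: C_def)
    define w where "w = y \<ominus>\<^bsub>H\<^esub> z"
    have w: "w \<in> carrier H" using yzH by (simp add: w_def)
    have "hinner H w (\<pi> g x) = 0" if g: "g \<in> carrier G" for g
    proof -
      have "hinner H (\<pi> g x) w = 0"
        using g yzH x fun_cong[OF yz(3), of g] by (simp add: w_def rep.hinner_minus_right \<Phi>_def)
      then show ?thesis
        using rep.hinner_commute[of w "\<pi> g x"] g x w by simp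
    qed
    then have "w \<in> orth" using w by (simp add: orth_def)
    moreover have "hinner H u w = 0" if "u \<in> orth" for u
      using that yz yzH by (simp add: w_def C_def orth_def rep.hinner_minus_right)
    ultimately have "hinner H w w = 0" by blast
    then have "hdist H y z = 0"
      using yzH by (simp add: hdist_def hnorm_def w_def)
    then show "y = z"
      using yzH by simp
  qed
  have C_sub: "C \<subseteq> carrier H" "\<zero>\<^bsub>H\<^esub> \<in> C"
    by (auto simp: C_def orth_def)
  have C_add: "y \<oplus>\<^bsub>H\<^esub> z \<in> C" if "y \<in> C" "z \<in> C" for y z
    using that by (auto simp: C_def orth_def rep.hinner_add_right)
  have C_smult: "c \<odot>\<^bsub>H\<^esub> y \<in> C" if "y \<in> C" for c y
    using that by (auto simp: C_def orth_def rep.hinner_smult_right)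
  obtain K :: "('g \<Rightarrow> complex) hilbert" and \<rho> where K: "unitary_rep G T K \<rho>"
    "carrier K = \<Phi> ` C" "\<zero>\<^bsub>K\<^esub> = \<Phi> \<zero>\<^bsub>H\<^esub>" "\<forall>x\<in>C. hnorm K (\<Phi> x) = hnorm H x"
    "\<forall>x\<in>C. \<forall>y\<in>C. hdist K (\<Phi> x) (\<Phi> y) = hdist H x y"
    "\<forall>g\<in>carrier G. \<forall>x\<in>C. \<rho> g (\<Phi> x) = \<Phi> (\<pi> g x)"
    using unitary_rep_transport[OF rep C_sub C_closed C_add C_smult C_inv C_inj] by blast
  have "hinner H z x = 0" if "z \<in> orth" for z
  proof -
    have "hinner H z (\<pi> \<one>\<^bsub>G\<^esub> x) = 0"
      using that unfolding orth_def by blast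
    then show ?thesis
      using rep.rep_one[OF x(1)] by simp
  qed
  then have xC: "x \<in> C" using x by (simp add: C_def)
  have "\<Phi> x \<noteq> \<zero>\<^bsub>K\<^esub>"
    using K(3) C_inj C_sub xC x by (metis inj_onD)
  moreover have "hdist K (\<rho> g (\<Phi> x)) (\<Phi> x) < \<epsilon> * hnorm K (\<Phi> x)" if "g \<in> Q" for g
    using that Q K C_inv xC x by (simp add: subset_iff)
  ultimately have "\<exists>x\<in>carrier K. x \<noteq> \<zero>\<^bsub>K\<^esub> \<and> (\<forall>g\<in>Q. hdist K (\<rho> g x) x < \<epsilon> * hnorm K x)"
    using K(2) xC by (intro bexI[of _ "\<Phi> x"]) auto
  then obtain y where y: "y \<in> carrier K" "y \<noteq> \<zero>\<^bsub>K\<^esub>" "\<forall>g\<in>carrier G. \<rho> g y = y"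
    using assms(1)[unfolded kazhdan_pair_def, THEN spec, THEN spec, THEN mp, OF K(1)] by meson
  from y(1) obtain z where z: "z \<in> C" "y = \<Phi> z"
    unfolding K(2) by (elim imageE)
  have "z \<noteq> \<zero>\<^bsub>H\<^esub>"
    using y(2) z(2) K(3) by metis
  moreover have "\<pi> g z = z" if g: "g \<in> carrier G" for g
  proof (rule inj_onD[OF C_inj _ C_inv[OF g z(1)] z(1)])
    have "\<rho> g (\<Phi> z) = \<Phi> (\<pi> g z)"
      using K(6) g z(1) by blast
    moreover have "\<rho> g (\<Phi> z) = \<Phi> z"
      using y(3) g z(2) by blast
    ultimately show "\<Phi> (\<pi> g z) = \<Phi> z"
      by simp
  qed
  ultimately show "\<exists>y\<in>carrier H. y \<noteq> \<zero>\<^bsub>H\<^esub> \<and> (\<forall>g\<in>carrier G. \<pi> g y = y)"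
    using z(1) C_sub(1) by blast
qed


section \<open>Complex Hilbert spaces as types\<close>

class complex_hilbert = real_inner + complete_space +
  fixes scaleC :: "complex \<Rightarrow> 'a \<Rightarrow> 'a" (infixr \<open>*\<^sub>C\<close> 75)
    and cinner :: "'a \<Rightarrow> 'a \<Rightarrow> complex"
  assumes scaleC_add_right: "c *\<^sub>C (x + y) = c *\<^sub>C x + c *\<^sub>C y"
    and scaleC_add_left: "(c + d) *\<^sub>C x = c *\<^sub>C x + d *\<^sub>C x"
    and scaleC_scaleC: "c *\<^sub>C d *\<^sub>C x = (c * d) *\<^sub>C x"
    and scaleR_scaleC: "r *\<^sub>R x = complex_of_real r *\<^sub>C x"
    and cinner_commute: "cinner x y = cnj (cinner y x)"
    and cinner_add_right: "cinner x (y + z) = cinner x y + cinner x z"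
    and cinner_scaleC_right: "cinner x (c *\<^sub>C y) = c * cinner x y"
    and inner_cinner: "inner x y = Re (cinner x y)"

definition hilbert_of_type :: "'m::complex_hilbert hilbert" where
  "hilbert_of_type =
     \<lparr>carrier = UNIV, monoid.mult = undefined, one = undefined, ring.zero = 0, add = (+),
      smult = (*\<^sub>C), hinner = cinner\<rparr>"

abbreviation unitary_module ::
  "('g, 'x) monoid_scheme \<Rightarrow> 'g topology \<Rightarrow> ('g \<Rightarrow> 'm::complex_hilbert \<Rightarrow> 'm) \<Rightarrow> bool" where
  "unitary_module G T \<pi> \<equiv> unitary_rep G T hilbert_of_type \<pi>"

lemma hilbert_of_type_simps [simp]:
  "carrier hilbert_of_type = UNIV" "\<zero>\<^bsub>hilbert_of_type\<^esub> = 0"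
  "x \<oplus>\<^bsub>hilbert_of_type\<^esub> y = x + y" "c \<odot>\<^bsub>hilbert_of_type\<^esub> x = c *\<^sub>C x"
  "hinner hilbert_of_type x y = cinner x y"
  by (auto simp: hilbert_of_type_def)

lemma inner_product_space_of_type:
  "inner_product_space (hilbert_of_type :: 'm::complex_hilbert hilbert)"
proof -
  have ab: "abelian_group (hilbert_of_type :: 'm hilbert)"
  proof (rule abelian_groupI)
    fix x :: 'm
    show "\<exists>y\<in>carrier hilbert_of_type. y \<oplus>\<^bsub>hilbert_of_type\<^esub> x = \<zero>\<^bsub>hilbert_of_type\<^esub>"
      by (rule bexI[of _ "- x"]) auto
  qed (auto simp: add_ac)
  have "Module.module complex_ring (hilbert_of_type :: 'm hilbert)"
  proof (intro Module.module.intro complex_ring_cring ab Module.module_axioms.intro)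
    fix x :: 'm
    show "\<one>\<^bsub>complex_ring\<^esub> \<odot>\<^bsub>hilbert_of_type\<^esub> x = x"
      using scaleR_scaleC[of 1 x] by (simp add: complex_ring_def)
  qed (auto simp: complex_ring_def scaleC_add_left scaleC_add_right scaleC_scaleC)
  then show ?thesis
  proof (rule inner_product_space.intro, unfold_locales)
    fix x :: 'm assume "x \<noteq> \<zero>\<^bsub>hilbert_of_type\<^esub>"
    then show "0 < Re (hinner hilbert_of_type x x)"
      by (simp flip: inner_cinner)
  qed (auto simp: cinner_add_right cinner_scaleC_right intro: cinner_commute)
qed

lemma hdist_hilbert_of_type: "hdist hilbert_of_type = (dist :: 'm::complex_hilbert \<Rightarrow> _)"
proof (intro ext)
  fix x y :: 'm
  interpret hilbert_of_type: inner_product_space "hilbert_of_type :: 'm hilbert"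
    by (rule inner_product_space_of_type)
  have "\<ominus>\<^bsub>hilbert_of_type\<^esub> y = - y"
    by (rule hilbert_of_type.minus_equality) auto
  then have "x \<ominus>\<^bsub>hilbert_of_type\<^esub> y = x - y"
    by (simp add: a_minus_def)
  then show "hdist hilbert_of_type x y = dist x y"
    by (simp add: hdist_def hnorm_def dist_norm norm_eq_sqrt_inner inner_cinner)
qed

lemma hilbert_space_of_type: "hilbert_space (hilbert_of_type :: 'm::complex_hilbert hilbert)"
  by (intro hilbert_space.intro hilbert_space_axioms.intro inner_product_space_of_type)
    (simp add: hdist_hilbert_of_type complete_UNIV)

lemma unitary_module_iff:
  fixes \<pi> :: "'g \<Rightarrow> 'm::complex_hilbert \<Rightarrow> 'm"
  shows "unitary_module G T \<pi> \<longleftrightarrow>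
    topological_group G T \<and>
    (\<forall>g\<in>carrier G. \<forall>x y. \<pi> g (x + y) = \<pi> g x + \<pi> g y) \<and>
    (\<forall>g\<in>carrier G. \<forall>c x. \<pi> g (c *\<^sub>C x) = c *\<^sub>C \<pi> g x) \<and>
    (\<forall>g\<in>carrier G. \<forall>x y. cinner (\<pi> g x) (\<pi> g y) = cinner x y) \<and>
    (\<forall>x. \<pi> \<one>\<^bsub>G\<^esub> x = x) \<and>
    (\<forall>g\<in>carrier G. \<forall>h\<in>carrier G. \<forall>x. \<pi> (g \<otimes>\<^bsub>G\<^esub> h) x = \<pi> g (\<pi> h x)) \<and>
    (\<forall>x. continuous_map T euclidean (\<lambda>g. \<pi> g x))"
  by (auto simp: unitary_rep_def unitary_rep_axioms_def hilbert_space_of_type hdist_hilbert_of_type)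

definition fixed_vectors :: "('g \<Rightarrow> 'm \<Rightarrow> 'm) \<Rightarrow> 'g set \<Rightarrow> 'm set" where
  "fixed_vectors \<pi> K = {x. \<forall>g\<in>K. \<pi> g x = x}"


section \<open>First cohomology\<close>

definition cocycles ::
  "('g, 'x) monoid_scheme \<Rightarrow> 'g topology \<Rightarrow> ('g \<Rightarrow> 'm::complex_hilbert \<Rightarrow> 'm)
    \<Rightarrow> ('g \<Rightarrow> 'm) set" where
  "cocycles G T \<pi> =
     {b \<in> extensional (carrier G). continuous_map T euclidean b \<and>
        (\<forall>g\<in>carrier G. \<forall>h\<in>carrier G. b (g \<otimes>\<^bsub>G\<^esub> h) = b g + \<pi> g (b h))}"

definition coboundaries ::
  "('g, 'x) monoid_scheme \<Rightarrow> ('g \<Rightarrow> 'm::complex_hilbert \<Rightarrow> 'm) \<Rightarrow> ('g \<Rightarrow> 'm) set" where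
  "coboundaries G \<pi> = range (\<lambda>x. \<lambda>g\<in>carrier G. \<pi> g x - x)"

definition closed_coboundaries ::
  "('g, 'x) monoid_scheme \<Rightarrow> 'g topology \<Rightarrow> ('g \<Rightarrow> 'm::complex_hilbert \<Rightarrow> 'm)
    \<Rightarrow> ('g \<Rightarrow> 'm) set" where
  "closed_coboundaries G T \<pi> =
     {b \<in> cocycles G T \<pi>. \<forall>K \<epsilon>. compactin T K \<and> \<epsilon> > 0 \<longrightarrow>
        (\<exists>c \<in> coboundaries G \<pi>. \<forall>g\<in>K. dist (b g) (c g) < \<epsilon>)}"

definition cocycle_group ::
  "('g, 'x) monoid_scheme \<Rightarrow> 'g topology \<Rightarrow> ('g \<Rightarrow> 'm::complex_hilbert \<Rightarrow> 'm)
    \<Rightarrow> ('g \<Rightarrow> 'm) monoid" where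
  "cocycle_group G T \<pi> =
     \<lparr>carrier = cocycles G T \<pi>, monoid.mult = (\<lambda>b c. \<lambda>g\<in>carrier G. b g + c g),
      one = (\<lambda>g\<in>carrier G. 0)\<rparr>"

definition H1 ::
  "('g, 'x) monoid_scheme \<Rightarrow> 'g topology \<Rightarrow> ('g \<Rightarrow> 'm::complex_hilbert \<Rightarrow> 'm)
    \<Rightarrow> ('g \<Rightarrow> 'm) set monoid" where
  "H1 G T \<pi> = cocycle_group G T \<pi> Mod coboundaries G \<pi>"

definition reduced_H1 ::
  "('g, 'x) monoid_scheme \<Rightarrow> 'g topology \<Rightarrow> ('g \<Rightarrow> 'm::complex_hilbert \<Rightarrow> 'm)
    \<Rightarrow> ('g \<Rightarrow> 'm) set monoid" where
  "reduced_H1 G T \<pi> = cocycle_group G T \<pi> Mod closed_coboundaries G T \<pi>"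


section \<open>Graphs and trees\<close>

text \<open>
  Unlike \<^locale>\<open>bidirected_digraph\<close>, this puts no condition on \<open>arev\<close> outside the arcs, so that
  a subgraph can share \<open>arev\<close> with the ambient graph.
\<close>

locale oriented_graph = wf_digraph \<Gamma>
  for \<Gamma> :: "('v, 'e) pre_digraph" (structure) and arev :: "'e \<Rightarrow> 'e" +
  assumes arev_closed: "e \<in> arcs \<Gamma> \<Longrightarrow> arev e \<in> arcs \<Gamma>"
    and arev_arev: "e \<in> arcs \<Gamma> \<Longrightarrow> arev (arev e) = e"
    and arev_neq: "e \<in> arcs \<Gamma> \<Longrightarrow> arev e \<noteq> e"
    and tail_arev: "e \<in> arcs \<Gamma> \<Longrightarrow> tail \<Gamma> (arev e) = head \<Gamma> e"

text \<open>The closed walk along an arc and back is a \<^const>\<open>pre_digraph.cycle\<close>, but not a circuit.\<close>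

locale tree_graph = oriented_graph +
  assumes tree_connected: "Digraph_Component.connected \<Gamma>"
    and no_circuit: "cycle p \<Longrightarrow> \<exists>e. p = [e, arev e]"

locale graph_action =
  oriented_graph \<Gamma> arev + vert: group_action G "verts \<Gamma>" \<phi> + arc: group_action G "arcs \<Gamma>" \<psi>
  for G :: "('g, 'x) monoid_scheme" and \<Gamma> :: "('v, 'e) pre_digraph" and arev
    and \<phi> :: "'g \<Rightarrow> 'v \<Rightarrow> 'v" and \<psi> :: "'g \<Rightarrow> 'e \<Rightarrow> 'e" +
  assumes action_tail: "\<lbrakk>g \<in> carrier G; e \<in> arcs \<Gamma>\<rbrakk> \<Longrightarrow> tail \<Gamma> (\<psi> g e) = \<phi> g (tail \<Gamma> e)"
    and action_arev: "\<lbrakk>g \<in> carrier G; e \<in> arcs \<Gamma>\<rbrakk> \<Longrightarrow> arev (\<psi> g e) = \<psi> g (arev e)"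

locale tree_action_without_inversion = graph_action + tree_graph \<Gamma> arev +
  assumes no_inversion: "\<lbrakk>g \<in> carrier G; e \<in> arcs \<Gamma>\<rbrakk> \<Longrightarrow> \<psi> g e \<noteq> arev e"

text \<open>
  The elements of the quotient graph are the orbits, and the image of an orbit of arcs under
  \<open>tail\<close>, \<open>head\<close> or \<open>arev\<close> is again an orbit.
\<close>

definition quotient_graph ::
  "('g, 'x) monoid_scheme \<Rightarrow> ('v, 'e) pre_digraph \<Rightarrow> ('g \<Rightarrow> 'v \<Rightarrow> 'v) \<Rightarrow> ('g \<Rightarrow> 'e \<Rightarrow> 'e)
    \<Rightarrow> ('v set, 'e set) pre_digraph" where
  "quotient_graph G \<Gamma> \<phi> \<psi> =
     \<lparr>verts = orbits G (verts \<Gamma>) \<phi>, arcs = orbits G (arcs \<Gamma>) \<psi>,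
      tail = image (tail \<Gamma>), head = image (head \<Gamma>)\<rparr>"

definition orientation :: "('v, 'e) pre_digraph \<Rightarrow> ('e \<Rightarrow> 'e) \<Rightarrow> 'e set \<Rightarrow> bool" where
  "orientation Y arev A \<longleftrightarrow> A \<subseteq> arcs Y \<and> (\<forall>e\<in>arcs Y. e \<in> A \<longleftrightarrow> arev e \<notin> A)"

definition maximal_tree ::
  "('v, 'e) pre_digraph \<Rightarrow> ('e \<Rightarrow> 'e) \<Rightarrow> ('v, 'e) pre_digraph \<Rightarrow> bool" where
  "maximal_tree Y arev S \<longleftrightarrow> pre_digraph.max_subgraph Y (\<lambda>S'. tree_graph S' arev) S"


section \<open>Bass-Serre data\<close>

definition lifted_tree ::
  "('v, 'e) pre_digraph \<Rightarrow> ('e \<Rightarrow> 'e) \<Rightarrow> ('v set, 'e set) pre_digraph \<Rightarrow> 'e set set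
    \<Rightarrow> ('v set \<Rightarrow> 'v) \<Rightarrow> ('e set \<Rightarrow> 'e) \<Rightarrow> ('v, 'e) pre_digraph" where
  "lifted_tree \<Gamma> arev S A vlift elift =
     \<lparr>verts = vlift ` verts S, arcs = elift ` (arcs S \<inter> A) \<union> arev ` elift ` (arcs S \<inter> A),
      tail = tail \<Gamma>, head = head \<Gamma>\<rparr>"

locale bass_serre_data = tree_action_without_inversion +
  fixes S A vlift elift t Y
  defines "Y \<equiv> quotient_graph G \<Gamma> \<phi> \<psi>"
  assumes maximal_tree: "maximal_tree Y (image arev) S"
    and orientation: "orientation Y (image arev) A"
    and vertex_lift: "v \<in> verts Y \<Longrightarrow> vlift v \<in> v"
    and arc_lift: "e \<in> A \<Longrightarrow> elift e \<in> e"
    and tree_lift: "subgraph (lifted_tree \<Gamma> arev S A vlift elift) \<Gamma>"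
      "tree_graph (lifted_tree \<Gamma> arev S A vlift elift) arev"
    and head_lift: "e \<in> A \<Longrightarrow> head \<Gamma> (elift e) = vlift (head Y e)"
    and t_closed: "e \<in> A \<Longrightarrow> t e \<in> carrier G"
    and tail_lift: "e \<in> A \<Longrightarrow> tail \<Gamma> (elift e) = \<phi> (inv\<^bsub>G\<^esub> (t e)) (vlift (tail Y e))"
    and t_tree: "e \<in> A \<inter> arcs S \<Longrightarrow> t e = \<one>\<^bsub>G\<^esub>"

definition iota ::
  "('g, 'x) monoid_scheme \<Rightarrow> ('w, 'a) pre_digraph \<Rightarrow> 'a set \<Rightarrow> ('a \<Rightarrow> 'g)
    \<Rightarrow> ('g \<Rightarrow> 'm::complex_hilbert \<Rightarrow> 'm) \<Rightarrow> ('w \<Rightarrow> 'm) \<Rightarrow> 'a \<Rightarrow> 'm" where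
  "iota G Y A t \<pi> f = (\<lambda>e\<in>A. f (head Y e) - \<pi> (inv\<^bsub>G\<^esub> (t e)) (f (tail Y e)))"

end

theory Submission
  imports Defs
begin

text \<open>
  A cocycle \<open>b\<close> restricted to the vertex group \<open>G\<^sub>x\<close> is a coboundary because \<open>G\<^sub>x\<close> has Property (T),
  so the affine action \<open>m \<mapsto> \<pi> g m + b g\<close> admits an equivariant map \<open>u\<close> from the vertices of the tree to
  \<open>M\<close>. Its differential \<open>u (e\<^sub>+) - u (e\<^sub>-)\<close> is an alternating \<open>G\<close>-equivariant function on the arcs.
  Conversely, on a tree every such function has a potential \<open>u\<close>, unique up to a constant, and
  \<open>b g = u (g x) - \<pi> g (u x)\<close> is a cocycle not depending on \<open>x\<close>. Here \<open>b\<close> is a coboundary if and only if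
  the function on the arcs is the differential of a \<open>G\<close>-equivariant function on the vertices. Evaluation
  at the lifts turns equivariant functions into the two products and the differential into \<open>\<iota>\<close>.

  In the reduced case, a compact subset of \<open>G\<close> moves a base vertex to finitely many vertices only, as
  stabilizers are open, so approximating finitely many arc values controls \<open>b\<close> on it. Conversely, if
  \<open>u\<close> is almost invariant under the Kazhdan sets of finitely many vertex groups, its values at these
  vertices are close to fixed vectors.

  That Property (T) gives fixed points of affine isometric actions is Delorme's theorem: on the Hilbert
  space spanned by vectors \<open>e\<^sub>v\<close> with \<open>\<langle>e\<^sub>v, e\<^sub>w\<rangle> = exp (- t \<bar>v - w\<bar>\<^sup>2)\<close> the vector \<open>e\<^sub>0\<close> is almost
  invariant for small \<open>t\<close>, whereas an unbounded orbit excludes nonzero invariant vectors, since moving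
  any vector along the orbit makes it converge weakly to \<open>0\<close>. So orbits are bounded, and the
  circumcentre of an orbit is fixed.
\<close>

section \<open>Minimisation in Hilbert spaces\<close>

text \<open>Parallelogram law for \<open>x - a\<close> and \<open>y - a\<close>. The subtracted term
  \<open>(dist x y)\<^sup>2 / 4\<close> is the uniform convexity asked for in
  \<open>uniformly_convex_attains_min\<close>.\<close>

lemma norm_midpoint_diff_sq:
  fixes x y a :: "'a::real_inner"
  shows "(norm (midpoint x y - a))\<^sup>2 = ((norm (x - a))\<^sup>2 + (norm (y - a))\<^sup>2) / 2 - (dist x y)\<^sup>2 / 4"
proof -
  have "midpoint x y - a = (1/2) *\<^sub>R ((x - a) + (y - a))"
    by (simp add: midpoint_def algebra_simps) (simp flip: scaleR_add_left)
  moreover have "x - y = (x - a) - (y - a)" by simp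
  ultimately show ?thesis
    unfolding dist_norm power2_norm_eq_inner
    by (simp add: inner_add_left inner_add_right inner_diff_left inner_diff_right inner_commute field_simps)
qed

text \<open>A quadratic convexity defect forces minimising sequences to be Cauchy, so completeness
  does the work of compactness. Both circumcentres and orthogonal projections come from
  this.\<close>

lemma uniformly_convex_attains_min:
  fixes f :: "'a::{real_inner,complete_space} \<Rightarrow> real"
  assumes C: "closed C" "C \<noteq> {}" "\<And>x y. x \<in> C \<Longrightarrow> y \<in> C \<Longrightarrow> midpoint x y \<in> C"
    and cont: "continuous_on C f" and nonneg: "\<And>x. x \<in> C \<Longrightarrow> 0 \<le> f x"
    and conv: "\<And>x y. x \<in> C \<Longrightarrow> y \<in> C \<Longrightarrow> f (midpoint x y) \<le> (f x + f y) / 2 - (dist x y)\<^sup>2 / 4"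
  obtains z where "z \<in> C" "\<And>x. x \<in> C \<Longrightarrow> f z \<le> f x" "\<And>x. x \<in> C \<Longrightarrow> f x \<le> f z \<Longrightarrow> x = z"
proof -
  define m where "m = Inf (f ` C)"
  have bdd: "bdd_below (f ` C)" using nonneg by (auto intro!: bdd_belowI[of _ 0])
  have m: "m \<le> f x" if "x \<in> C" for x
    unfolding m_def using bdd that by (auto intro: cInf_lower)
  \<comment> \<open>The midpoint lies in \<open>C\<close> and has value at least \<open>m\<close>,
    so the defect is controlled by the excess of \<open>f x\<close> and \<open>f y\<close> over
    \<open>m\<close>.\<close>
  have dist_le: "(dist x y)\<^sup>2 \<le> 2 * ((f x - m) + (f y - m))" if "x \<in> C" "y \<in> C" for x y
    using conv[OF that] m[OF C(3)[OF that]] by argo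
  have "\<exists>x\<in>C. f x < m + 1 / real (Suc n)" for n
    using cInf_lessD[of "f ` C" "m + 1 / real (Suc n)"] C(2) by (auto simp: m_def)
  then obtain s where s: "\<And>n. s n \<in> C" "\<And>n. f (s n) < m + 1 / real (Suc n)" by metis
  have "Cauchy s"
  proof (rule metric_CauchyI)
    fix e :: real assume e: "e > 0"
    then obtain N where N: "1 / real (Suc N) < e\<^sup>2 / 4"
      using nat_approx_posE[of "e\<^sup>2 / 4"] by auto
    have "dist (s i) (s j) < e" if "N \<le> i" "N \<le> j" for i j
    proof -
      have "1 / real (Suc i) \<le> 1 / real (Suc N)" "1 / real (Suc j) \<le> 1 / real (Suc N)"
        using that by (auto simp: frac_le)
      then have "(dist (s i) (s j))\<^sup>2 < e\<^sup>2"
        using dist_le[of "s i" "s j"] s(1) s(2)[of i] s(2)[of j] N by fastforce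
      then show ?thesis using e by (simp add: power2_less_imp_less)
    qed
    then show "\<exists>M. \<forall>i\<ge>M. \<forall>j\<ge>M. dist (s i) (s j) < e" by blast
  qed
  then obtain z where z: "s \<longlonglongrightarrow> z" using Cauchy_convergent convergent_def by blast
  then have zC: "z \<in> C" using C(1) s(1) closed_sequentially by blast
  have "(\<lambda>n. f (s n)) \<longlonglongrightarrow> f z"
    using continuous_on_tendsto_compose[OF cont z zC] s(1) by simp
  moreover have "(\<lambda>n. m + 1 / real (Suc n)) \<longlonglongrightarrow> m + 0"
    by (intro tendsto_add tendsto_const LIMSEQ_inverse_real_of_nat[unfolded inverse_eq_divide])
  ultimately have "f z \<le> m"
    using s(2) by (intro LIMSEQ_le[of "\<lambda>n. f (s n)" _ "\<lambda>n. m + 1 / real (Suc n)" m]) (auto intro: less_imp_le)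
  moreover have "x = z" if "x \<in> C" "f x \<le> f z" for x
  proof -
    have "2 * ((f x - m) + (f z - m)) \<le> 0" using that(2) \<open>f z \<le> m\<close> by simp
    then have "(dist x z)\<^sup>2 \<le> 0" using dist_le[OF that(1) zC] by (rule order_trans[rotated])
    then show ?thesis by simp
  qed
  ultimately show ?thesis using that[OF zC] m by (meson order_trans)
qed

text \<open>The function \<open>r\<close> gives the radius of the smallest closed ball around a
  point that contains \<open>S\<close>. Its square inherits the convexity defect of the squared
  distances, so it has a unique minimiser, and this one point serves every \<open>h\<close>.\<close>

lemma circumcentre:
  fixes S :: "'a::{real_inner,complete_space} set"
  assumes S: "bounded S" "S \<noteq> {}"
  obtains z where "\<And>h. (\<And>x y. dist (h x) (h y) = dist x y) \<Longrightarrow> h ` S = S \<Longrightarrow> h z = z"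
proof -
  define r where "r = (\<lambda>x. SUP s\<in>S. dist x s)"
  have bdd: "bdd_above ((\<lambda>s. dist x s) ` S)" for x
    using S(1) by (meson bounded_any_center bdd_aboveI2)
  have upper: "dist x s \<le> r x" if "s \<in> S" for x s
    unfolding r_def by (rule cSUP_upper[OF that bdd])
  have least: "r x \<le> c" if "\<And>s. s \<in> S \<Longrightarrow> dist x s \<le> c" for x c
    unfolding r_def using S(2) that by (rule cSUP_least)
  have nonneg: "0 \<le> r x" for x
    using S(2) upper[of _ x] zero_le_dist order_trans by blast
  have lip: "r x \<le> r y + dist x y" for x y
  proof (rule least)
    fix s assume "s \<in> S"
    then show "dist x s \<le> r y + dist x y"
      using upper[of s y] dist_triangle[of x s y] by linarith
  qed
  have "(1::real)-lipschitz_on UNIV r"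
  proof (rule lipschitz_onI)
    fix x y show "dist (r x) (r y) \<le> 1 * dist x y"
      using lip[of x y] lip[of y x] by (simp add: dist_real_def dist_commute abs_le_iff)
  qed simp
  then have "continuous_on UNIV (\<lambda>x. (r x)\<^sup>2)"
    by (intro continuous_on_power lipschitz_on_continuous_on)
  moreover have "(r (midpoint x y))\<^sup>2 \<le> ((r x)\<^sup>2 + (r y)\<^sup>2) / 2 - (dist x y)\<^sup>2 / 4" (is "_ \<le> ?c") for x y
  proof -
    have le: "(dist (midpoint x y) s)\<^sup>2 \<le> ?c" if "s \<in> S" for s
    proof -
      have "(dist x s)\<^sup>2 \<le> (r x)\<^sup>2" "(dist y s)\<^sup>2 \<le> (r y)\<^sup>2"
        using upper[OF that] by (auto intro: power_mono)
      then show ?thesis using norm_midpoint_diff_sq[of x y s] by (simp add: dist_norm)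
    qed
    have "r (midpoint x y) \<le> sqrt ?c"
      by (intro least real_le_rsqrt le)
    moreover have "0 \<le> ?c" using le S(2) zero_le_power2 order_trans by blast
    ultimately show ?thesis
      using power_mono[of "r (midpoint x y)" "sqrt ?c" 2] nonneg by simp
  qed
  ultimately obtain z where z: "\<And>x. (r x)\<^sup>2 \<le> (r z)\<^sup>2 \<Longrightarrow> x = z"
    by (elim uniformly_convex_attains_min[of UNIV "\<lambda>x. (r x)\<^sup>2", rotated 3]) auto
  \<comment> \<open>Since \<open>h\<close> permutes \<open>S\<close> isometrically,
    \<open>r (h z) \<le> r z\<close>; uniqueness of the minimiser then gives
    \<open>h z = z\<close>.\<close>
  have "h z = z" if h: "\<And>x y. dist (h x) (h y) = dist x y" "h ` S = S" for h
  proof (rule z, rule power_mono[OF least nonneg])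
    fix s assume "s \<in> S"
    then obtain s' where "s' \<in> S" "s = h s'" using h(2) by blast
    then show "dist (h z) s \<le> r z" using upper h(1) by simp
  qed
  then show ?thesis using that by blast
qed

text \<open>The nearest point of \<open>C\<close> to \<open>x\<close> has this property.
  Orthogonality refers to the real inner product.\<close>

lemma orthogonal_projection_exists:
  fixes C :: "'a::{real_inner,complete_space} set"
  assumes C: "closed C" "subspace C"
  obtains z where "z \<in> C" "\<And>y. y \<in> C \<Longrightarrow> inner (x - z) y = 0"
proof -
  have mid: "midpoint u v \<in> C" if "u \<in> C" "v \<in> C" for u v
    unfolding midpoint_def using C(2) that by (intro subspace_scale subspace_add)
  obtain z where z: "z \<in> C" "\<And>y. y \<in> C \<Longrightarrow> (norm (z - x))\<^sup>2 \<le> (norm (y - x))\<^sup>2"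
  proof (rule uniformly_convex_attains_min[of C "\<lambda>y. (norm (y - x))\<^sup>2"])
    show "C \<noteq> {}" using C(2) subspace_0 by auto
  qed (use C mid in \<open>auto intro!: continuous_intros simp: norm_midpoint_diff_sq\<close>)
  have "inner (x - z) y = 0" if y: "y \<in> C" for y
  proof (rule ccontr)
    assume nz: "inner (x - z) y \<noteq> 0"
    \<comment> \<open>This \<open>a\<close> minimises the distance from \<open>x - z\<close> to the
      line spanned by \<open>y\<close>, so a nonzero inner product would give a point of
      \<open>C\<close> nearer to \<open>x\<close> than \<open>z\<close>.\<close>
    define a where "a = inner (x - z) y / (norm y)\<^sup>2"
    have ny: "norm y > 0" using nz by auto
    have "z + a *\<^sub>R y \<in> C" using C(2) z(1) y by (intro subspace_add subspace_scale)
    then have "(norm (x - z))\<^sup>2 \<le> (norm (x - z - a *\<^sub>R y))\<^sup>2"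
      using z(2)[of "z + a *\<^sub>R y"] by (simp add: norm_minus_commute algebra_simps)
    also have "\<dots> = (norm (x - z))\<^sup>2 - 2 * a * inner (x - z) y + a\<^sup>2 * (norm y)\<^sup>2"
      unfolding power2_norm_eq_inner
      by (simp add: inner_diff_left inner_diff_right inner_commute power2_eq_square algebra_simps)
    also have "\<dots> = (norm (x - z))\<^sup>2 - (inner (x - z) y)\<^sup>2 / (norm y)\<^sup>2"
      using ny by (simp add: a_def field_simps power2_eq_square)
    finally show False using nz ny by (simp add: field_simps)
  qed
  then show ?thesis using z(1) that by blast
qed

section \<open>The Gaussian kernel\<close>

text \<open>Tested on real coefficients: complex ones are later separated into real and imaginary
  parts.\<close>

definition pos_def_kernel :: "('i \<Rightarrow> 'i \<Rightarrow> real) \<Rightarrow> bool" where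
  "pos_def_kernel K \<longleftrightarrow>
     (\<forall>S c. finite S \<longrightarrow> 0 \<le> (\<Sum>i\<in>S. \<Sum>j\<in>S. c i * c j * K i j))"

text \<open>Schur product theorem for \<open>K\<close> and a Gram matrix. Each induction step splits
  off the direction of one vector: this direction contributes a quadratic form of \<open>K\<close>,
  and after projection that vector is zero and drops out of the sum.\<close>

lemma pos_def_kernel_sum_inner:
  fixes v :: "'i \<Rightarrow> 'a::real_inner"
  assumes K: "pos_def_kernel K" and S: "finite S"
  shows "0 \<le> (\<Sum>i\<in>S. \<Sum>j\<in>S. K i j * inner (v i) (v j))"
  using S
proof (induction S arbitrary: v rule: finite_induct)
  case (insert s S)
  text \<open>Project all vectors onto the orthogonal complement of the new one.\<close>
  define e where "e = sgn (v s)"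
  define w where "w = (\<lambda>i. v i - inner (v i) e *\<^sub>R e)"
  have ee: "e = 0 \<or> inner e e = 1"
    by (simp add: e_def dot_square_norm norm_sgn)
  \<comment> \<open>As \<open>e\<close> is zero or a unit vector, the mixed terms cancel in both
    cases.\<close>
  have split: "K i j * inner (v i) (v j)
      = inner (v i) e * inner (v j) e * K i j + K i j * inner (w i) (w j)" for i j
    using ee by (auto simp: w_def inner_diff_left inner_diff_right inner_commute algebra_simps)
  have ws: "w s = 0"
  proof (cases "v s = 0")
    case False
    have "inner (v s) e = norm (v s)"
      by (simp add: e_def sgn_div_norm divide_inverse[symmetric] flip: norm_eq_square power2_norm_eq_inner)
        (use False in \<open>simp add: power2_eq_square\<close>)
    with False show ?thesis by (simp add: w_def e_def sgn_div_norm)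
  qed (simp add: w_def)
  have "0 \<le> (\<Sum>i\<in>insert s S. \<Sum>j\<in>insert s S. inner (v i) e * inner (v j) e * K i j)"
    using K[unfolded pos_def_kernel_def, rule_format, of "insert s S" "\<lambda>i. inner (v i) e"]
      insert.hyps(1) by simp
  moreover have "(\<Sum>i\<in>insert s S. \<Sum>j\<in>insert s S. K i j * inner (w i) (w j))
      = (\<Sum>i\<in>S. \<Sum>j\<in>S. K i j * inner (w i) (w j))"
    using insert.hyps ws by simp
  ultimately show ?case
    using insert.IH[of w] by (simp only: split sum.distrib)
qed simp

lemma pos_def_kernel_mult_inner:
  fixes v :: "'i \<Rightarrow> 'a::real_inner"
  assumes "pos_def_kernel K"
  shows "pos_def_kernel (\<lambda>i j. K i j * inner (v i) (v j))"
  unfolding pos_def_kernel_def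
proof (intro allI impI)
  fix S :: "'i set" and c :: "'i \<Rightarrow> real" assume "finite S"
  then show "0 \<le> (\<Sum>i\<in>S. \<Sum>j\<in>S. c i * c j * (K i j * inner (v i) (v j)))"
    using pos_def_kernel_sum_inner[OF assms, of S "\<lambda>i. c i *\<^sub>R v i"] by (simp add: mult_ac)
qed

text \<open>The constant kernel 1 yields the square of the sum of the coefficients; each further
  power is one application of the Schur product.\<close>

lemma pos_def_kernel_inner_power:
  fixes v :: "'i \<Rightarrow> 'a::real_inner"
  shows "pos_def_kernel (\<lambda>i j. (inner (v i) (v j)) ^ n)"
proof (induction n)
  case 0
  have "(\<Sum>i\<in>S. \<Sum>j\<in>S. c i * c j) = (\<Sum>i\<in>S. c i)\<^sup>2" for S and c :: "'i \<Rightarrow> real"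
    by (simp add: power2_eq_square sum_product)
  then show ?case by (simp add: pos_def_kernel_def)
next
  case (Suc n)
  then show ?case
    using pos_def_kernel_mult_inner[OF Suc, of v] by (simp add: mult.commute)
qed

text \<open>The exponential series combines the powers with nonnegative coefficients, and
  nonnegativity passes to the sum of the series.\<close>

lemma pos_def_kernel_exp_inner:
  fixes v :: "'i \<Rightarrow> 'a::real_inner"
  shows "pos_def_kernel (\<lambda>i j. exp (inner (v i) (v j)))"
  unfolding pos_def_kernel_def
proof (intro allI impI)
  fix S :: "'i set" and c :: "'i \<Rightarrow> real" assume S: "finite S"
  have "(\<lambda>n. \<Sum>i\<in>S. \<Sum>j\<in>S. c i * c j * (inner (v i) (v j) ^ n /\<^sub>R fact n))
      sums (\<Sum>i\<in>S. \<Sum>j\<in>S. c i * c j * exp (inner (v i) (v j)))"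
    by (intro sums_sum sums_mult exp_converges)
  moreover have "0 \<le> (\<Sum>i\<in>S. \<Sum>j\<in>S. c i * c j * (inner (v i) (v j) ^ n /\<^sub>R fact n))" for n
  proof -
    have "(\<Sum>i\<in>S. \<Sum>j\<in>S. c i * c j * (inner (v i) (v j) ^ n /\<^sub>R fact n))
        = (\<Sum>i\<in>S. \<Sum>j\<in>S. c i * c j * inner (v i) (v j) ^ n) / fact n"
      by (simp add: sum_divide_distrib divide_inverse sum_distrib_left mult_ac)
    then show ?thesis
      using pos_def_kernel_inner_power[of v n] S by (simp add: pos_def_kernel_def)
  qed
  ultimately show "0 \<le> (\<Sum>i\<in>S. \<Sum>j\<in>S. c i * c j * exp (inner (v i) (v j)))"
    by (rule sums_le[OF _ sums_zero, rotated])
qed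

text \<open>Expanding the squared distance factors the Gaussian into one factor in
  \<open>v i\<close>, one in \<open>v j\<close> and the exponential of an inner product. The first
  two are absorbed into the coefficients \<open>d\<close>; the rescaling in \<open>w\<close>
  accounts for the factor \<open>2 * t\<close>.\<close>

lemma pos_def_kernel_gaussian:
  fixes v :: "'i \<Rightarrow> 'a::real_inner"
  assumes "0 \<le> t"
  shows "pos_def_kernel (\<lambda>i j. exp (- t * (dist (v i) (v j))\<^sup>2))"
  unfolding pos_def_kernel_def
proof (intro allI impI)
  fix S :: "'i set" and c :: "'i \<Rightarrow> real" assume S: "finite S"
  define d where "d = (\<lambda>i. c i * exp (- t * (norm (v i))\<^sup>2))"
  define w where "w = (\<lambda>i. sqrt (2 * t) *\<^sub>R v i)"
  have "c i * c j * exp (- t * (dist (v i) (v j))\<^sup>2) = d i * d j * exp (inner (w i) (w j))" for i j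
  proof -
    have "inner (w i) (w j) = 2 * t * inner (v i) (v j)"
      using assms by (simp add: w_def)
    moreover have "- t * (dist (v i) (v j))\<^sup>2
        = - t * (norm (v i))\<^sup>2 + - t * (norm (v j))\<^sup>2 + 2 * t * inner (v i) (v j)"
      unfolding dist_norm power2_norm_eq_inner
      by (simp add: inner_diff_left inner_diff_right inner_commute algebra_simps)
    ultimately have "exp (- t * (dist (v i) (v j))\<^sup>2)
        = exp (- t * (norm (v i))\<^sup>2) * exp (- t * (norm (v j))\<^sup>2) * exp (inner (w i) (w j))"
      by (simp only: exp_add)
    then show ?thesis by (simp only: d_def mult_ac)
  qed
  then show "0 \<le> (\<Sum>i\<in>S. \<Sum>j\<in>S. c i * c j * exp (- t * (dist (v i) (v j))\<^sup>2))"
    using pos_def_kernel_exp_inner[of w] S by (simp add: pos_def_kernel_def)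
qed

section \<open>Completion of a semi-inner-product space\<close>

text \<open>
  Only the form \<open>B\<close> has to be sesquilinear; no algebraic laws are required of \<open>plus\<close> and \<open>scl\<close>
  themselves. So formal linear combinations can be represented by lists. The completion consists
  of the functionals \<open>x \<mapsto> lim\<^sub>n B x (s n)\<close> for Cauchy sequences \<open>s\<close>.
\<close>

locale semi_inner_product =
  fixes plus :: "'a \<Rightarrow> 'a \<Rightarrow> 'a" and scl :: "complex \<Rightarrow> 'a \<Rightarrow> 'a" and B :: "'a \<Rightarrow> 'a \<Rightarrow> complex"
  assumes B_plus: "B x (plus y z) = B x y + B x z"
    and B_scl: "B x (scl c y) = c * B x y"
    and B_commute: "B y x = cnj (B x y)"
    and B_pos: "0 \<le> Re (B x x)"
begin

definition seminorm :: "'a \<Rightarrow> real" where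
  "seminorm x = sqrt (Re (B x x))"

definition diff :: "'a \<Rightarrow> 'a \<Rightarrow> 'a" where
  "diff x y = plus x (scl (-1) y)"

definition cauchy :: "(nat \<Rightarrow> 'a) \<Rightarrow> bool" where
  "cauchy s \<longleftrightarrow> (\<forall>\<epsilon>>0. \<exists>N. \<forall>m\<ge>N. \<forall>n\<ge>N. seminorm (diff (s m) (s n)) < \<epsilon>)"

text \<open>The functional stands for the class of \<open>s\<close>: by
  \<open>cauchy_weakly_null\<close>, sequences representing the same functional differ by a null
  sequence, so equality of functionals replaces a quotient.\<close>

definition represents :: "(nat \<Rightarrow> 'a) \<Rightarrow> ('a \<Rightarrow> complex) \<Rightarrow> bool" where
  "represents s f \<longleftrightarrow> cauchy s \<and> (\<forall>x. (\<lambda>n. B x (s n)) \<longlonglongrightarrow> f x)"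

definition embed :: "'a \<Rightarrow> 'a \<Rightarrow> complex" where
  "embed y = (\<lambda>x. B x y)"

text \<open>The inner product evaluates \<open>g\<close> along a sequence chosen for
  \<open>f\<close>; \<open>tendsto_hinner_completion\<close> shows that the choice does not
  matter.\<close>

definition completion :: "('a \<Rightarrow> complex) hilbert" where
  "completion = \<lparr>carrier = {f. \<exists>s. represents s f}, monoid.mult = undefined, one = undefined,
     ring.zero = (\<lambda>_. 0), add = (\<lambda>f g x. f x + g x), smult = (\<lambda>c f x. c * f x),
     hinner = (\<lambda>f g. lim (\<lambda>n. g ((SOME s. represents s f) n)))\<rparr>"

section \<open>The seminorm and the Cauchy-Schwarz inequality\<close>

lemma B_plus_left: "B (plus y z) x = B y x + B z x"
  by (metis B_commute B_plus complex_cnj_add)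

lemma B_scl_left: "B (scl c y) x = cnj c * B y x"
  by (metis B_commute B_scl complex_cnj_mult)

lemma B_diff: "B x (diff y z) = B x y - B x z"
  by (simp add: diff_def B_plus B_scl)

lemma B_diff_left: "B (diff y z) x = B y x - B z x"
  by (simp add: diff_def B_plus_left B_scl_left)

lemmas B_simps = B_plus B_scl B_plus_left B_scl_left B_diff B_diff_left

lemma B_self: "B x x = complex_of_real ((seminorm x)\<^sup>2)"
proof -
  have "Im (B x x) = 0"
    using B_commute[of x x] by (metis Reals_cnj_iff complex_is_Real_iff)
  then show ?thesis using B_pos[of x] by (simp add: seminorm_def complex_eq_iff)
qed

lemma seminorm_nonneg [simp]: "0 \<le> seminorm x"
  by (simp add: seminorm_def B_pos)

lemma seminorm_sq: "(seminorm x)\<^sup>2 = Re (B x x)"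
  by (simp add: seminorm_def B_pos)

lemma seminorm_cong: "B x x = B y y \<Longrightarrow> seminorm x = seminorm y"
  by (simp add: seminorm_def)

text \<open>The form may be degenerate, so the quadratic inequality \<open>quad\<close> is kept for
  all real \<open>r\<close>: a large \<open>r\<close> settles the case of a null vector
  \<open>y\<close>, and the optimal \<open>r = 1 / N\<close> the other one.\<close>

lemma cauchy_schwarz: "cmod (B x y) \<le> seminorm x * seminorm y"
proof -
  define p where "p = cmod (B x y)"
  have quad: "0 \<le> (seminorm x)\<^sup>2 - 2 * r * p\<^sup>2 + r\<^sup>2 * p\<^sup>2 * (seminorm y)\<^sup>2" for r :: real
  proof -
    define c where "c = - complex_of_real r * cnj (B x y)"
    have "B (plus x (scl c y)) (plus x (scl c y))
        = B x x + c * B x y + cnj (c * B x y) + c * cnj c * B y y"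
      using B_commute[of y x] by (simp add: B_simps algebra_simps)
    moreover have "c * B x y = complex_of_real (- r * p\<^sup>2)"
      using complex_norm_square[of "B x y"] by (simp add: c_def p_def mult_ac)
    moreover have "c * cnj c = complex_of_real (r\<^sup>2 * p\<^sup>2)"
      using complex_norm_square[of "B x y"] by (simp add: c_def p_def mult_ac power2_eq_square)
    ultimately have "Re (B (plus x (scl c y)) (plus x (scl c y)))
        = (seminorm x)\<^sup>2 - 2 * r * p\<^sup>2 + r\<^sup>2 * p\<^sup>2 * (seminorm y)\<^sup>2"
      by (simp add: B_self)
    then show ?thesis using B_pos by metis
  qed
  have "p\<^sup>2 \<le> (seminorm x)\<^sup>2 * (seminorm y)\<^sup>2"
  proof (cases "seminorm y = 0")
    case True
    have "p = 0"
    proof (rule ccontr)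
      assume "p \<noteq> 0"
      \<comment> \<open>With \<open>seminorm y = 0\<close>, this value of \<open>r\<close> makes the
        right-hand side of \<open>quad\<close> equal to -1.\<close>
      then show False
        using quad[of "((seminorm x)\<^sup>2 + 1) / (2 * p\<^sup>2)"] True by (simp add: field_simps)
    qed
    then show ?thesis by simp
  next
    case False
    define N where "N = (seminorm y)\<^sup>2"
    have N: "N > 0" using False by (simp add: N_def)
    have "0 \<le> (seminorm x)\<^sup>2 - 2 * (1 / N) * p\<^sup>2 + (1 / N)\<^sup>2 * p\<^sup>2 * N"
      using quad[of "1 / N"] by (simp only: N_def)
    also have "\<dots> = (seminorm x)\<^sup>2 - p\<^sup>2 / N"
      using N by (simp add: power2_eq_square)
    finally show ?thesis using N by (simp add: pos_divide_le_eq N_def)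
  qed
  then show ?thesis
    by (metis p_def power_mult_distrib power2_le_imp_le seminorm_nonneg mult_nonneg_nonneg)
qed

lemma seminorm_plus: "seminorm (plus x y) \<le> seminorm x + seminorm y"
proof (rule power2_le_imp_le)
  have "(seminorm (plus x y))\<^sup>2 = (seminorm x)\<^sup>2 + 2 * Re (B x y) + (seminorm y)\<^sup>2"
    using B_commute[of y x] by (simp add: seminorm_sq B_simps)
  moreover have "Re (B x y) \<le> seminorm x * seminorm y"
    using cauchy_schwarz complex_Re_le_cmod order_trans by blast
  ultimately show "(seminorm (plus x y))\<^sup>2 \<le> (seminorm x + seminorm y)\<^sup>2"
    by (simp add: power2_sum)
qed simp

lemma seminorm_scl: "seminorm (scl c x) = cmod c * seminorm x"
proof -
  have "(seminorm (scl c x))\<^sup>2 = Re ((c * cnj c) * B x x)"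
    by (simp only: seminorm_sq B_simps) (simp add: mult_ac)
  also have "\<dots> = (cmod c * seminorm x)\<^sup>2"
    by (simp add: B_self power_mult_distrib complex_mult_cnj cmod_power2)
  finally show ?thesis by (simp add: power2_eq_iff_nonneg)
qed

section \<open>Cauchy sequences and the functionals they represent\<close>

lemma cauchyD:
  assumes "cauchy s" "\<epsilon> > 0"
  obtains N where "\<And>m n. m \<ge> N \<Longrightarrow> n \<ge> N \<Longrightarrow> seminorm (diff (s m) (s n)) < \<epsilon>"
  using assms unfolding cauchy_def by blast

lemma cauchy_plus:
  assumes "cauchy s" "cauchy r"
  shows "cauchy (\<lambda>n. plus (s n) (r n))"
  unfolding cauchy_def
proof (intro allI impI)
  fix \<epsilon> :: real assume "\<epsilon> > 0"
  then obtain M N where M: "\<And>m n. m \<ge> M \<Longrightarrow> n \<ge> M \<Longrightarrow> seminorm (diff (s m) (s n)) < \<epsilon> / 2"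
    and N: "\<And>m n. m \<ge> N \<Longrightarrow> n \<ge> N \<Longrightarrow> seminorm (diff (r m) (r n)) < \<epsilon> / 2"
    using cauchyD[OF assms(1), of "\<epsilon> / 2"] cauchyD[OF assms(2), of "\<epsilon> / 2"] by (metis half_gt_zero)
  have "seminorm (diff (plus (s m) (r m)) (plus (s n) (r n))) < \<epsilon>"
    if "m \<ge> max M N" "n \<ge> max M N" for m n
  proof -
    \<comment> \<open>The two arguments may be different elements, as \<open>plus\<close> obeys no
      laws; only the form fails to distinguish them.\<close>
    have "seminorm (diff (plus (s m) (r m)) (plus (s n) (r n)))
        = seminorm (plus (diff (s m) (s n)) (diff (r m) (r n)))"
      by (rule seminorm_cong) (simp add: B_simps)
    then show ?thesis
      using seminorm_plus[of "diff (s m) (s n)" "diff (r m) (r n)"] M[of m n] N[of m n] that by simp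
  qed
  then show "\<exists>N. \<forall>m\<ge>N. \<forall>n\<ge>N. seminorm (diff (plus (s m) (r m)) (plus (s n) (r n))) < \<epsilon>"
    by blast
qed

lemma cauchy_scl:
  assumes "cauchy s"
  shows "cauchy (\<lambda>n. scl c (s n))"
  unfolding cauchy_def
proof (intro allI impI)
  fix \<epsilon> :: real assume "\<epsilon> > 0"
  then have "\<epsilon> / (cmod c + 1) > 0" by (simp add: add_nonneg_pos)
  then obtain N where N: "\<And>m n. m \<ge> N \<Longrightarrow> n \<ge> N \<Longrightarrow> seminorm (diff (s m) (s n)) < \<epsilon> / (cmod c + 1)"
    using cauchyD[OF assms] by metis
  have "seminorm (diff (scl c (s m)) (scl c (s n))) < \<epsilon>" if "m \<ge> N" "n \<ge> N" for m n
  proof -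
    have "seminorm (diff (scl c (s m)) (scl c (s n))) = seminorm (scl c (diff (s m) (s n)))"
      by (rule seminorm_cong) (simp add: B_simps algebra_simps)
    also have "\<dots> \<le> (cmod c + 1) * seminorm (diff (s m) (s n))"
      by (simp add: seminorm_scl mult_right_mono)
    also have "\<dots> < \<epsilon>"
      using N[OF that] by (simp add: add_nonneg_pos pos_less_divide_eq mult.commute)
    finally show ?thesis .
  qed
  then show "\<exists>N. \<forall>m\<ge>N. \<forall>n\<ge>N. seminorm (diff (scl c (s m)) (scl c (s n))) < \<epsilon>"
    by blast
qed

lemma cauchy_bounded:
  assumes "cauchy s"
  obtains C where "C > 0" "\<And>n. seminorm (s n) \<le> C"
proof -
  obtain N where N: "\<And>m n. m \<ge> N \<Longrightarrow> n \<ge> N \<Longrightarrow> seminorm (diff (s m) (s n)) < 1"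
    using cauchyD[OF assms, of 1] by auto
  define C where "C = 1 + (\<Sum>n\<le>N. seminorm (s n))"
  have sumN: "seminorm (s n) \<le> (\<Sum>n\<le>N. seminorm (s n))" if "n \<le> N" for n
    using that by (intro member_le_sum) auto
  have "seminorm (s n) \<le> C" for n
  proof (cases "n \<le> N")
    case True
    then show ?thesis using sumN[of n] by (simp add: C_def)
  next
    case False
    have "seminorm (s n) = seminorm (plus (diff (s n) (s N)) (s N))"
      by (rule seminorm_cong) (simp add: B_simps)
    also have "\<dots> \<le> 1 + seminorm (s N)"
      using seminorm_plus[of "diff (s n) (s N)" "s N"] N[of n N] False by simp
    finally show ?thesis using sumN[of N] by (simp add: C_def)
  qed
  moreover have "C > 0" by (simp add: C_def add_pos_nonneg sum_nonneg)
  ultimately show ?thesis using that by blast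
qed

lemma cauchy_represents:
  assumes "cauchy s"
  obtains f where "represents s f"
proof -
  have "Cauchy (\<lambda>n. B x (s n))" for x
  proof (rule CauchyI)
    fix \<epsilon> :: real assume e: "\<epsilon> > 0"
    then have "\<epsilon> / (seminorm x + 1) > 0" by (simp add: add_nonneg_pos)
    then obtain N where N: "\<And>m n. m \<ge> N \<Longrightarrow> n \<ge> N \<Longrightarrow> seminorm (diff (s m) (s n)) < \<epsilon> / (seminorm x + 1)"
      using cauchyD[OF assms] by metis
    have "cmod (B x (s m) - B x (s n)) < \<epsilon>" if "m \<ge> N" "n \<ge> N" for m n
    proof -
      have "cmod (B x (diff (s m) (s n))) \<le> (seminorm x + 1) * seminorm (diff (s m) (s n))"
        using cauchy_schwarz[of x "diff (s m) (s n)"] mult_right_mono[of "seminorm x" "seminorm x + 1"]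
        by (meson order_trans less_add_one less_imp_le seminorm_nonneg)
      also have "\<dots> < \<epsilon>"
        using N[OF that] by (simp add: add_nonneg_pos pos_less_divide_eq mult.commute)
      finally show ?thesis by (simp add: B_diff)
    qed
    then show "\<exists>M. \<forall>m\<ge>M. \<forall>n\<ge>M. cmod (B x (s m) - B x (s n)) < \<epsilon>" by blast
  qed
  then have "\<exists>l. (\<lambda>n. B x (s n)) \<longlonglongrightarrow> l" for x
    using Cauchy_convergent convergent_def by blast
  then obtain f where "\<And>x. (\<lambda>n. B x (s n)) \<longlonglongrightarrow> f x" by metis
  then show ?thesis using that[of f] assms by (simp add: represents_def)
qed

lemma represents_diff_apply:
  assumes "represents r g"
  shows "g (diff x y) = g x - g y"
proof -
  have "(\<lambda>n. B (diff x y) (r n)) \<longlonglongrightarrow> g x - g y"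
    unfolding B_diff_left using assms by (intro tendsto_diff) (auto simp: represents_def)
  then show ?thesis
    using assms LIMSEQ_unique unfolding represents_def by blast
qed

lemma represents_bounded:
  assumes "represents r g"
  obtains C where "C > 0" "\<And>x. cmod (g x) \<le> C * seminorm x"
proof -
  obtain C where C: "C > 0" "\<And>n. seminorm (r n) \<le> C"
    using assms cauchy_bounded unfolding represents_def by blast
  have "cmod (g x) \<le> C * seminorm x" for x
  proof (rule LIMSEQ_le_const2)
    show "(\<lambda>n. cmod (B x (r n))) \<longlonglongrightarrow> cmod (g x)"
      using assms by (intro tendsto_norm) (auto simp: represents_def)
    have "cmod (B x (r n)) \<le> C * seminorm x" for n
      using cauchy_schwarz[of x "r n"] mult_left_mono[OF C(2)[of n], of "seminorm x"]
      by (simp add: mult.commute)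
    then show "\<exists>N. \<forall>n\<ge>N. cmod (B x (r n)) \<le> C * seminorm x" by blast
  qed
  with C that show ?thesis by blast
qed

text \<open>The squared seminorm of \<open>d n\<close> is
  \<open>B (d n) (diff (d n) (d m)) + B (d n) (d m)\<close>. The first term is small by boundedness
  and the Cauchy property, the second by weak convergence in \<open>m\<close>.\<close>

lemma cauchy_weakly_null:
  assumes "cauchy d" "\<And>x. (\<lambda>n. B x (d n)) \<longlonglongrightarrow> 0"
  shows "(\<lambda>n. seminorm (d n)) \<longlonglongrightarrow> 0"
proof (rule LIMSEQ_I)
  fix \<epsilon> :: real assume e: "\<epsilon> > 0"
  obtain C where C: "C > 0" "\<And>n. seminorm (d n) \<le> C" using cauchy_bounded assms(1) by blast
  obtain N where N: "\<And>m n. m \<ge> N \<Longrightarrow> n \<ge> N \<Longrightarrow> seminorm (diff (d m) (d n)) < \<epsilon>\<^sup>2 / (2 * C)"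
    using cauchyD[OF assms(1), of "\<epsilon>\<^sup>2 / (2 * C)"] e C(1) by (metis divide_pos_pos zero_less_power mult_pos_pos zero_less_numeral)
  have "seminorm (d n) < \<epsilon>" if n: "n \<ge> N" for n
  proof (rule power2_less_imp_less)
    \<comment> \<open>Weak convergence is used for the fixed vector \<open>d n\<close>, so
      \<open>m\<close> depends on \<open>n\<close>.\<close>
    obtain m where m: "m \<ge> N" "cmod (B (d n) (d m)) < \<epsilon>\<^sup>2 / 2"
    proof -
      have "\<forall>\<^sub>F m in sequentially. cmod (B (d n) (d m)) < \<epsilon>\<^sup>2 / 2"
        using tendstoD[OF assms(2)[of "d n"], of "\<epsilon>\<^sup>2 / 2"] e by simp
      then show ?thesis
        using that eventually_happens[OF eventually_conj[OF _ eventually_ge_at_top[of N]]] by force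
    qed
    have "(seminorm (d n))\<^sup>2 = cmod (B (d n) (diff (d n) (d m)) + B (d n) (d m))"
      by (simp add: B_diff B_self norm_power)
    also have "\<dots> \<le> C * (\<epsilon>\<^sup>2 / (2 * C)) + cmod (B (d n) (d m))"
    proof -
      have "cmod (B (d n) (diff (d n) (d m))) \<le> seminorm (d n) * seminorm (diff (d n) (d m))"
        by (rule cauchy_schwarz)
      also have "\<dots> \<le> C * (\<epsilon>\<^sup>2 / (2 * C))"
        using C N[OF n m(1)] by (intro mult_mono) auto
      finally show ?thesis using norm_triangle_le by (smt (verit))
    qed
    also have "\<dots> < \<epsilon>\<^sup>2" using m(2) C(1) by simp
    finally show "(seminorm (d n))\<^sup>2 < \<epsilon>\<^sup>2" .
  qed (use e in simp)
  then show "\<exists>no. \<forall>n\<ge>no. norm (seminorm (d n) - 0) < \<epsilon>" by auto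
qed

section \<open>The inner product of the completion\<close>

lemma cauchy_diff:
  assumes "cauchy s" "cauchy r"
  shows "cauchy (\<lambda>n. diff (s n) (r n))"
  unfolding diff_def using assms by (intro cauchy_plus cauchy_scl)

lemma represents_cauchy: "represents s f \<Longrightarrow> cauchy s"
  by (simp add: represents_def)

text \<open>Any representing sequences compute the inner product, which frees it from the choice in
  its definition. The second form is the tool by which identities of \<open>B\<close> pass to the
  completion.\<close>

lemma tendsto_hinner_completion:
  assumes s: "represents s f" and r: "represents r g"
  shows "(\<lambda>n. g (s n)) \<longlonglongrightarrow> hinner completion f g"
    and "(\<lambda>n. B (s n) (r n)) \<longlonglongrightarrow> hinner completion f g"
proof -
  obtain C where C: "C > 0" "\<And>x. cmod (g x) \<le> C * seminorm x"
    using represents_bounded[OF r] by blast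
  define s' where "s' = (SOME s. represents s f)"
  have s': "represents s' f" unfolding s'_def by (rule someI[of _ s]) (rule s)
  have gs: "(\<lambda>n. g (s n)) \<longlonglongrightarrow> hinner completion f g"
  proof -
    have "Cauchy (\<lambda>n. g (s' n))"
    proof (rule CauchyI)
      fix \<epsilon> :: real assume "\<epsilon> > 0"
      then have "\<epsilon> / C > 0" using C by simp
      then obtain N where N: "\<And>m n. m \<ge> N \<Longrightarrow> n \<ge> N \<Longrightarrow> seminorm (diff (s' m) (s' n)) < \<epsilon> / C"
        using cauchyD[OF represents_cauchy[OF s']] by blast
      have "cmod (g (s' m) - g (s' n)) < \<epsilon>" if "m \<ge> N" "n \<ge> N" for m n
      proof -
        have "C * seminorm (diff (s' m) (s' n)) < \<epsilon>"
          using N[OF that] C by (simp add: pos_less_divide_eq mult.commute)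
        then show ?thesis
          using C(2)[of "diff (s' m) (s' n)"] by (simp add: represents_diff_apply[OF r])
      qed
      then show "\<exists>M. \<forall>m\<ge>M. \<forall>n\<ge>M. cmod (g (s' m) - g (s' n)) < \<epsilon>" by blast
    qed
    then have 1: "(\<lambda>n. g (s' n)) \<longlonglongrightarrow> hinner completion f g"
      by (simp add: completion_def s'_def Cauchy_convergent_iff convergent_LIMSEQ_iff)
    have "(\<lambda>n. B x (diff (s n) (s' n))) \<longlonglongrightarrow> f x - f x" for x
      unfolding B_diff using s s' by (intro tendsto_diff) (auto simp: represents_def)
    then have "(\<lambda>n. seminorm (diff (s n) (s' n))) \<longlonglongrightarrow> 0"
      using s s' by (intro cauchy_weakly_null cauchy_diff) (auto simp: represents_def)
    then have 0: "(\<lambda>n. C * seminorm (diff (s n) (s' n))) \<longlonglongrightarrow> 0"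
      by (rule tendsto_mult_right_zero)
    have "(\<lambda>n. g (diff (s n) (s' n))) \<longlonglongrightarrow> 0"
      by (rule Lim_null_comparison[OF _ 0]) (intro always_eventually allI C)
    from tendsto_add[OF this 1] show ?thesis by (simp add: represents_diff_apply[OF r])
  qed
  obtain D where D: "D > 0" "\<And>n. seminorm (s n) \<le> D"
    using cauchy_bounded s unfolding represents_def by blast
  have "(\<lambda>n. B (s n) (r n) - g (s n)) \<longlonglongrightarrow> 0"
  proof (rule LIMSEQ_I)
    fix \<epsilon> :: real assume "\<epsilon> > 0"
    then have "\<epsilon> / (2 * D) > 0" using D by simp
    then obtain N where N: "\<And>m n. m \<ge> N \<Longrightarrow> n \<ge> N \<Longrightarrow> seminorm (diff (r m) (r n)) < \<epsilon> / (2 * D)"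
      using cauchyD[OF represents_cauchy[OF r]] by blast
    \<comment> \<open>Here \<open>g (s n)\<close> is the limit in \<open>m\<close> of
      \<open>B (s n) (r m)\<close>, so the difference is a limit of
      \<open>B (s n) (diff (r n) (r m))\<close>, to which Cauchy-Schwarz applies.\<close>
    have le: "cmod (B (s n) (r n) - g (s n)) \<le> \<epsilon> / 2" if n: "n \<ge> N" for n
    proof (rule LIMSEQ_le_const2)
      show "(\<lambda>m. cmod (B (s n) (r n) - B (s n) (r m))) \<longlonglongrightarrow> cmod (B (s n) (r n) - g (s n))"
        using r by (intro tendsto_intros) (auto simp: represents_def)
      have "cmod (B (s n) (r n) - B (s n) (r m)) \<le> \<epsilon> / 2" if m: "m \<ge> N" for m
      proof -
        have "cmod (B (s n) (diff (r n) (r m))) \<le> D * (\<epsilon> / (2 * D))"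
          by (rule order_trans[OF cauchy_schwarz]) (use D N[OF n m] in \<open>intro mult_mono; simp\<close>)
        then show ?thesis using D by (simp add: B_diff)
      qed
      then show "\<exists>N. \<forall>m\<ge>N. cmod (B (s n) (r n) - B (s n) (r m)) \<le> \<epsilon> / 2" by blast
    qed
    have "norm (B (s n) (r n) - g (s n) - 0) < \<epsilon>" if "n \<ge> N" for n
      using le[OF that] \<open>\<epsilon> > 0\<close> by simp
    then show "\<exists>no. \<forall>n\<ge>no. norm (B (s n) (r n) - g (s n) - 0) < \<epsilon>"
      by blast
  qed
  from tendsto_add[OF this gs] show "(\<lambda>n. B (s n) (r n)) \<longlonglongrightarrow> hinner completion f g" by simp
  show "(\<lambda>n. g (s n)) \<longlonglongrightarrow> hinner completion f g" by (rule gs)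
qed

lemma hinner_completion_eqI:
  assumes "represents s f" "represents r g" "(\<lambda>n. B (s n) (r n)) \<longlonglongrightarrow> l"
  shows "hinner completion f g = l"
  using tendsto_hinner_completion(2)[OF assms(1,2)] assms(3) LIMSEQ_unique by blast

lemma represents_plus:
  assumes "represents s f" "represents r g"
  shows "represents (\<lambda>n. plus (s n) (r n)) (\<lambda>x. f x + g x)"
  using assms by (auto simp: represents_def B_plus intro: cauchy_plus tendsto_add)

lemma represents_scl:
  assumes "represents s f"
  shows "represents (\<lambda>n. scl c (s n)) (\<lambda>x. c * f x)"
  using assms by (auto simp: represents_def B_scl intro: cauchy_scl tendsto_mult_left)

lemma represents_embed: "represents (\<lambda>_. y) (embed y)"
proof -
  have "seminorm (diff y y) = 0" by (simp add: seminorm_def B_simps)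
  then show ?thesis by (simp add: represents_def cauchy_def embed_def)
qed

text \<open>The type \<open>'a\<close> carries no distinguished zero; \<open>scl 0 y\<close> takes
  its place, since the form vanishes on it.\<close>

lemma represents_zero: "represents (\<lambda>_. scl 0 y) (\<lambda>_. 0)"
  using represents_embed[of "scl 0 y"] by (simp add: embed_def B_scl)

lemma completion_simps [simp]:
  "carrier completion = {f. \<exists>s. represents s f}"
  "\<zero>\<^bsub>completion\<^esub> = (\<lambda>_. 0)"
  "f \<oplus>\<^bsub>completion\<^esub> g = (\<lambda>x. f x + g x)"
  "c \<odot>\<^bsub>completion\<^esub> f = (\<lambda>x. c * f x)"
  by (simp_all add: completion_def)

lemma tendsto_seminorm:
  assumes "represents s f"
  shows "(\<lambda>n. seminorm (s n)) \<longlonglongrightarrow> hnorm completion f"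
  unfolding seminorm_def hnorm_def
  by (intro tendsto_intros tendsto_hinner_completion assms)

text \<open>The identities are limits of those of \<open>B\<close>. Definiteness comes from
  Cauchy-Schwarz: if the seminorms along \<open>s\<close> tend to 0, so do all
  \<open>B x (s n)\<close>, and the functional is zero.\<close>

lemma inner_product_space_completion: "inner_product_space completion"
proof (rule inner_product_space.intro)
  have ab: "abelian_group completion"
  proof (rule abelian_groupI)
    fix f assume "f \<in> carrier completion"
    then obtain s where "represents s f" by auto
    then show "\<exists>g\<in>carrier completion. g \<oplus>\<^bsub>completion\<^esub> f = \<zero>\<^bsub>completion\<^esub>"
      using represents_scl[of s f "-1"] by (intro bexI[of _ "\<lambda>x. -1 * f x"]) auto
  qed (auto simp: algebra_simps intro: represents_plus represents_zero)
  show "Module.module complex_ring completion"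
    by (intro Module.module.intro complex_ring_cring ab Module.module_axioms.intro)
      (auto simp: complex_ring_def algebra_simps intro: represents_scl)
  show "inner_product_space_axioms completion"
  proof
    fix f g assume "f \<in> carrier completion" "g \<in> carrier completion"
    then obtain s r where sr: "represents s f" "represents r g" by auto
    show "hinner completion f g = cnj (hinner completion g f)"
    proof (rule hinner_completion_eqI[OF sr])
      show "(\<lambda>n. B (s n) (r n)) \<longlonglongrightarrow> cnj (hinner completion g f)"
        using tendsto_cnj[OF tendsto_hinner_completion(2)[OF sr(2,1)]] by (simp flip: B_commute)
    qed
    show "hinner completion f (c \<odot>\<^bsub>completion\<^esub> g) = c * hinner completion f g" for c
      unfolding completion_simps
    proof (rule hinner_completion_eqI[OF sr(1) represents_scl[OF sr(2)]])
      show "(\<lambda>n. B (s n) (scl c (r n))) \<longlonglongrightarrow> c * hinner completion f g"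
        unfolding B_scl by (intro tendsto_mult tendsto_const tendsto_hinner_completion sr)
    qed
  next
    fix f g h assume "f \<in> carrier completion" "g \<in> carrier completion" "h \<in> carrier completion"
    then obtain s r q where sr: "represents s f" "represents r g" "represents q h" by auto
    show "hinner completion f (g \<oplus>\<^bsub>completion\<^esub> h) = hinner completion f g + hinner completion f h"
      unfolding completion_simps
    proof (rule hinner_completion_eqI[OF sr(1) represents_plus[OF sr(2,3)]])
      show "(\<lambda>n. B (s n) (plus (r n) (q n))) \<longlonglongrightarrow> hinner completion f g + hinner completion f h"
        unfolding B_plus by (intro tendsto_add tendsto_hinner_completion sr)
    qed
  next
    fix f assume "f \<in> carrier completion" and nz: "f \<noteq> \<zero>\<^bsub>completion\<^esub>"
    then obtain s where s: "represents s f" by auto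
    have Re: "(\<lambda>n. Re (B (s n) (s n))) \<longlonglongrightarrow> Re (hinner completion f f)"
      by (intro tendsto_Re tendsto_hinner_completion s)
    then have "0 \<le> Re (hinner completion f f)"
      by (rule LIMSEQ_le_const) (simp add: B_pos)
    moreover have "Re (hinner completion f f) \<noteq> 0"
    proof
      assume "Re (hinner completion f f) = 0"
      then have 0: "(\<lambda>n. seminorm (s n)) \<longlonglongrightarrow> 0"
        using tendsto_seminorm[OF s] by (simp add: hnorm_def)
      have "f x = 0" for x
      proof -
        have "(\<lambda>n. B x (s n)) \<longlonglongrightarrow> 0"
          by (rule Lim_null_comparison[OF _ tendsto_mult_right_zero[OF 0, of "seminorm x"]])
            (intro always_eventually allI cauchy_schwarz)
        then show ?thesis using s LIMSEQ_unique unfolding represents_def by blast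
      qed
      with nz show False by auto
    qed
    ultimately show "0 < Re (hinner completion f f)" by simp
  qed
qed

sublocale completion: inner_product_space completion
  by (rule inner_product_space_completion)

sublocale completion_metric: Metric_space "carrier completion" "hdist completion"
  by (rule completion.Metric_space_hdist)

lemma completion_minus:
  assumes "f \<in> carrier completion" "g \<in> carrier completion"
  shows "f \<ominus>\<^bsub>completion\<^esub> g = (\<lambda>x. f x - g x)"
proof -
  obtain s where "represents s g" using assms(2) by auto
  then have "(\<lambda>x. -1 * g x) \<in> carrier completion"
    using represents_scl[of s g "-1"] by auto
  then have "\<ominus>\<^bsub>completion\<^esub> g = (\<lambda>x. -1 * g x)"
    using assms by (intro completion.minus_equality) auto
  then show ?thesis by (simp add: a_minus_def)
qed

lemma represents_diff:
  assumes "represents s f" "represents r g"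
  shows "represents (\<lambda>n. diff (s n) (r n)) (\<lambda>x. f x - g x)"
  using represents_plus[OF assms(1) represents_scl[OF assms(2), of "-1"]] by (simp add: diff_def)

lemma tendsto_hdist:
  assumes "represents s f" "represents r g"
  shows "(\<lambda>n. seminorm (diff (s n) (r n))) \<longlonglongrightarrow> hdist completion f g"
proof -
  have "f \<in> carrier completion" "g \<in> carrier completion" using assms by auto
  then have "hdist completion f g = hnorm completion (\<lambda>x. f x - g x)"
    by (simp only: hdist_def completion_minus if_True simp_thms)
  then show ?thesis using tendsto_seminorm[OF represents_diff[OF assms]] by simp
qed

section \<open>Density of the embedded elements and completeness\<close>

lemma embed_carrier: "embed y \<in> carrier completion"
  using represents_embed by auto

lemma hdist_embed: "hdist completion (embed x) (embed y) = seminorm (diff x y)"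
  using tendsto_hdist[OF represents_embed represents_embed] LIMSEQ_unique tendsto_const by blast

lemma hnorm_embed: "hnorm completion (embed x) = seminorm x"
  using tendsto_seminorm[OF represents_embed] LIMSEQ_unique tendsto_const by blast

lemma embed_dense:
  assumes "f \<in> carrier completion" "\<epsilon> > 0"
  obtains y where "hdist completion f (embed y) < \<epsilon>"
proof -
  obtain s where s: "represents s f" using assms(1) by auto
  then obtain N where N: "\<And>m n. m \<ge> N \<Longrightarrow> n \<ge> N \<Longrightarrow> seminorm (diff (s m) (s n)) < \<epsilon> / 2"
    using cauchyD[OF represents_cauchy[OF s], of "\<epsilon> / 2"] assms(2) by auto
  have "hdist completion f (embed (s N)) \<le> \<epsilon> / 2"
    by (rule LIMSEQ_le_const2[OF tendsto_hdist[OF s represents_embed]])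
      (use N in \<open>auto intro!: exI[of _ N] less_imp_le\<close>)
  then show ?thesis using that[of "s N"] assms(2) by simp
qed

text \<open>Evaluation at a point is continuous on the completion; this lets approximation in norm
  control individual values.\<close>

lemma apply_le_hnorm:
  assumes "f \<in> carrier completion"
  shows "cmod (f x) \<le> seminorm x * hnorm completion f"
proof -
  obtain s where s: "represents s f" using assms by auto
  show ?thesis
  proof (rule LIMSEQ_le)
    show "(\<lambda>n. cmod (B x (s n))) \<longlonglongrightarrow> cmod (f x)"
      using s by (intro tendsto_norm) (auto simp: represents_def)
    show "(\<lambda>n. seminorm x * seminorm (s n)) \<longlonglongrightarrow> seminorm x * hnorm completion f"
      by (intro tendsto_mult tendsto_const tendsto_seminorm s)
  qed (auto intro: cauchy_schwarz)
qed

text \<open>The \<open>n\<close>-th term of a Cauchy sequence is approximated to within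
  \<open>1 / Suc n\<close> by an embedded element \<open>y n\<close>. The elements
  \<open>y n\<close> form a Cauchy sequence for the seminorm, and the functional it represents is
  the limit.\<close>

lemma hilbert_space_completion: "hilbert_space completion"
proof (intro hilbert_space.intro inner_product_space_completion hilbert_space_axioms.intro)
  show "completion_metric.mcomplete"
    unfolding completion_metric.mcomplete_def
  proof (intro allI impI)
    fix \<sigma> assume \<sigma>: "completion_metric.MCauchy \<sigma>"
    then have \<sigma>C: "\<sigma> n \<in> carrier completion" for n
      unfolding completion_metric.MCauchy_def by blast
    have "\<exists>y. hdist completion (\<sigma> n) (embed y) < 1 / real (Suc n)" for n
      using embed_dense[OF \<sigma>C, of "1 / real (Suc n)" n] by auto
    then obtain y where y: "\<And>n. hdist completion (\<sigma> n) (embed (y n)) < 1 / real (Suc n)" by metis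
    have "cauchy y"
      unfolding cauchy_def
    proof (intro allI impI)
      fix \<epsilon> :: real assume e: "\<epsilon> > 0"
      then obtain M where M: "\<And>m n. m \<ge> M \<Longrightarrow> n \<ge> M \<Longrightarrow> hdist completion (\<sigma> m) (\<sigma> n) < \<epsilon> / 3"
        using \<sigma> unfolding completion_metric.MCauchy_def by (meson zero_less_divide_iff zero_less_numeral)
      obtain K where K: "1 / real (Suc K) < \<epsilon> / 3"
        using nat_approx_posE[of "\<epsilon> / 3"] e by auto
      have "seminorm (diff (y m) (y n)) < \<epsilon>" if "m \<ge> max M K" "n \<ge> max M K" for m n
      proof -
        have "1 / real (Suc m) \<le> 1 / real (Suc K)" "1 / real (Suc n) \<le> 1 / real (Suc K)"
          using that by (auto simp: frac_le)
        moreover have "hdist completion (embed (y m)) (embed (y n))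
            \<le> hdist completion (embed (y m)) (\<sigma> m) + hdist completion (\<sigma> m) (embed (y n))"
          by (intro completion_metric.triangle embed_carrier \<sigma>C)
        moreover have "hdist completion (\<sigma> m) (embed (y n))
            \<le> hdist completion (\<sigma> m) (\<sigma> n) + hdist completion (\<sigma> n) (embed (y n))"
          by (intro completion_metric.triangle embed_carrier \<sigma>C)
        ultimately show ?thesis
          using y[of m] y[of n] M[of m n] K that completion_metric.commute[of "embed (y m)" "\<sigma> m"]
          by (simp add: hdist_embed)
      qed
      then show "\<exists>N. \<forall>m\<ge>N. \<forall>n\<ge>N. seminorm (diff (y m) (y n)) < \<epsilon>" by blast
    qed
    then obtain f where f: "represents y f" by (rule cauchy_represents)
    have "limitin completion_metric.mtopology \<sigma> f sequentially"
      unfolding completion_metric.limit_metric_sequentially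
    proof (intro conjI allI impI)
      show fC: "f \<in> carrier completion" using f by auto
      fix \<epsilon> :: real assume e: "\<epsilon> > 0"
      obtain N where N: "\<And>m n. m \<ge> N \<Longrightarrow> n \<ge> N \<Longrightarrow> seminorm (diff (y m) (y n)) < \<epsilon> / 2"
        using cauchyD[OF \<open>cauchy y\<close>, of "\<epsilon> / 2"] e by auto
      obtain K where K: "1 / real (Suc K) < \<epsilon> / 2"
        using nat_approx_posE[of "\<epsilon> / 2"] e by auto
      have "\<sigma> n \<in> carrier completion \<and> hdist completion (\<sigma> n) f < \<epsilon>" if n: "n \<ge> max N K" for n
      proof -
        have "hdist completion (embed (y n)) f \<le> \<epsilon> / 2"
          by (rule LIMSEQ_le_const2[OF tendsto_hdist[OF represents_embed f]])
            (use N n in \<open>auto intro!: exI[of _ N] less_imp_le\<close>)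
        moreover have "1 / real (Suc n) \<le> 1 / real (Suc K)"
          using n by (auto simp: frac_le)
        moreover have "hdist completion (\<sigma> n) f
            \<le> hdist completion (\<sigma> n) (embed (y n)) + hdist completion (embed (y n)) f"
          by (intro completion_metric.triangle embed_carrier \<sigma>C fC)
        ultimately show ?thesis using y[of n] K \<sigma>C[of n] by linarith
      qed
      then show "\<exists>N. \<forall>n\<ge>N. \<sigma> n \<in> carrier completion \<and> hdist completion (\<sigma> n) f < \<epsilon>" by blast
    qed
    then show "\<exists>f. limitin completion_metric.mtopology \<sigma> f sequentially" by blast
  qed
qed

end

section \<open>Isometric actions on the completion\<close>

locale semi_inner_product_action = semi_inner_product plus scl B + topological_group G T
  for plus :: "'a \<Rightarrow> 'a \<Rightarrow> 'a" and scl B and G :: "('g, 'x) monoid_scheme" and T +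
  fixes \<alpha> :: "'g \<Rightarrow> 'a \<Rightarrow> 'a"
  assumes act_B: "g \<in> carrier G \<Longrightarrow> B (\<alpha> g x) (\<alpha> g y) = B x y"
    and act_one: "\<alpha> \<one>\<^bsub>G\<^esub> x = x"
    and act_mult: "\<lbrakk>g \<in> carrier G; h \<in> carrier G\<rbrakk> \<Longrightarrow> \<alpha> (g \<otimes>\<^bsub>G\<^esub> h) x = \<alpha> g (\<alpha> h x)"
    and act_continuous: "continuous_map T euclidean (\<lambda>g. B x (\<alpha> g y))"
begin

text \<open>Composition with the inverse extends \<open>\<alpha> g\<close> from embedded elements
  (\<open>rep_embed\<close>). Being defined by composition, it is linear in \<open>f\<close>
  whatever \<open>\<alpha> g\<close> does to sums.\<close>

definition rep :: "'g \<Rightarrow> ('a \<Rightarrow> complex) \<Rightarrow> 'a \<Rightarrow> complex" where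
  "rep g f = (\<lambda>x. f (\<alpha> (inv\<^bsub>G\<^esub> g) x))"

lemma act_adjoint: "g \<in> carrier G \<Longrightarrow> B (\<alpha> (inv\<^bsub>G\<^esub> g) x) y = B x (\<alpha> g y)"
  using act_B[of g "\<alpha> (inv\<^bsub>G\<^esub> g) x" y] act_mult[of g "inv\<^bsub>G\<^esub> g" x] by (simp add: act_one)

lemma represents_rep:
  assumes g: "g \<in> carrier G" and s: "represents s f"
  shows "represents (\<lambda>n. \<alpha> g (s n)) (rep g f)"
proof -
  have "seminorm (diff (\<alpha> g x) (\<alpha> g y)) = seminorm (diff x y)" for x y
    by (rule seminorm_cong) (simp add: B_simps act_B g)
  then show ?thesis
    using s g by (simp add: represents_def cauchy_def rep_def flip: act_adjoint)
qed

lemma rep_closed: "\<lbrakk>g \<in> carrier G; f \<in> carrier completion\<rbrakk> \<Longrightarrow> rep g f \<in> carrier completion"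
  using represents_rep by auto

lemma rep_embed: "g \<in> carrier G \<Longrightarrow> rep g (embed y) = embed (\<alpha> g y)"
  by (simp add: rep_def embed_def act_adjoint)

lemma hinner_rep:
  assumes g: "g \<in> carrier G" and "f \<in> carrier completion" "h \<in> carrier completion"
  shows "hinner completion (rep g f) (rep g h) = hinner completion f h"
proof -
  obtain s r where "represents s f" "represents r h" using assms by auto
  then show ?thesis
    using hinner_completion_eqI[OF represents_rep[OF g] represents_rep[OF g], of s f r h]
      tendsto_hinner_completion(2)[of s f r h] by (simp add: act_B g)
qed

lemma hdist_rep:
  assumes g: "g \<in> carrier G" and "f \<in> carrier completion" "h \<in> carrier completion"
  shows "hdist completion (rep g f) (rep g h) = hdist completion f h"
proof -
  obtain s r where sr: "represents s f" "represents r h" using assms by auto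
  have "seminorm (diff (\<alpha> g x) (\<alpha> g y)) = seminorm (diff x y)" for x y
    by (rule seminorm_cong) (simp add: B_simps act_B g)
  then show ?thesis
    using tendsto_hdist[OF represents_rep[OF g] represents_rep[OF g], OF sr] tendsto_hdist[OF sr]
      LIMSEQ_unique by auto
qed

text \<open>For isometries, continuity of coefficients gives norm continuity: the squared distance
  of \<open>\<alpha> h y\<close> and \<open>\<alpha> g y\<close> is the function
  \<open>\<delta>\<close> of one coefficient. Density extends this to all of the completion, with
  three errors of \<epsilon> / 3.\<close>

lemma rep_continuous:
  assumes f: "f \<in> carrier completion"
  shows "continuous_map T completion_metric.mtopology (\<lambda>g. rep g f)"
  unfolding completion_metric.continuous_map_to_metric
proof (intro ballI allI impI)
  fix h and \<epsilon> :: real assume "h \<in> topspace T" and \<epsilon>: "\<epsilon> > 0"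
  then have h: "h \<in> carrier G" by (simp add: topspace_eq)
  obtain y where y: "hdist completion f (embed y) < \<epsilon> / 3"
    using embed_dense[OF f, of "\<epsilon> / 3"] \<epsilon> by auto
  define \<delta> where "\<delta> = (\<lambda>g. 2 * (Re (B y y) - Re (B (\<alpha> h y) (\<alpha> g y))))"
  have \<delta>: "(seminorm (diff (\<alpha> h y) (\<alpha> g y)))\<^sup>2 = \<delta> g" if "g \<in> carrier G" for g
    using B_commute[of "\<alpha> g y" "\<alpha> h y"] that h by (simp add: \<delta>_def seminorm_sq B_simps act_B)
  have "continuous_map T euclideanreal \<delta>"
  proof -
    have "continuous_map T euclideanreal (Re \<circ> (\<lambda>g. B (\<alpha> h y) (\<alpha> g y)))"
      by (intro continuous_map_compose[OF act_continuous]) (simp add: continuous_on_Re)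
    then show ?thesis
      unfolding \<delta>_def comp_def by (intro continuous_map_real_mult continuous_map_diff) auto
  qed
  then have "openin T {g \<in> topspace T. \<delta> g \<in> {..< (\<epsilon> / 3)\<^sup>2}}"
    by (rule openin_continuous_map_preimage) simp
  moreover have "\<delta> h = 0" using h by (simp add: \<delta>_def act_B)
  moreover have "rep g f \<in> completion_metric.mball (rep h f) \<epsilon>"
    if "g \<in> topspace T" "\<delta> g < (\<epsilon> / 3)\<^sup>2" for g
  proof -
    have g: "g \<in> carrier G" using that topspace_eq by simp
    have "seminorm (diff (\<alpha> h y) (\<alpha> g y)) < \<epsilon> / 3"
      by (rule power2_less_imp_less) (use that g \<epsilon> in \<open>simp_all add: \<delta>\<close>)
    then have "hdist completion (rep h (embed y)) (rep g (embed y)) < \<epsilon> / 3"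
      using g h by (simp add: rep_embed hdist_embed)
    moreover have "hdist completion (rep h f) (rep h (embed y)) < \<epsilon> / 3"
      "hdist completion (rep g (embed y)) (rep g f) < \<epsilon> / 3"
      using y g h f embed_carrier hdist_rep completion_metric.commute by metis+
    moreover have "hdist completion (rep h f) (rep g f)
        \<le> hdist completion (rep h f) (rep h (embed y)) + hdist completion (rep h (embed y)) (rep g f)"
      "hdist completion (rep h (embed y)) (rep g f)
        \<le> hdist completion (rep h (embed y)) (rep g (embed y))
          + hdist completion (rep g (embed y)) (rep g f)"
      by (intro completion_metric.triangle rep_closed g h f embed_carrier)+
    ultimately have "hdist completion (rep h f) (rep g f) < \<epsilon>" by linarith
    then show ?thesis
      unfolding completion_metric.in_mball using g h f rep_closed by blast
  qed
  ultimately show "\<exists>U. openin T U \<and> h \<in> U \<and>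
      (\<forall>g\<in>U. rep g f \<in> completion_metric.mball (rep h f) \<epsilon>)"
    using \<open>h \<in> topspace T\<close> \<epsilon> by (intro exI[of _ "{g \<in> topspace T. \<delta> g \<in> {..< (\<epsilon> / 3)\<^sup>2}}"]) auto
qed

lemma unitary_rep_completion: "unitary_rep G T completion rep"
proof (intro unitary_rep.intro unitary_rep_axioms.intro topological_group_axioms
    hilbert_space_completion rep_closed hinner_rep rep_continuous)
  fix g h f assume gh: "g \<in> carrier G" "h \<in> carrier G"
  then show "rep (g \<otimes>\<^bsub>G\<^esub> h) f = rep g (rep h f)"
    by (simp add: rep_def inv_mult_group act_mult)
qed (auto simp: rep_def act_one)

end

section \<open>Property (T) implies that affine isometric actions have fixed points\<close>

lemma continuous_map_sum_list:
  fixes f :: "'i \<Rightarrow> 'x \<Rightarrow> 'a::real_normed_vector"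
  assumes "\<And>i. i \<in> set xs \<Longrightarrow> continuous_map X euclidean (f i)"
  shows "continuous_map X euclidean (\<lambda>x. \<Sum>i\<leftarrow>xs. f i x)"
  using assms by (induction xs) (simp_all add: continuous_map_add)

lemma tendsto_sum_list_zero:
  fixes f :: "'i \<Rightarrow> 'x \<Rightarrow> 'a::real_normed_vector"
  assumes "\<And>i. i \<in> set xs \<Longrightarrow> (f i \<longlongrightarrow> 0) F"
  shows "((\<lambda>x. \<Sum>i\<leftarrow>xs. f i x) \<longlongrightarrow> 0) F"
  using assms by (induction xs) (auto intro: tendsto_add_zero)

text \<open>A list of pairs \<open>(a, v)\<close> stands for the formal linear combination of the points \<open>v\<close>.\<close>

definition scale_list :: "complex \<Rightarrow> (complex \<times> 'm) list \<Rightarrow> (complex \<times> 'm) list" where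
  "scale_list c xs = map (\<lambda>(a, v). (c * a, v)) xs"

text \<open>Sesquilinear extension of the Gaussian kernel from points to formal combinations,
  antilinear in the first argument. A point may occur several times in a list.\<close>

definition gaussian_form ::
  "real \<Rightarrow> (complex \<times> 'm::real_inner) list \<Rightarrow> (complex \<times> 'm) list \<Rightarrow> complex" where
  "gaussian_form t xs ys =
     (\<Sum>(a, v)\<leftarrow>xs. \<Sum>(b, w)\<leftarrow>ys. cnj a * b * complex_of_real (exp (- t * (dist v w)\<^sup>2)))"

lemma gaussian_form_singleton:
  "gaussian_form t [(a, v)] [(b, w)] = cnj a * b * complex_of_real (exp (- t * (dist v w)\<^sup>2))"
  by (simp add: gaussian_form_def)

lemma cnj_sum_list: "cnj (\<Sum>x\<leftarrow>xs. f x) = (\<Sum>x\<leftarrow>xs. cnj (f x))"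
  by (induction xs) auto

lemma sum_list_swap:
  fixes f :: "'a \<Rightarrow> 'b \<Rightarrow> 'c::comm_monoid_add"
  shows "(\<Sum>x\<leftarrow>xs. \<Sum>y\<leftarrow>ys. f x y) = (\<Sum>y\<leftarrow>ys. \<Sum>x\<leftarrow>xs. f x y)"
  by (induction xs) (simp_all add: sum_list_addf)

lemma semi_inner_product_gaussian:
  assumes "0 \<le> t"
  shows "semi_inner_product (@) scale_list (gaussian_form t :: (complex \<times> 'm::real_inner) list \<Rightarrow> _)"
proof
  fix x y z :: "(complex \<times> 'm) list" and c :: complex
  show "gaussian_form t x (y @ z) = gaussian_form t x y + gaussian_form t x z"
    by (simp add: gaussian_form_def sum_list_addf case_prod_unfold)
  show "gaussian_form t x (scale_list c y) = c * gaussian_form t x y"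
    by (simp add: gaussian_form_def scale_list_def sum_list_const_mult case_prod_unfold comp_def
        mult.assoc mult.left_commute[of _ c])
  show "gaussian_form t y x = cnj (gaussian_form t x y)"
    unfolding gaussian_form_def case_prod_unfold cnj_sum_list
    by (subst sum_list_swap) (simp add: dist_commute mult.commute)
  \<comment> \<open>Indices are positions in the list, so repeated points are harmless. The kernel
    is real and symmetric, hence the Hermitian form is its value on the real parts plus that on the
    imaginary parts of the coefficients.\<close>
  define a v where "a = (\<lambda>i. fst (x ! i))" and "v = (\<lambda>i. snd (x ! i))"
  define K where "K = (\<lambda>i j. exp (- t * (dist (v i) (v j))\<^sup>2))"
  have K: "pos_def_kernel K"
    unfolding K_def by (rule pos_def_kernel_gaussian[OF assms])
  have "Re (gaussian_form t x x)
      = (\<Sum>i<length x. \<Sum>j<length x. Re (a i) * Re (a j) * K i j + Im (a i) * Im (a j) * K i j)"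
    by (simp add: gaussian_form_def case_prod_unfold sum_list_sum_nth a_def v_def K_def
        lessThan_atLeast0 algebra_simps)
  also have "\<dots> \<ge> 0"
    using K unfolding pos_def_kernel_def sum.distrib by (intro add_nonneg_nonneg) simp_all
  finally show "0 \<le> Re (gaussian_form t x x)" .
qed

text \<open>Meant for \<open>v n = \<pi> (s n) x\<close>, which has constant norm, and
  \<open>u n = b (s n)\<close> going to infinity: the affine action then moves every point away from
  \<open>w\<close>.\<close>

lemma tendsto_gaussian_at_infinity:
  fixes u :: "nat \<Rightarrow> 'm::real_normed_vector"
  assumes t: "t > 0" and u: "filterlim (\<lambda>n. norm (u n)) at_top sequentially"
    and v: "\<And>n. norm (v n) \<le> c"
  shows "(\<lambda>n. exp (- t * (dist (v n + u n) w)\<^sup>2)) \<longlonglongrightarrow> 0"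
proof -
  have "norm (u n) + - (c + norm w) \<le> dist (v n + u n) w" for n
    using v[of n] norm_triangle_ineq4[of "v n + u n - w" "v n - w"] norm_triangle_ineq4[of "v n" w]
    by (simp add: dist_norm)
  then have le: "\<forall>n. - (c + norm w) + norm (u n) \<le> dist (v n + u n) w"
    by (simp add: add.commute)
  have "filterlim (\<lambda>n. - (c + norm w) + norm (u n)) at_top sequentially"
    by (rule filterlim_tendsto_add_at_top[OF tendsto_const u])
  from filterlim_at_top_mono[OF this always_eventually[OF le]]
  have "filterlim (\<lambda>n. dist (v n + u n) w) at_top sequentially" .
  then have "filterlim (\<lambda>n. t * (dist (v n + u n) w)\<^sup>2) at_top sequentially"
    by (intro filterlim_tendsto_pos_mult_at_top[OF tendsto_const t] filterlim_pow_at_top) auto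
  then have "filterlim (\<lambda>n. - t * (dist (v n + u n) w)\<^sup>2) at_bot sequentially"
    by (simp add: filterlim_uminus_at_top)
  then show ?thesis by (rule filterlim_compose[OF exp_at_bot])
qed

section \<open>Bounded orbits and fixed points of affine actions\<close>

lemma unitary_module_dist:
  fixes \<pi> :: "'g \<Rightarrow> 'm::complex_hilbert \<Rightarrow> 'm"
  assumes "unitary_module G T \<pi>" "g \<in> carrier G"
  shows "dist (\<pi> g x) (\<pi> g y) = dist x y"
proof -
  have add: "\<pi> g (u + v) = \<pi> g u + \<pi> g v" and cin: "cinner (\<pi> g u) (\<pi> g v) = cinner u v" for u v
    using assms unfolding unitary_module_iff by blast+
  have "\<pi> g (x - y) = \<pi> g x - \<pi> g y"
    using add[of "x - y" y] by (simp add: algebra_simps)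
  then show ?thesis
    using cin[of "x - y" "x - y"] by (simp add: dist_norm norm_eq_sqrt_inner inner_cinner)
qed

text \<open>The values of \<open>b\<close> form the orbit of 0 under the affine action. An unbounded
  orbit would make the invariant vector supplied by Property (T) vanish.\<close>

lemma property_T_orbit_bounded:
  fixes \<pi> :: "'g \<Rightarrow> 'm::complex_hilbert \<Rightarrow> 'm"
  assumes um: "unitary_module G T \<pi>" and T: "property_T G T"
    and cont: "continuous_map T euclidean b"
    and cocycle: "\<And>g h. g \<in> carrier G \<Longrightarrow> h \<in> carrier G \<Longrightarrow> b (g \<otimes>\<^bsub>G\<^esub> h) = b g + \<pi> g (b h)"
  shows "bounded (b ` carrier G)"
proof (rule ccontr)
  assume unbounded: "\<not> bounded (b ` carrier G)"
  interpret topological_group G T using um unitary_module_iff by blast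
  have add: "\<And>g x y. g \<in> carrier G \<Longrightarrow> \<pi> g (x + y) = \<pi> g x + \<pi> g y"
    and one: "\<And>x. \<pi> \<one>\<^bsub>G\<^esub> x = x"
    and mult: "\<And>g h x. g \<in> carrier G \<Longrightarrow> h \<in> carrier G \<Longrightarrow> \<pi> (g \<otimes>\<^bsub>G\<^esub> h) x = \<pi> g (\<pi> h x)"
    and pi_cont: "\<And>x. continuous_map T euclidean (\<lambda>g. \<pi> g x)"
    using um unfolding unitary_module_iff by blast+
  have zero: "\<pi> g 0 = 0" if "g \<in> carrier G" for g
    using add[OF that, of 0 0] by simp
  have norm_pi: "norm (\<pi> g x) = norm x" if "g \<in> carrier G" for g x
    using unitary_module_dist[OF um that, of x 0] zero[OF that] by simp
  have b_one: "b \<one>\<^bsub>G\<^esub> = 0"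
    using cocycle[of "\<one>\<^bsub>G\<^esub>" "\<one>\<^bsub>G\<^esub>"] by (simp add: one)
  obtain Q \<epsilon> where Q: "compactin T Q" and \<epsilon>: "\<epsilon> > 0"
    and kazhdan: "kazhdan_pair TYPE('g \<Rightarrow> complex) G T Q \<epsilon>"
    using T unfolding property_T_def by blast
  have QG: "Q \<subseteq> carrier G"
    using compactin_subset_topspace[OF Q] topspace_eq by simp
  have "compactin euclidean (b ` Q)"
    by (rule image_compactin[OF Q cont])
  then have "bounded (b ` Q)"
    by (simp add: compact_imp_bounded)
  then obtain R where R: "\<And>g. g \<in> Q \<Longrightarrow> norm (b g) \<le> R"
    unfolding bounded_iff by blast
  \<comment> \<open>A positive bound for the squared norm of \<open>b\<close> on \<open>Q\<close>,
    even when \<open>R = 0\<close>; with the next choice,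
    \<open>2 * (t * P) = \<epsilon>\<^sup>2 / 2\<close>, which makes the vector \<open>e\<close>
    almost invariant.\<close>
  define P where "P = R\<^sup>2 + 1"
  have P: "P > 0" using zero_le_power2[of R] unfolding P_def by linarith
  define t where "t = \<epsilon>\<^sup>2 / (4 * P)"
  have t: "t > 0" unfolding t_def using \<epsilon> P by simp
  \<comment> \<open>The affine action moves the points and keeps the coefficients; as it is
    isometric, the Gaussian form is preserved.\<close>
  define \<alpha> where "\<alpha> = (\<lambda>g. map (\<lambda>(a :: complex, v). (a, \<pi> g v + b g)))"
  interpret semi_inner_product "(@)" scale_list "gaussian_form t :: (complex \<times> 'm) list \<Rightarrow> _"
    by (rule semi_inner_product_gaussian[OF less_imp_le[OF t]])
  interpret semi_inner_product_action "(@)" scale_list "gaussian_form t :: (complex \<times> 'm) list \<Rightarrow> _" G T \<alpha>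
  proof unfold_locales
    fix g h x y assume g: "g \<in> carrier G"
    show "gaussian_form t (\<alpha> g x) (\<alpha> g y) = gaussian_form t x y"
      using unitary_module_dist[OF um g]
      by (simp add: gaussian_form_def \<alpha>_def case_prod_unfold comp_def)
    assume h: "h \<in> carrier G"
    show "\<alpha> (g \<otimes>\<^bsub>G\<^esub> h) x = \<alpha> g (\<alpha> h x)"
      using g h by (simp add: \<alpha>_def case_prod_unfold comp_def mult cocycle add add_ac)
  next
    show "\<alpha> \<one>\<^bsub>G\<^esub> x = x" for x
      by (simp add: \<alpha>_def one b_one)
    fix x y
    have "continuous_map T euclidean
        (\<lambda>g. cnj (fst p) * fst q * complex_of_real (exp (- t * (dist (snd p) (\<pi> g (snd q) + b g))\<^sup>2)))"
      for p q :: "complex \<times> 'm"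
    proof -
      have "continuous_map T euclidean (\<lambda>g. \<pi> g (snd q) + b g)"
        by (intro continuous_map_add pi_cont cont)
      moreover have "continuous_map euclidean euclidean
          (\<lambda>u. cnj (fst p) * fst q * complex_of_real (exp (- t * (dist (snd p) u)\<^sup>2)))"
        by (simp, intro continuous_intros)
      ultimately show ?thesis
        by (rule continuous_map_compose[unfolded comp_def])
    qed
    then show "continuous_map T euclidean (\<lambda>g. gaussian_form t x (\<alpha> g y))"
      unfolding gaussian_form_def \<alpha>_def by (simp add: case_prod_unfold comp_def continuous_map_sum_list)
  qed
  \<comment> \<open>The unit vector belonging to the point 0, which \<open>g\<close> carries to the
    vector belonging to \<open>b g\<close>.\<close>
  define e where "e = embed [(1, 0)]"
  have norm_e: "hnorm completion e = 1"
    by (simp add: e_def hnorm_embed seminorm_def gaussian_form_singleton)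
  have close: "hdist completion (rep g e) e < \<epsilon> * hnorm completion e" if "g \<in> Q" for g
  proof -
    have g: "g \<in> carrier G" using that QG by blast
    have "\<alpha> g [(1, 0)] = [(1, b g)]" using g by (simp add: \<alpha>_def zero)
    then have "hdist completion (rep g e) e = seminorm (diff [(1, b g)] [(1, 0)])"
      by (simp add: e_def rep_embed g hdist_embed)
    moreover have "(seminorm (diff [(1, b g)] [(1, 0)]))\<^sup>2 = 2 - 2 * exp (- t * (norm (b g))\<^sup>2)"
      by (simp add: seminorm_sq B_diff B_diff_left gaussian_form_singleton)
    moreover have "2 - 2 * exp (- t * (norm (b g))\<^sup>2) < \<epsilon>\<^sup>2"
    proof -
      have "2 - 2 * exp (- t * (norm (b g))\<^sup>2) \<le> 2 * (t * (norm (b g))\<^sup>2)"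
        using exp_ge_add_one_self[of "- t * (norm (b g))\<^sup>2"] by simp
      also have "\<dots> \<le> 2 * (t * P)"
        using power_mono[OF R[OF that], of 2] t by (simp add: P_def)
      also have "\<dots> = \<epsilon>\<^sup>2 / 2"
        using P by (simp add: t_def)
      also have "\<dots> < \<epsilon>\<^sup>2" using \<epsilon> by simp
      finally show ?thesis .
    qed
    ultimately show ?thesis
      using \<epsilon> norm_e power2_less_imp_less[of "hdist completion (rep g e) e" \<epsilon>] by simp
  qed
  \<comment> \<open>The completion lives on functions of lists, so the Kazhdan pair has to change
    its type.\<close>
  have kazhdan': "kazhdan_pair TYPE((complex \<times> 'm) list \<Rightarrow> complex) G T Q \<epsilon>"
    by (rule kazhdan_pair_any_type[OF kazhdan QG])
  have e: "e \<in> carrier completion"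
    unfolding e_def by (rule embed_carrier)
  have "e \<noteq> \<zero>\<^bsub>completion\<^esub>"
    using norm_e completion.hnorm_eq_0[OF e] by simp
  with e close have "\<exists>x\<in>carrier completion. x \<noteq> \<zero>\<^bsub>completion\<^esub> \<and>
      (\<forall>g\<in>Q. hdist completion (rep g x) x < \<epsilon> * hnorm completion x)"
    by (intro bexI[of _ e]) (simp_all del: completion_simps)
  from kazhdan'[unfolded kazhdan_pair_def, rule_format, OF unitary_rep_completion this]
  obtain f where f: "f \<in> carrier completion" "f \<noteq> \<zero>\<^bsub>completion\<^esub>"
    and inv: "\<And>g. g \<in> carrier G \<Longrightarrow> rep g f = f"
    by blast
  have "\<exists>g\<in>carrier G. norm (b g) > real n" for n
    using unbounded unfolding bounded_iff by (metis imageE linorder_not_less)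
  then obtain s where s: "\<And>n. s n \<in> carrier G" "\<And>n. norm (b (s n)) > real n" by metis
  have at_top: "filterlim (\<lambda>n. norm (b (s n))) at_top sequentially"
    by (rule filterlim_at_top_mono[OF filterlim_real_sequentially])
      (use s(2) in \<open>auto intro!: always_eventually less_imp_le\<close>)
  have "f x = 0" for x
  proof (rule ccontr)
    assume nz: "f x \<noteq> 0"
    \<comment> \<open>The summand 1 permits division. Below, \<open>f\<close> is replaced by a
      nearby embedded \<open>y\<close>, whose values along the orbit tend to 0, while the values of
      \<open>f\<close> stay equal to \<open>f x\<close>.\<close>
    have pos: "seminorm x + 1 > 0" by (simp add: add_nonneg_pos)
    obtain y where y: "hdist completion f (embed y) < cmod (f x) / 2 / (seminorm x + 1)"
      using embed_dense[OF f(1), of "cmod (f x) / 2 / (seminorm x + 1)"] nz pos by auto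
    have "(\<lambda>n. gaussian_form t (\<alpha> (s n) x) y) \<longlonglongrightarrow> 0"
      unfolding gaussian_form_def \<alpha>_def map_map comp_def case_prod_unfold fst_conv snd_conv
    proof (intro tendsto_sum_list_zero tendsto_mult_right_zero)
      fix p q :: "complex \<times> 'm"
      have "(\<lambda>n. exp (- t * (dist (\<pi> (s n) (snd p) + b (s n)) (snd q))\<^sup>2)) \<longlonglongrightarrow> 0"
        using norm_pi s(1) by (intro tendsto_gaussian_at_infinity[OF t at_top, where c = "norm (snd p)"]) simp
      from tendsto_of_real[OF this]
      show "(\<lambda>n. complex_of_real (exp (- t * (dist (\<pi> (s n) (snd p) + b (s n)) (snd q))\<^sup>2))) \<longlonglongrightarrow> 0"
        by simp
    qed
    then have lim: "(\<lambda>n. cmod (f x - gaussian_form t (\<alpha> (s n) x) y)) \<longlonglongrightarrow> cmod (f x - 0)"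
      by (intro tendsto_intros)
    have bound: "cmod (f x - gaussian_form t (\<alpha> (s n) x) y) \<le> cmod (f x) / 2" for n
    proof -
      \<comment> \<open>As \<open>rep\<close> composes with the inverse, invariance under the
        inverse of \<open>s n\<close> is what moves the argument by \<open>s n\<close>.\<close>
      have inv_s: "inv\<^bsub>G\<^esub> (s n) \<in> carrier G" using s(1) by simp
      have "f x = f (\<alpha> (s n) x)"
        using fun_cong[OF inv[OF inv_s], of x] s(1) by (simp add: rep_def)
      moreover have "hdist completion f (embed y) = hnorm completion (\<lambda>x. f x - embed y x)"
        using f(1) embed_carrier[of y] by (simp only: hdist_def completion_minus if_True simp_thms)
      moreover have "seminorm (\<alpha> (s n) x) = seminorm x"
        by (rule seminorm_cong) (rule act_B[OF s(1)])
      moreover have "(\<lambda>x. f x - embed y x) \<in> carrier completion"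
        using completion.minus_closed[OF f(1) embed_carrier[of y]]
        by (simp only: completion_minus[OF f(1) embed_carrier])
      ultimately have "cmod (f x - gaussian_form t (\<alpha> (s n) x) y) \<le> seminorm x * hdist completion f (embed y)"
        using apply_le_hnorm[of "\<lambda>x. f x - embed y x" "\<alpha> (s n) x"] by (simp only: embed_def)
      also have "\<dots> \<le> (seminorm x + 1) * hdist completion f (embed y)"
        by (intro mult_right_mono) simp_all
      also have "\<dots> \<le> cmod (f x) / 2"
        using y pos by (simp add: pos_less_divide_eq algebra_simps)
      finally show ?thesis .
    qed
    have "cmod (f x - 0) \<le> cmod (f x) / 2"
      by (rule LIMSEQ_le_const2[OF lim]) (intro exI allI impI bound)
    then show False using nz by simp
  qed
  then show False using f(2) by (auto simp: fun_eq_iff)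
qed

text \<open>By the cocycle identity each affine map permutes the bounded set of values of
  \<open>b\<close>, so it fixes the circumcentre of that set.\<close>

lemma property_T_fixed_point:
  fixes \<pi> :: "'g \<Rightarrow> 'm::complex_hilbert \<Rightarrow> 'm"
  assumes um: "unitary_module G T \<pi>" and T: "property_T G T"
    and cont: "continuous_map T euclidean b"
    and cocycle: "\<And>g h. g \<in> carrier G \<Longrightarrow> h \<in> carrier G \<Longrightarrow> b (g \<otimes>\<^bsub>G\<^esub> h) = b g + \<pi> g (b h)"
  obtains u where "\<And>g. g \<in> carrier G \<Longrightarrow> \<pi> g u + b g = u"
proof -
  interpret topological_group G T using um unitary_module_iff by blast
  obtain u where u: "\<And>h. (\<And>x y. dist (h x) (h y) = dist x y) \<Longrightarrow> h ` (b ` carrier G) = b ` carrier G \<Longrightarrow> h u = u"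
    using circumcentre[OF property_T_orbit_bounded[OF assms]] by blast
  have "\<pi> g u + b g = u" if g: "g \<in> carrier G" for g
  proof (rule u)
    show "dist (\<pi> g x + b g) (\<pi> g y + b g) = dist x y" for x y
      using unitary_module_dist[OF um g] by simp
    have 1: "\<pi> g (b h) + b g = b (g \<otimes>\<^bsub>G\<^esub> h)" if "h \<in> carrier G" for h
      using cocycle[OF g that] by simp
    have "b h \<in> (\<lambda>x. \<pi> g x + b g) ` b ` carrier G" if h: "h \<in> carrier G" for h
    proof -
      have "b h = \<pi> g (b (inv\<^bsub>G\<^esub> g \<otimes>\<^bsub>G\<^esub> h)) + b g"
        using 1[of "inv\<^bsub>G\<^esub> g \<otimes>\<^bsub>G\<^esub> h"] g h by (simp flip: m_assoc)
      then show ?thesis using g h by blast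
    qed
    with 1 g show "(\<lambda>x. \<pi> g x + b g) ` b ` carrier G = b ` carrier G"
      by auto
  qed
  then show ?thesis using that by blast
qed

section \<open>Fixed and almost fixed vectors\<close>

lemma fixed_vectors_closed_subspace:
  fixes \<pi> :: "'g \<Rightarrow> 'm::complex_hilbert \<Rightarrow> 'm"
  assumes um: "unitary_module G T \<pi>" and K: "K \<subseteq> carrier G"
  shows "closed (fixed_vectors \<pi> K)" "subspace (fixed_vectors \<pi> K)"
    and "x \<in> fixed_vectors \<pi> K \<Longrightarrow> c *\<^sub>C x \<in> fixed_vectors \<pi> K"
proof -
  have add: "\<And>g x y. g \<in> K \<Longrightarrow> \<pi> g (x + y) = \<pi> g x + \<pi> g y"
    and scale: "\<And>g c x. g \<in> K \<Longrightarrow> \<pi> g (c *\<^sub>C x) = c *\<^sub>C \<pi> g x"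
    and dist: "\<And>g x y. g \<in> K \<Longrightarrow> dist (\<pi> g x) (\<pi> g y) = dist x y"
    using um K unitary_module_dist[OF um] unfolding unitary_module_iff by blast+
  have zero: "\<pi> g 0 = 0" if "g \<in> K" for g
    using add[OF that, of 0 0] by simp
  show smult: "c *\<^sub>C x \<in> fixed_vectors \<pi> K" if "x \<in> fixed_vectors \<pi> K" for c x
    using that scale by (simp add: fixed_vectors_def)
  show "subspace (fixed_vectors \<pi> K)"
    by (rule subspaceI) (use smult in \<open>auto simp: fixed_vectors_def zero add scaleR_scaleC scale\<close>)
  have cont: "continuous_on UNIV (\<pi> g)" if "g \<in> K" for g
  proof (rule lipschitz_on_continuous_on)
    show "1-lipschitz_on UNIV (\<pi> g)" by (rule lipschitz_onI) (simp_all add: dist that)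
  qed
  have "closed {x. \<pi> g x = x}" if "g \<in> K" for g
    by (intro closed_Collect_eq continuous_on_id cont that)
  moreover have "fixed_vectors \<pi> K = (\<Inter>g\<in>K. {x. \<pi> g x = x})"
    by (auto simp: fixed_vectors_def)
  ultimately show "closed (fixed_vectors \<pi> K)" by auto
qed

text \<open>The representation on the orthogonal complement of the fixed vectors has no fixed vectors.\<close>

lemma property_T_near_fixed_vectors:
  fixes \<pi> :: "'g \<Rightarrow> 'm::complex_hilbert \<Rightarrow> 'm"
  assumes um: "unitary_module G T \<pi>" and T: "property_T G T"
  obtains Q \<eta> where "compactin T Q" "\<eta> > 0"
    "\<And>x \<delta>. \<delta> > 0 \<Longrightarrow> (\<And>g. g \<in> Q \<Longrightarrow> dist (\<pi> g x) x < \<eta> * \<delta>) \<Longrightarrow>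
      \<exists>y\<in>fixed_vectors \<pi> (carrier G). dist x y < \<delta>"
proof -
  interpret topological_group G T using um unitary_module_iff by blast
  have add: "\<And>g x y. g \<in> carrier G \<Longrightarrow> \<pi> g (x + y) = \<pi> g x + \<pi> g y"
    and scale: "\<And>g c x. g \<in> carrier G \<Longrightarrow> \<pi> g (c *\<^sub>C x) = c *\<^sub>C \<pi> g x"
    and cin: "\<And>g x y. g \<in> carrier G \<Longrightarrow> cinner (\<pi> g x) (\<pi> g y) = cinner x y"
    using um unfolding unitary_module_iff by blast+
  obtain Q \<epsilon> where Q: "compactin T Q" and \<epsilon>: "\<epsilon> > 0"
    and kazhdan: "kazhdan_pair TYPE('g \<Rightarrow> complex) G T Q \<epsilon>"
    using T unfolding property_T_def by blast
  have QG: "Q \<subseteq> carrier G"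
    using compactin_subset_topspace[OF Q] topspace_eq by simp
  have kazhdan': "kazhdan_pair TYPE('m) G T Q \<epsilon>"
    by (rule kazhdan_pair_any_type[OF kazhdan QG])
  define F where "F = fixed_vectors \<pi> (carrier G)"
  note F = fixed_vectors_closed_subspace[OF um order_refl, folded F_def]
  define D where "D = {x. \<forall>y\<in>F. inner y x = 0}"
  have "closed {x. inner y x = 0}" for y :: 'm
    by (intro closed_Collect_eq continuous_intros)
  moreover have "D = (\<Inter>y\<in>F. {x. inner y x = 0})" by (auto simp: D_def)
  ultimately have D_closed: "closed D" by auto
  \<comment> \<open>Orthogonality in \<open>D\<close> involves only the real part of the inner
    product. \<open>D\<close> is nevertheless a complex subspace, because \<open>F\<close> is one
    and the scalar can be moved to the other side.\<close>
  have D_scale: "c *\<^sub>C x \<in> D" if "x \<in> D" for c x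
  proof -
    have "inner y (c *\<^sub>C x) = inner (cnj c *\<^sub>C y) x" for y
      using cinner_commute[of "cnj c *\<^sub>C y" x] cinner_commute[of y x]
      by (simp add: inner_cinner cinner_scaleC_right)
    then show ?thesis using that F(3) by (simp add: D_def)
  qed
  have D_inv: "\<pi> g x \<in> D" if g: "g \<in> carrier G" and x: "x \<in> D" for g x
  proof -
    have "inner y (\<pi> g x) = inner y x" if "y \<in> F" for y
    proof -
      have "\<pi> g y = y" using that g by (simp add: F_def fixed_vectors_def)
      then show ?thesis using cin[OF g, of y x] by (simp add: inner_cinner)
    qed
    then show ?thesis using x by (simp add: D_def)
  qed
  have norm: "hnorm hilbert_of_type x = norm x" for x :: 'm
    by (simp add: hnorm_def norm_eq_sqrt_inner inner_cinner)
  have "\<exists>(K :: 'm hilbert) \<rho>. unitary_rep G T K \<rho> \<and> carrier K = id ` D \<and> \<zero>\<^bsub>K\<^esub> = id \<zero>\<^bsub>hilbert_of_type\<^esub> \<and>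
    (\<forall>x\<in>D. hnorm K (id x) = hnorm hilbert_of_type x) \<and>
    (\<forall>x\<in>D. \<forall>y\<in>D. hdist K (id x) (id y) = hdist hilbert_of_type x y) \<and>
    (\<forall>g\<in>carrier G. \<forall>x\<in>D. \<rho> g (id x) = id (\<pi> g x))"
  proof (rule unitary_rep_transport[OF um])
    show "\<And>c x. x \<in> D \<Longrightarrow> c \<odot>\<^bsub>hilbert_of_type\<^esub> x \<in> D"
      using D_scale by simp
    show "\<And>g x. g \<in> carrier G \<Longrightarrow> x \<in> D \<Longrightarrow> \<pi> g x \<in> D"
      by (rule D_inv)
    show "closedin (htopology hilbert_of_type) D"
      using D_closed by (simp add: hdist_hilbert_of_type)
  qed (auto simp: D_def inner_add_right)
  then obtain K :: "'m hilbert" and \<rho> where K: "unitary_rep G T K \<rho>" "carrier K = D" "\<zero>\<^bsub>K\<^esub> = 0"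
    "\<And>x. x \<in> D \<Longrightarrow> hnorm K x = norm x" "\<And>x y. x \<in> D \<Longrightarrow> y \<in> D \<Longrightarrow> hdist K x y = dist x y"
    "\<And>g x. g \<in> carrier G \<Longrightarrow> x \<in> D \<Longrightarrow> \<rho> g x = \<pi> g x"
    unfolding image_id id_apply norm hdist_hilbert_of_type hilbert_of_type_simps by blast
  have "\<exists>y\<in>F. dist x y < \<delta>" if \<delta>: "\<delta> > 0" and almost: "\<And>g. g \<in> Q \<Longrightarrow> dist (\<pi> g x) x < \<epsilon> * \<delta>" for x \<delta>
  proof -
    obtain z where z: "z \<in> F" "\<And>y. y \<in> F \<Longrightarrow> inner (x - z) y = 0"
      using orthogonal_projection_exists[OF F(1,2)] by blast
    define w where "w = x - z"
    have wD: "w \<in> D" using z(2) by (simp add: D_def w_def inner_commute)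
    have "norm w < \<delta>"
    \<comment> \<open>If \<open>w\<close> were not short, it would be almost invariant: it is
      displaced exactly as \<open>x\<close> is, since \<open>z\<close> is fixed. Property (T) then
      gives a nonzero fixed vector in \<open>D\<close>, orthogonal to itself.\<close>
    proof (rule ccontr)
      assume "\<not> norm w < \<delta>"
      then have large: "\<epsilon> * \<delta> \<le> \<epsilon> * norm w" "w \<noteq> 0" using \<epsilon> \<delta> by auto
      have "hdist K (\<rho> g w) w < \<epsilon> * hnorm K w" if "g \<in> Q" for g
      proof -
        have g: "g \<in> carrier G" using that QG by blast
        have "\<pi> g x = \<pi> g w + z"
          using add[OF g, of w z] z(1) g by (simp add: w_def F_def fixed_vectors_def)
        then have "dist (\<pi> g w) w = dist (\<pi> g x) x"
          by (simp add: w_def dist_norm algebra_simps)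
        then show ?thesis
          using K(4-6) almost[OF that] large wD g D_inv by simp
      qed
      then have "\<exists>x\<in>carrier K. x \<noteq> \<zero>\<^bsub>K\<^esub> \<and> (\<forall>g\<in>Q. hdist K (\<rho> g x) x < \<epsilon> * hnorm K x)"
        using K(2,3) wD large(2) by (intro bexI[of _ w]) auto
      then obtain y where y: "y \<in> carrier K" "y \<noteq> \<zero>\<^bsub>K\<^esub>" "\<And>g. g \<in> carrier G \<Longrightarrow> \<rho> g y = y"
        using kazhdan' K(1) unfolding kazhdan_pair_def by blast
      then have "y \<in> F" "y \<in> D" using K(2,6) by (auto simp: F_def fixed_vectors_def)
      then have "inner y y = 0" by (simp add: D_def)
      then show False using y(2) K(3) by simp
    qed
    then show ?thesis using z(1) by (auto simp: w_def dist_norm)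
  qed
  then show ?thesis using that[OF Q \<epsilon>] unfolding F_def by blast
qed

section \<open>Potentials on trees\<close>

context oriented_graph
begin

lemma head_arev: "e \<in> arcs \<Gamma> \<Longrightarrow> head \<Gamma> (arev e) = tail \<Gamma> e"
  using tail_arev[of "arev e"] arev_closed[of e] arev_arev[of e] by simp

lemma awalk_reverse:
  assumes "awalk u p v"
  shows "awalk v (rev (map arev p)) u"
  using assms
proof (induction p arbitrary: u)
  case (Cons e p)
  then have e: "e \<in> arcs \<Gamma>" "u = tail \<Gamma> e" and p: "awalk (head \<Gamma> e) p v"
    by (auto simp: awalk_Cons_iff)
  have "awalk (head \<Gamma> e) [arev e] u"
    using e by (simp add: awalk_Cons_iff awalk_Nil_iff arev_closed tail_arev head_arev)
  then show ?case
    using awalk_appendI[OF Cons.IH[OF p]] by simp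
qed (auto simp: awalk_Nil_iff)

text \<open>Connectedness is defined through the symmetric closure; reversed arcs make the graph
  symmetric already, so directed walks exist.\<close>

lemma connected_awalk:
  assumes conn: "Digraph_Component.connected \<Gamma>" and xy: "x \<in> verts \<Gamma>" "y \<in> verts \<Gamma>"
  obtains p where "awalk x p y"
proof -
  have "symmetric \<Gamma>"
    unfolding symmetric_conv using arev_closed tail_arev head_arev by metis
  moreover have "x \<rightarrow>\<^sup>*\<^bsub>with_proj (mk_symmetric \<Gamma>)\<^esub> y"
    using conn xy unfolding Digraph_Component.connected_def strongly_connected_def by simp
  ultimately have "x \<rightarrow>\<^sup>*\<^bsub>\<Gamma>\<^esub> y"
    using reachable_mk_symmetric_eq by blast
  then show ?thesis using that reachable_awalk by blast
qed

end

lemma (in wf_digraph) awalk_sum_difference: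
  fixes f :: "'a \<Rightarrow> 'm::ab_group_add"
  assumes "awalk x p y"
  shows "(\<Sum>e\<leftarrow>p. f (head G e) - f (tail G e)) = f y - f x"
  using assms by (induction p arbitrary: x) (auto simp: awalk_Cons_iff awalk_Nil_iff)

context tree_graph
begin

text \<open>Induction on the length. If no vertex is repeated, the walk is a cycle and thus goes
  along an arc and back, where \<open>c\<close> cancels. Otherwise a repeated vertex splits it into
  two shorter closed walks.\<close>

lemma closed_walk_sum_zero:
  fixes c :: "'b \<Rightarrow> 'm::ab_group_add"
  assumes anti: "\<And>e. e \<in> arcs \<Gamma> \<Longrightarrow> c (arev e) = - c e"
    and "awalk u p u"
  shows "(\<Sum>e\<leftarrow>p. c e) = 0"
  using assms(2)
proof (induction "length p" arbitrary: p u rule: less_induct)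
  case less
  show ?case
  proof (cases p)
    case (Cons e es)
    show ?thesis
    proof (cases "distinct (tl (awalk_verts u p))")
      case True
      then have "cycle p" using less.prems Cons by (auto simp: cycle_def)
      then obtain d where d: "p = [d, arev d]" using no_circuit by blast
      then have "d \<in> arcs \<Gamma>" using less.prems by (auto simp: awalk_Cons_iff)
      then show ?thesis using d anti by simp
    next
      case False
      \<comment> \<open>The repetition is sought after the first arc. So \<open>e\<close> stays in
        the outer walk, and the inner walk \<open>r\<close> is strictly shorter than
        \<open>p\<close>.\<close>
      then have *: "awalk (head \<Gamma> e) es u" "\<not> distinct (awalk_verts (head \<Gamma> e) es)"
        using less.prems Cons by (auto simp: awalk_Cons_iff)
      from awalk_not_distinct_decomp[OF this] obtain q r s w where dec: "es = q @ r @ s" "0 < length r"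
        "awalk (head \<Gamma> e) q w" "awalk w r w" "awalk w s u"
        by blast
      have "awalk u (e # q @ s) u"
        using awalk_appendI[OF dec(3,5)] less.prems Cons by (simp add: awalk_Cons_iff del: awalk_append_iff)
      then have "(\<Sum>e\<leftarrow>e # q @ s. c e) = 0"
        using less.hyps[of "e # q @ s" u] dec Cons by simp
      moreover have "(\<Sum>e\<leftarrow>r. c e) = 0"
        using less.hyps[of r w] dec Cons by simp
      ultimately show ?thesis using dec Cons by (simp add: add_ac)
    qed
  qed simp
qed

text \<open>The potential at a vertex is the sum of \<open>c\<close> along a chosen walk from a root
  \<open>r\<close>; vanishing on closed walks makes the choice immaterial.\<close>

lemma potential_exists:
  fixes c :: "'b \<Rightarrow> 'm::ab_group_add"
  assumes anti: "\<And>e. e \<in> arcs \<Gamma> \<Longrightarrow> c (arev e) = - c e"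
  obtains u where "\<And>e. e \<in> arcs \<Gamma> \<Longrightarrow> u (head \<Gamma> e) - u (tail \<Gamma> e) = c e"
proof -
  obtain r where r: "r \<in> verts \<Gamma>"
    using tree_connected unfolding Digraph_Component.connected_def strongly_connected_def by auto
  define P where "P = (\<lambda>x. SOME p. awalk r p x)"
  have P: "awalk r (P x) x" if "x \<in> verts \<Gamma>" for x
    using connected_awalk[OF tree_connected r that] unfolding P_def by (metis someI_ex)
  have rev_sum: "(\<Sum>e\<leftarrow>rev (map arev p). c e) = - (\<Sum>e\<leftarrow>p. c e)" if "set p \<subseteq> arcs \<Gamma>" for p
    using that by (induction p) (auto simp: anti)
  have "(\<Sum>e\<leftarrow>P (head \<Gamma> e). c e) - (\<Sum>e\<leftarrow>P (tail \<Gamma> e). c e) = c e" if e: "e \<in> arcs \<Gamma>" for e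
  proof -
    \<comment> \<open>To the tail, across \<open>e\<close>, and back from the head: the zero sum of
      this closed walk is the required equation.\<close>
    have "awalk r (P (tail \<Gamma> e) @ [e] @ rev (map arev (P (head \<Gamma> e)))) r"
      using e by (intro awalk_appendI[OF P awalk_appendI[OF arc_implies_awalk awalk_reverse[OF P]]]) auto
    from closed_walk_sum_zero[where c = c, OF anti this] show ?thesis
      using rev_sum[of "P (head \<Gamma> e)"] P[of "head \<Gamma> e"] e
      by (simp add: awalk_def) (simp add: algebra_simps add_eq_0_iff)
  qed
  then show ?thesis using that[of "\<lambda>x. \<Sum>e\<leftarrow>P x. c e"] by blast
qed

lemma constant_on_tree:
  fixes f :: "'a \<Rightarrow> 'm::ab_group_add"
  assumes "\<And>e. e \<in> arcs \<Gamma> \<Longrightarrow> f (head \<Gamma> e) = f (tail \<Gamma> e)"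
    and xy: "x \<in> verts \<Gamma>" "y \<in> verts \<Gamma>"
  shows "f x = f y"
proof -
  obtain p where p: "awalk x p y" using connected_awalk[OF tree_connected xy] .
  then have "set p \<subseteq> arcs \<Gamma>" by auto
  then have "(\<Sum>e\<leftarrow>p. f (head \<Gamma> e) - f (tail \<Gamma> e)) = 0"
    using assms(1) by (induction p) auto
  then show ?thesis using awalk_sum_difference[OF p, of f] by simp
qed

end

section \<open>Equivariant functions\<close>

context group_action
begin

lemma orbits_closed: "X \<in> orbits G E \<phi> \<Longrightarrow> x \<in> X \<Longrightarrow> x \<in> E"
  unfolding orbits_def orbit_def using element_image by blast

lemma orbits_eq_orbit:
  assumes "X \<in> orbits G E \<phi>" "x \<in> X"
  shows "X = orbit G \<phi> x"
proof -
  obtain y where y: "y \<in> E" "X = orbit G \<phi> y" using assms(1) unfolding orbits_def by blast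
  have x: "x \<in> E" using orbits_closed assms by blast
  show ?thesis
  proof (intro equalityI subsetI)
    fix z assume z: "z \<in> X"
    then have "z \<in> E" using orbits_closed assms(1) by blast
    then show "z \<in> orbit G \<phi> x"
      using orbit_trans[of x y z] orbit_sym[of y x] x y z assms(2) by simp
  next
    fix z assume z: "z \<in> orbit G \<phi> x"
    then have "z \<in> E" unfolding orbit_def using x element_image by blast
    then show "z \<in> X" using orbit_trans[of y x z] x y z assms(2) by simp
  qed
qed

text \<open>A value at one representative spreads over its orbit consistently because the stabilizer
  fixes it. The action \<open>a\<close> need not be linear: it will be unitary for equivariant
  functions and affine for those twisted by a cocycle.\<close>

lemma equivariant_extension:
  fixes a :: "'a \<Rightarrow> 'm \<Rightarrow> 'm"
  assumes a_one: "\<And>m. a \<one> m = m"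
    and a_mult: "\<And>g h m. g \<in> carrier G \<Longrightarrow> h \<in> carrier G \<Longrightarrow> a (g \<otimes> h) m = a g (a h m)"
    and lift: "\<And>X. X \<in> orbits G E \<phi> \<Longrightarrow> l X \<in> X"
    and fixed: "\<And>X g. X \<in> orbits G E \<phi> \<Longrightarrow> g \<in> stabilizer G \<phi> (l X) \<Longrightarrow> a g (f X) = f X"
  obtains w where "\<And>g x. g \<in> carrier G \<Longrightarrow> x \<in> E \<Longrightarrow> w (\<phi> g x) = a g (w x)"
    "\<And>X. X \<in> orbits G E \<phi> \<Longrightarrow> w (l X) = f X"
proof -
  interpret group G using group_hom group_hom.axioms(1) by blast
  define k where "k = (\<lambda>x. SOME g. g \<in> carrier G \<and> \<phi> g (l (orbit G \<phi> x)) = x)"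
  define w where "w = (\<lambda>x. a (k x) (f (orbit G \<phi> x)))"
  \<comment> \<open>Both \<open>g\<close> and the chosen \<open>k x\<close> carry \<open>l X\<close>
    to the same vertex, so they differ by an element of the stabilizer of
    \<open>l X\<close>.\<close>
  have key: "w (\<phi> g (l X)) = a g (f X)" if g: "g \<in> carrier G" and X: "X \<in> orbits G E \<phi>" for g X
  proof -
    define x where "x = \<phi> g (l X)"
    have lX: "l X \<in> E" using orbits_closed[OF X lift[OF X]] .
    have "x \<in> X"
      using orbits_eq_orbit[OF X lift[OF X]] g unfolding x_def orbit_def by blast
    then have orb: "orbit G \<phi> x = X" using orbits_eq_orbit[OF X] by simp
    have kx: "k x \<in> carrier G \<and> \<phi> (k x) (l X) = x"
      unfolding k_def orb by (rule someI[of _ g]) (simp add: g x_def)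
    have "\<phi> (inv g \<otimes> k x) (l X) = \<phi> (inv g) x"
      using composition_rule[OF lX, of "inv g" "k x"] g kx by simp
    also have "\<dots> = l X" using orbit_sym_aux[OF g lX] by (simp add: x_def)
    finally have "inv g \<otimes> k x \<in> stabilizer G \<phi> (l X)"
      using g kx by (simp add: stabilizer_def)
    then have "a (inv g \<otimes> k x) (f X) = f X" by (rule fixed[OF X])
    then have "a (g \<otimes> (inv g \<otimes> k x)) (f X) = a g (f X)"
      using a_mult[of g "inv g \<otimes> k x"] g kx by simp
    moreover have "g \<otimes> (inv g \<otimes> k x) = k x"
      using g kx by (simp flip: m_assoc)
    ultimately show ?thesis by (simp add: w_def orb flip: x_def)
  qed
  have "w (\<phi> g x) = a g (w x)" if g: "g \<in> carrier G" and x: "x \<in> E" for g x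
  proof -
    define X where "X = orbit G \<phi> x"
    have X: "X \<in> orbits G E \<phi>" using x by (auto simp: X_def orbits_def)
    have lX: "l X \<in> E" using orbits_closed[OF X lift[OF X]] .
    have "x \<in> orbit G \<phi> (l X)"
      using orbits_eq_orbit[OF X lift[OF X]] orbit_refl[OF x] by (simp add: X_def)
    then obtain h where h: "h \<in> carrier G" "x = \<phi> h (l X)" unfolding orbit_def by blast
    have "\<phi> g x = \<phi> (g \<otimes> h) (l X)" using composition_rule[OF lX g h(1)] h(2) by simp
    then show ?thesis using key[of "g \<otimes> h" X] key[OF h(1) X] g h X a_mult by simp
  qed
  moreover have "w (l X) = f X" if X: "X \<in> orbits G E \<phi>" for X
  proof -
    have "\<phi> \<one> (l X) = l X"
      using orbits_closed[OF X lift[OF X]] id_eq_one by (metis restrict_apply')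
    then show ?thesis using key[OF one_closed X] a_one by simp
  qed
  ultimately show ?thesis using that by blast
qed

end

section \<open>Cocycles and equivariant cochains\<close>

lemma trivial_FactGroup_iff:
  assumes "N \<lhd> H"
  shows "trivial_group (H Mod N) \<longleftrightarrow> carrier H \<subseteq> N"
proof -
  interpret normal N H by (fact assms)
  have "trivial_group (H Mod N) \<longleftrightarrow> (\<forall>x\<in>carrier H. N #>\<^bsub>H\<^esub> x = N)"
    using factorgroup_is_group one_closed
    unfolding trivial_group_def FactGroup_def RCOSETS_def by auto
  moreover have "N #>\<^bsub>H\<^esub> x = N \<longleftrightarrow> x \<in> N" if "x \<in> carrier H" for x
    using coset_join1[OF _ that is_subgroup] coset_join2[OF that is_subgroup] by blast
  ultimately show ?thesis by auto
qed

lemma norm_sum_list_le: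
  fixes f :: "'i \<Rightarrow> 'a::real_normed_vector"
  shows "norm (\<Sum>i\<leftarrow>xs. f i) \<le> (\<Sum>i\<leftarrow>xs. norm (f i))"
  by (induction xs) (auto intro: norm_triangle_le)

section \<open>The group of cocycles and its quotients\<close>

locale unitary_module_action = topological_group G T
  for G :: "('g, 'x) monoid_scheme" (structure) and T +
  fixes \<pi> :: "'g \<Rightarrow> 'm::complex_hilbert \<Rightarrow> 'm"
  assumes unitary: "unitary_module G T \<pi>"
begin

lemma rep_add: "g \<in> carrier G \<Longrightarrow> \<pi> g (x + y) = \<pi> g x + \<pi> g y"
  and rep_one: "\<pi> \<one> x = x"
  and rep_mult: "g \<in> carrier G \<Longrightarrow> h \<in> carrier G \<Longrightarrow> \<pi> (g \<otimes> h) x = \<pi> g (\<pi> h x)"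
  and rep_continuous: "continuous_map T euclidean (\<lambda>g. \<pi> g x)"
  and rep_dist: "g \<in> carrier G \<Longrightarrow> dist (\<pi> g x) (\<pi> g y) = dist x y"
  using unitary unitary_module_dist[OF unitary] unfolding unitary_module_iff by blast+

lemma rep_zero: "g \<in> carrier G \<Longrightarrow> \<pi> g 0 = 0"
  using rep_add[of g 0 0] by simp

lemma rep_minus: "g \<in> carrier G \<Longrightarrow> \<pi> g (- x) = - \<pi> g x"
  using rep_add[of g x "- x"] rep_zero[of g] by (simp add: eq_neg_iff_add_eq_0 add.commute)

lemma rep_diff: "g \<in> carrier G \<Longrightarrow> \<pi> g (x - y) = \<pi> g x - \<pi> g y"
  using rep_add[of g x "- y"] rep_minus[of g y] by simp

lemma unitary_subgroup:
  assumes K: "subgroup K G"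
  shows "unitary_module (G\<lparr>carrier := K\<rparr>) (subtopology T K) \<pi>"
proof -
  have "K \<subseteq> carrier G" using K subgroup.subset by blast
  then show ?thesis
    using unitary subgroup_topological_group[OF K]
    unfolding unitary_module_iff by (auto simp: subset_iff intro: continuous_map_from_subtopology)
qed

lemma cocycleD:
  assumes "b \<in> cocycles G T \<pi>"
  shows "continuous_map T euclidean b"
    and "g \<in> carrier G \<Longrightarrow> h \<in> carrier G \<Longrightarrow> b (g \<otimes> h) = b g + \<pi> g (b h)"
  using assms by (auto simp: cocycles_def)

lemma cocyclesI:
  assumes "b \<in> extensional (carrier G)" "continuous_map T euclidean b"
    "\<And>g h. g \<in> carrier G \<Longrightarrow> h \<in> carrier G \<Longrightarrow> b (g \<otimes> h) = b g + \<pi> g (b h)"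
  shows "b \<in> cocycles G T \<pi>"
  using assms by (simp add: cocycles_def)

lemma zero_cocycle: "(\<lambda>g\<in>carrier G. 0) \<in> cocycles G T \<pi>"
proof (rule cocyclesI)
  show "continuous_map T euclidean (\<lambda>g\<in>carrier G. 0 :: 'm)"
    by (rule continuous_map_eq[of _ _ "\<lambda>_. 0"]) (simp_all add: topspace_eq)
qed (simp_all add: rep_zero)

lemma add_cocycle:
  assumes "b \<in> cocycles G T \<pi>" "c \<in> cocycles G T \<pi>"
  shows "(\<lambda>g\<in>carrier G. b g + c g) \<in> cocycles G T \<pi>"
proof (rule cocyclesI)
  have "continuous_map T euclidean (\<lambda>g. b g + c g)"
    by (intro continuous_map_add cocycleD(1) assms)
  then show "continuous_map T euclidean (\<lambda>g\<in>carrier G. b g + c g)"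
    by (rule continuous_map_eq) (simp add: topspace_eq)
qed (simp_all add: cocycleD(2)[OF assms(1)] cocycleD(2)[OF assms(2)] rep_add)

lemma minus_cocycle:
  assumes "b \<in> cocycles G T \<pi>"
  shows "(\<lambda>g\<in>carrier G. - b g) \<in> cocycles G T \<pi>"
proof (rule cocyclesI)
  have "continuous_map T euclidean (\<lambda>g. - b g)"
    by (intro continuous_map_minus cocycleD(1) assms)
  then show "continuous_map T euclidean (\<lambda>g\<in>carrier G. - b g)"
    by (rule continuous_map_eq) (simp add: topspace_eq)
qed (simp_all add: cocycleD(2)[OF assms] rep_minus)

lemma coboundary_cocycle: "(\<lambda>g\<in>carrier G. \<pi> g m - m) \<in> cocycles G T \<pi>"
proof (rule cocyclesI)
  have "continuous_map T euclidean (\<lambda>g. \<pi> g m - m)"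
    by (intro continuous_map_diff rep_continuous) simp
  then show "continuous_map T euclidean (\<lambda>g\<in>carrier G. \<pi> g m - m)"
    by (rule continuous_map_eq) (simp add: topspace_eq)
qed (simp_all add: rep_mult rep_diff)

lemma cocycles_eqI:
  assumes "b \<in> cocycles G T \<pi>" "c \<in> extensional (carrier G)" "\<And>g. g \<in> carrier G \<Longrightarrow> b g = c g"
  shows "b = c"
  using assms by (intro extensionalityI[of b "carrier G"]) (auto simp: cocycles_def)

lemma cocycle_group_simps [simp]:
  "carrier (cocycle_group G T \<pi>) = cocycles G T \<pi>"
  "b \<otimes>\<^bsub>cocycle_group G T \<pi>\<^esub> c = (\<lambda>g\<in>carrier G. b g + c g)"
  "\<one>\<^bsub>cocycle_group G T \<pi>\<^esub> = (\<lambda>g\<in>carrier G. 0)"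
  by (simp_all add: cocycle_group_def)

lemma cocycle_comm_group: "Group.comm_group (cocycle_group G T \<pi>)"
proof (rule comm_groupI)
  fix b assume b: "b \<in> carrier (cocycle_group G T \<pi>)"
  show "\<one>\<^bsub>cocycle_group G T \<pi>\<^esub> \<otimes>\<^bsub>cocycle_group G T \<pi>\<^esub> b = b"
    by (rule cocycles_eqI[symmetric]) (use b in simp_all)
  show "\<exists>c\<in>carrier (cocycle_group G T \<pi>). c \<otimes>\<^bsub>cocycle_group G T \<pi>\<^esub> b = \<one>\<^bsub>cocycle_group G T \<pi>\<^esub>"
    using minus_cocycle[of b] b
    by (intro bexI[of _ "\<lambda>g\<in>carrier G. - b g"]) (auto intro: restrict_ext)
qed (auto simp: add_cocycle zero_cocycle add_ac intro: restrict_ext)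

lemma inv_cocycle_group:
  assumes "b \<in> cocycles G T \<pi>"
  shows "inv\<^bsub>cocycle_group G T \<pi>\<^esub> b = (\<lambda>g\<in>carrier G. - b g)"
proof -
  interpret Z: Group.comm_group "cocycle_group G T \<pi>" by (rule cocycle_comm_group)
  show ?thesis
    by (rule Z.inv_equality) (use assms minus_cocycle in \<open>auto intro: restrict_ext\<close>)
qed

lemma subgroup_coboundaries: "subgroup (coboundaries G \<pi>) (cocycle_group G T \<pi>)"
proof -
  interpret Z: Group.comm_group "cocycle_group G T \<pi>" by (rule cocycle_comm_group)
  show ?thesis
  proof (rule Z.subgroupI)
    show "coboundaries G \<pi> \<subseteq> carrier (cocycle_group G T \<pi>)"
      using coboundary_cocycle by (auto simp: coboundaries_def)
  next
    fix b assume "b \<in> coboundaries G \<pi>"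
    then obtain m where m: "b = (\<lambda>g\<in>carrier G. \<pi> g m - m)" unfolding coboundaries_def by blast
    have "(\<lambda>g\<in>carrier G. - b g) = (\<lambda>g\<in>carrier G. \<pi> g (- m) - (- m))"
      by (rule restrict_ext) (simp add: m rep_minus)
    then have "inv\<^bsub>cocycle_group G T \<pi>\<^esub> b = (\<lambda>g\<in>carrier G. \<pi> g (- m) - (- m))"
      using inv_cocycle_group[of b] coboundary_cocycle[of m] unfolding m by (simp only:)
    then show "inv\<^bsub>cocycle_group G T \<pi>\<^esub> b \<in> coboundaries G \<pi>"
      unfolding coboundaries_def by blast
  next
    fix b c assume "b \<in> coboundaries G \<pi>" "c \<in> coboundaries G \<pi>"
    then obtain m n where mn: "b = (\<lambda>g\<in>carrier G. \<pi> g m - m)" "c = (\<lambda>g\<in>carrier G. \<pi> g n - n)"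
      unfolding coboundaries_def by blast
    have "(\<lambda>g\<in>carrier G. b g + c g) = (\<lambda>g\<in>carrier G. \<pi> g (m + n) - (m + n))"
      by (rule restrict_ext) (simp add: mn rep_add)
    then show "b \<otimes>\<^bsub>cocycle_group G T \<pi>\<^esub> c \<in> coboundaries G \<pi>"
      unfolding coboundaries_def by simp
  qed (simp add: coboundaries_def)
qed

lemma subgroup_closed_coboundaries: "subgroup (closed_coboundaries G T \<pi>) (cocycle_group G T \<pi>)"
proof -
  interpret Z: Group.comm_group "cocycle_group G T \<pi>" by (rule cocycle_comm_group)
  interpret B: subgroup "coboundaries G \<pi>" "cocycle_group G T \<pi>" by (rule subgroup_coboundaries)
  have compact: "g \<in> carrier G" if "compactin T K" "g \<in> K" for K g
    using that compactin_subset_topspace topspace_eq by blast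
  show ?thesis
  proof (rule Z.subgroupI)
    show "closed_coboundaries G T \<pi> \<subseteq> carrier (cocycle_group G T \<pi>)"
      by (auto simp: closed_coboundaries_def)
    show "closed_coboundaries G T \<pi> \<noteq> {}"
      using B.one_closed zero_cocycle unfolding closed_coboundaries_def by force
  next
    fix b assume b: "b \<in> closed_coboundaries G T \<pi>"
    then have bZ: "b \<in> cocycles G T \<pi>" by (simp add: closed_coboundaries_def)
    have "\<exists>c\<in>coboundaries G \<pi>. \<forall>g\<in>K. dist ((\<lambda>g\<in>carrier G. - b g) g) (c g) < \<epsilon>"
      if K: "compactin T K" "\<epsilon> > 0" for K \<epsilon>
    proof -
      obtain c where c: "c \<in> coboundaries G \<pi>" "\<And>g. g \<in> K \<Longrightarrow> dist (b g) (c g) < \<epsilon>"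
        using b K unfolding closed_coboundaries_def by blast
      have "c \<in> cocycles G T \<pi>" using c(1) B.subset by auto
      then have "(\<lambda>g\<in>carrier G. - c g) \<in> coboundaries G \<pi>"
        using B.m_inv_closed[OF c(1)] by (simp only: inv_cocycle_group)
      moreover have "dist ((\<lambda>g\<in>carrier G. - b g) g) ((\<lambda>g\<in>carrier G. - c g) g) < \<epsilon>" if "g \<in> K" for g
        using c(2)[OF that] compact[OF K(1) that] by (simp add: dist_minus)
      ultimately show ?thesis by blast
    qed
    then show "inv\<^bsub>cocycle_group G T \<pi>\<^esub> b \<in> closed_coboundaries G T \<pi>"
      using minus_cocycle[OF bZ] by (simp add: inv_cocycle_group[OF bZ] closed_coboundaries_def)
  next
    fix b c assume b: "b \<in> closed_coboundaries G T \<pi>" and c: "c \<in> closed_coboundaries G T \<pi>"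
    have "\<exists>a\<in>coboundaries G \<pi>. \<forall>g\<in>K. dist ((\<lambda>g\<in>carrier G. b g + c g) g) (a g) < \<epsilon>"
      if K: "compactin T K" "\<epsilon> > 0" for K \<epsilon>
    proof -
      have half: "compactin T K \<and> \<epsilon> / 2 > 0" using K by simp
      obtain b' where b': "b' \<in> coboundaries G \<pi>" "\<And>g. g \<in> K \<Longrightarrow> dist (b g) (b' g) < \<epsilon> / 2"
        using b half unfolding closed_coboundaries_def by blast
      obtain c' where c': "c' \<in> coboundaries G \<pi>" "\<And>g. g \<in> K \<Longrightarrow> dist (c g) (c' g) < \<epsilon> / 2"
        using c half unfolding closed_coboundaries_def by blast
      have "(\<lambda>g\<in>carrier G. b' g + c' g) \<in> coboundaries G \<pi>"
        using B.m_closed[OF b'(1) c'(1)] by simp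
      moreover have "dist ((\<lambda>g\<in>carrier G. b g + c g) g) ((\<lambda>g\<in>carrier G. b' g + c' g) g) < \<epsilon>"
        if "g \<in> K" for g
        using b'(2)[OF that] c'(2)[OF that] compact[OF K(1) that]
          dist_triangle_add[of "b g" "c g" "b' g" "c' g"] by simp
      ultimately show ?thesis by blast
    qed
    then show "b \<otimes>\<^bsub>cocycle_group G T \<pi>\<^esub> c \<in> closed_coboundaries G T \<pi>"
      using add_cocycle b c by (simp add: closed_coboundaries_def)
  qed
qed

text \<open>The cocycle group is commutative, so the coboundaries are normal and the factor group is
  trivial exactly when they exhaust it.\<close>

lemma trivial_H1_iff: "trivial_group (H1 G T \<pi>) \<longleftrightarrow> cocycles G T \<pi> \<subseteq> coboundaries G \<pi>"
proof -
  interpret Z: Group.comm_group "cocycle_group G T \<pi>" by (rule cocycle_comm_group)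
  show ?thesis
    using trivial_FactGroup_iff[of "coboundaries G \<pi>" "cocycle_group G T \<pi>"] subgroup_coboundaries
    by (simp add: H1_def Z.normal_iff_subgroup)
qed

lemma trivial_reduced_H1_iff:
  "trivial_group (reduced_H1 G T \<pi>) \<longleftrightarrow> cocycles G T \<pi> \<subseteq> closed_coboundaries G T \<pi>"
proof -
  interpret Z: Group.comm_group "cocycle_group G T \<pi>" by (rule cocycle_comm_group)
  show ?thesis
    using trivial_FactGroup_iff[of "closed_coboundaries G T \<pi>" "cocycle_group G T \<pi>"]
      subgroup_closed_coboundaries
    by (simp add: reduced_H1_def Z.normal_iff_subgroup)
qed

end

section \<open>Cocycles as differentials on the tree\<close>

locale tree_action_module =
  tree_action_without_inversion G \<Gamma> arev \<phi> \<psi> + unitary_module_action G T \<pi>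
  for G :: "('g, 'x) monoid_scheme" (structure) and \<Gamma> :: "('v, 'e) pre_digraph" and arev \<phi> \<psi> T
    and \<pi> :: "'g \<Rightarrow> 'm::complex_hilbert \<Rightarrow> 'm" +
  assumes stabilizer_open: "x \<in> verts \<Gamma> \<Longrightarrow> openin T (stabilizer G \<phi> x)"
    and stabilizer_T: "x \<in> verts \<Gamma> \<Longrightarrow>
      property_T (G\<lparr>carrier := stabilizer G \<phi> x\<rparr>) (subtopology T (stabilizer G \<phi> x))"
begin

lemma stabilizer_unitary:
  assumes "x \<in> verts \<Gamma>"
  shows "unitary_module (G\<lparr>carrier := stabilizer G \<phi> x\<rparr>) (subtopology T (stabilizer G \<phi> x)) \<pi>"
  by (rule unitary_subgroup[OF vert.stabilizer_subgroup[OF assms]])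

text \<open>The set is empty or a left coset \<open>h\<close> times the stabilizer of
  \<open>x\<close>, the preimage of an open set under a translation.\<close>

lemma transporter_open:
  assumes x: "x \<in> verts \<Gamma>"
  shows "openin T {g \<in> carrier G. \<phi> g x = y}"
proof (cases "\<exists>h\<in>carrier G. \<phi> h x = y")
  case True
  then obtain h where h: "h \<in> carrier G" "\<phi> h x = y" by blast
  have "continuous_map T T (\<lambda>g. inv h \<otimes> g)"
  proof -
    have "continuous_map T (prod_topology T T) (\<lambda>g. (inv h, g))"
      using h topspace_eq by (intro continuous_map_pairedI) auto
    from continuous_map_compose[OF this mult_continuous] show ?thesis by (simp add: comp_def)
  qed
  then have "openin T {g \<in> topspace T. inv h \<otimes> g \<in> stabilizer G \<phi> x}"
    by (rule openin_continuous_map_preimage) (rule stabilizer_open[OF x])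
  moreover have "inv h \<otimes> g \<in> stabilizer G \<phi> x \<longleftrightarrow> \<phi> g x = y" if g: "g \<in> carrier G" for g
  proof -
    have "inv h \<otimes> g \<in> stabilizer G \<phi> x \<longleftrightarrow> \<phi> (inv h) (\<phi> g x) = x"
      using g h x vert.composition_rule[OF x, of "inv h" g] by (simp add: stabilizer_def)
    also have "\<dots> \<longleftrightarrow> \<phi> g x = y"
    proof
      assume *: "\<phi> (inv h) (\<phi> g x) = x"
      have "\<phi> g x \<in> verts \<Gamma>" using vert.element_image[OF g x] by simp
      then have "\<phi> (inv (inv h)) x = \<phi> g x"
        using vert.orbit_sym_aux[of "inv h" "\<phi> g x" x] * h by simp
      then show "\<phi> g x = y" using h by simp
    next
      assume "\<phi> g x = y"
      then show "\<phi> (inv h) (\<phi> g x) = x" using vert.orbit_sym_aux[OF h(1) x] h(2) by simp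
    qed
    finally show ?thesis .
  qed
  ultimately show ?thesis
    by (simp add: topspace_eq cong: conj_cong)
next
  case False
  then have "{g \<in> carrier G. \<phi> g x = y} = {}" by blast
  then show ?thesis by (simp only: openin_empty)
qed

definition equivariant :: "('v \<Rightarrow> 'm) \<Rightarrow> bool" where
  "equivariant w \<longleftrightarrow> (\<forall>g\<in>carrier G. \<forall>x\<in>verts \<Gamma>. w (\<phi> g x) = \<pi> g (w x))"

definition affine_equivariant :: "('g \<Rightarrow> 'm) \<Rightarrow> ('v \<Rightarrow> 'm) \<Rightarrow> bool" where
  "affine_equivariant b u \<longleftrightarrow> (\<forall>g\<in>carrier G. \<forall>x\<in>verts \<Gamma>. u (\<phi> g x) = \<pi> g (u x) + b g)"

definition arc_cochain :: "('e \<Rightarrow> 'm) \<Rightarrow> bool" where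
  "arc_cochain c \<longleftrightarrow> (\<forall>e\<in>arcs \<Gamma>. c (arev e) = - c e) \<and>
     (\<forall>g\<in>carrier G. \<forall>e\<in>arcs \<Gamma>. c (\<psi> g e) = \<pi> g (c e))"

definition differential :: "('v \<Rightarrow> 'm) \<Rightarrow> 'e \<Rightarrow> 'm" where
  "differential u e = u (head \<Gamma> e) - u (tail \<Gamma> e)"

lemma arc_closed: "g \<in> carrier G \<Longrightarrow> e \<in> arcs \<Gamma> \<Longrightarrow> \<psi> g e \<in> arcs \<Gamma>"
  using arc.element_image by blast

lemma vert_closed: "g \<in> carrier G \<Longrightarrow> x \<in> verts \<Gamma> \<Longrightarrow> \<phi> g x \<in> verts \<Gamma>"
  using vert.element_image by blast

lemma action_head: "g \<in> carrier G \<Longrightarrow> e \<in> arcs \<Gamma> \<Longrightarrow> head \<Gamma> (\<psi> g e) = \<phi> g (head \<Gamma> e)"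
  using action_tail[of g "arev e"] action_arev[of g e] tail_arev[of e] tail_arev[of "\<psi> g e"]
    arc_closed[of g e] arev_closed[of e] by simp

text \<open>The translation part \<open>b g\<close> is the same at both ends of an arc and
  cancels.\<close>

lemma differential_affine:
  assumes "affine_equivariant b u"
  shows "arc_cochain (differential u)"
  using assms unfolding arc_cochain_def affine_equivariant_def differential_def
  by (simp add: tail_arev head_arev action_tail action_head rep_diff)

lemma affine_zero: "affine_equivariant (\<lambda>_. 0) w \<longleftrightarrow> equivariant w"
  by (simp add: affine_equivariant_def equivariant_def)

text \<open>The cocycle identity says precisely that \<open>m \<mapsto> \<pi> g m + b g\<close> is
  an action, to which the general extension lemma applies.\<close>

lemma affine_extension:
  assumes b: "b \<in> cocycles G T \<pi>"
    and l: "\<And>X. X \<in> orbits G (verts \<Gamma>) \<phi> \<Longrightarrow> l X \<in> X"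
    and f: "\<And>X g. X \<in> orbits G (verts \<Gamma>) \<phi> \<Longrightarrow> g \<in> stabilizer G \<phi> (l X) \<Longrightarrow> \<pi> g (f X) + b g = f X"
  obtains u where "affine_equivariant b u" "\<And>X. X \<in> orbits G (verts \<Gamma>) \<phi> \<Longrightarrow> u (l X) = f X"
proof -
  have one: "\<pi> \<one> m + b \<one> = m" for m
    using cocycleD(2)[OF b, of "\<one>" "\<one>"] by (simp add: rep_one)
  have mult: "\<pi> (g \<otimes> h) m + b (g \<otimes> h) = \<pi> g (\<pi> h m + b h) + b g"
    if "g \<in> carrier G" "h \<in> carrier G" for g h m
    using that cocycleD(2)[OF b] by (simp add: rep_mult rep_add add_ac)
  obtain u where "\<And>g x. g \<in> carrier G \<Longrightarrow> x \<in> verts \<Gamma> \<Longrightarrow> u (\<phi> g x) = \<pi> g (u x) + b g"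
    "\<And>X. X \<in> orbits G (verts \<Gamma>) \<phi> \<Longrightarrow> u (l X) = f X"
    using vert.equivariant_extension[of "\<lambda>g m. \<pi> g m + b g" l f, OF one mult l f] by blast
  then show ?thesis using that[of u] by (simp add: affine_equivariant_def)
qed

lemma equivariant_extension:
  assumes l: "\<And>X. X \<in> orbits G (verts \<Gamma>) \<phi> \<Longrightarrow> l X \<in> X"
    and f: "\<And>X. X \<in> orbits G (verts \<Gamma>) \<phi> \<Longrightarrow> f X \<in> fixed_vectors \<pi> (stabilizer G \<phi> (l X))"
  obtains w where "equivariant w" "\<And>X. X \<in> orbits G (verts \<Gamma>) \<phi> \<Longrightarrow> w (l X) = f X"
proof -
  have "\<pi> g (f X) = f X" if "X \<in> orbits G (verts \<Gamma>) \<phi>" "g \<in> stabilizer G \<phi> (l X)" for X g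
    using f[OF that(1)] that(2) by (simp add: fixed_vectors_def)
  from vert.equivariant_extension[of \<pi> l f, OF rep_one rep_mult l this] show ?thesis
    using that unfolding equivariant_def by metis
qed

text \<open>Property (T) of each stabilizer provides a point fixed by its affine action; these
  points serve as values at orbit representatives.\<close>

lemma affine_exists:
  assumes b: "b \<in> cocycles G T \<pi>"
  obtains u where "affine_equivariant b u"
proof -
  have orbit_ne: "\<exists>x. x \<in> X" if "X \<in> orbits G (verts \<Gamma>) \<phi>" for X
    using that vert.orbit_refl unfolding orbits_def by blast
  define l where "l = (\<lambda>X :: 'v set. SOME x. x \<in> X)"
  have l: "l X \<in> X" if "X \<in> orbits G (verts \<Gamma>) \<phi>" for X
    unfolding l_def by (rule someI_ex) (rule orbit_ne[OF that])
  have "\<exists>m. \<forall>g\<in>stabilizer G \<phi> x. \<pi> g m + b g = m" if x: "x \<in> verts \<Gamma>" for x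
  proof -
    have "continuous_map (subtopology T (stabilizer G \<phi> x)) euclidean b"
      by (rule continuous_map_from_subtopology) (rule cocycleD(1)[OF b])
    moreover have "stabilizer G \<phi> x \<subseteq> carrier G" by (rule vert.stabilizer_subset)
    ultimately obtain m where "\<And>g. g \<in> stabilizer G \<phi> x \<Longrightarrow> \<pi> g m + b g = m"
      using property_T_fixed_point[OF stabilizer_unitary[OF x] stabilizer_T[OF x], of b] cocycleD(2)[OF b]
      by (auto simp: subset_iff)
    then show ?thesis by blast
  qed
  then obtain f where f: "\<And>x g. x \<in> verts \<Gamma> \<Longrightarrow> g \<in> stabilizer G \<phi> x \<Longrightarrow> \<pi> g (f x) + b g = f x"
    by metis
  show ?thesis
  proof (rule affine_extension[OF b l, of "\<lambda>X. f (l X)"])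
    fix X g assume "X \<in> orbits G (verts \<Gamma>) \<phi>" "g \<in> stabilizer G \<phi> (l X)"
    then show "\<pi> g (f (l X)) + b g = f (l X)"
      using f vert.orbits_closed l by blast
  qed (assumption, rule that)
qed

text \<open>For a potential \<open>u\<close> and fixed \<open>g\<close>, the difference of
  \<open>u (\<phi> g x)\<close> and \<open>\<pi> g (u x)\<close> has zero differential in
  \<open>x\<close>, because \<open>c\<close> is equivariant. So it is a constant
  \<open>b g\<close>.\<close>

lemma cochain_integral:
  assumes c: "arc_cochain c"
  obtains u b where "b \<in> cocycles G T \<pi>" "affine_equivariant b u"
    "\<And>e. e \<in> arcs \<Gamma> \<Longrightarrow> differential u e = c e"
proof -
  obtain u where u: "\<And>e. e \<in> arcs \<Gamma> \<Longrightarrow> u (head \<Gamma> e) - u (tail \<Gamma> e) = c e"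
    using potential_exists[of c] c unfolding arc_cochain_def by blast
  obtain r where r: "r \<in> verts \<Gamma>"
    using tree_connected unfolding Digraph_Component.connected_def strongly_connected_def by auto
  define b where "b = (\<lambda>g\<in>carrier G. u (\<phi> g r) - \<pi> g (u r))"
  have b: "b g = u (\<phi> g x) - \<pi> g (u x)" if g: "g \<in> carrier G" and x: "x \<in> verts \<Gamma>" for g x
  proof -
    have "u (\<phi> g r) - \<pi> g (u r) = u (\<phi> g x) - \<pi> g (u x)"
    proof (rule constant_on_tree[OF _ r x])
      fix e assume e: "e \<in> arcs \<Gamma>"
      have "u (\<phi> g (head \<Gamma> e)) - u (\<phi> g (tail \<Gamma> e)) = c (\<psi> g e)"
        using u[OF arc_closed[OF g e]] by (simp add: action_head action_tail g e)
      also have "\<dots> = \<pi> g (u (head \<Gamma> e)) - \<pi> g (u (tail \<Gamma> e))"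
        using c g e u[OF e] by (simp add: arc_cochain_def flip: rep_diff)
      finally show "u (\<phi> g (head \<Gamma> e)) - \<pi> g (u (head \<Gamma> e)) = u (\<phi> g (tail \<Gamma> e)) - \<pi> g (u (tail \<Gamma> e))"
        by (simp add: algebra_simps)
    qed
    then show ?thesis using g by (simp add: b_def)
  qed
  \<comment> \<open>Independence of the vertex lets \<open>b g\<close> be computed at
    \<open>\<phi> h r\<close>.\<close>
  have "b (g \<otimes> h) = b g + \<pi> g (b h)" if gh: "g \<in> carrier G" "h \<in> carrier G" for g h
    using b[OF _ r, of "g \<otimes> h"] b[of g "\<phi> h r"] b[OF gh(2) r] gh
      vert_closed[OF gh(2) r] vert.composition_rule[OF r gh]
    by (simp add: rep_mult rep_diff)
  \<comment> \<open>On each open set of elements carrying \<open>r\<close> to a fixed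
    \<open>y\<close>, the value \<open>u (\<phi> g r)\<close> is constant, so \<open>b\<close> is
    continuous there.\<close>
  moreover have "continuous_map T euclidean b"
    unfolding continuous_map
  proof (intro conjI allI impI)
    fix U :: "'m set" assume U: "openin euclidean U"
    have "openin T {g \<in> topspace T. u y - \<pi> g (u r) \<in> U}" for y
      by (rule openin_continuous_map_preimage[OF _ U]) (intro continuous_map_diff rep_continuous, simp)
    then have "openin T ({g \<in> carrier G. \<phi> g r = y} \<inter> {g \<in> topspace T. u y - \<pi> g (u r) \<in> U})" for y
      by (intro openin_Int transporter_open r)
    then have "openin T (\<Union>y. {g \<in> carrier G. \<phi> g r = y} \<inter> {g \<in> topspace T. u y - \<pi> g (u r) \<in> U})"
      by blast
    moreover have "{g \<in> topspace T. b g \<in> U}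
        = (\<Union>y. {g \<in> carrier G. \<phi> g r = y} \<inter> {g \<in> topspace T. u y - \<pi> g (u r) \<in> U})"
      by (auto simp: b_def topspace_eq)
    ultimately show "openin T {g \<in> topspace T. b g \<in> U}" by simp
  qed simp
  ultimately have "b \<in> cocycles G T \<pi>"
    by (simp add: cocycles_def b_def)
  moreover have "affine_equivariant b u"
    using b by (simp add: affine_equivariant_def)
  ultimately show ?thesis using that[of b u] u by (simp add: differential_def)
qed

text \<open>If \<open>b\<close> is the coboundary of \<open>m\<close>, then \<open>u + m\<close> is
  equivariant with the same differential as \<open>u\<close>. Conversely, if an equivariant
  \<open>w\<close> has the differential of \<open>u\<close>, then \<open>w - u\<close> is a constant
  whose coboundary is \<open>b\<close>.\<close>

lemma coboundaries_iff_differential_onto: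
  "cocycles G T \<pi> \<subseteq> coboundaries G \<pi> \<longleftrightarrow>
     (\<forall>c. arc_cochain c \<longrightarrow> (\<exists>w. equivariant w \<and> (\<forall>e\<in>arcs \<Gamma>. differential w e = c e)))"
proof (intro iffI allI impI subsetI)
  fix c assume B: "cocycles G T \<pi> \<subseteq> coboundaries G \<pi>" and c: "arc_cochain c"
  obtain u b where b: "b \<in> cocycles G T \<pi>" and u: "affine_equivariant b u"
    and du: "\<And>e. e \<in> arcs \<Gamma> \<Longrightarrow> differential u e = c e"
    using cochain_integral[OF c] by blast
  obtain m where "b = (\<lambda>g\<in>carrier G. \<pi> g m - m)"
    using B b unfolding coboundaries_def by blast
  then have "equivariant (\<lambda>x. u x + m)"
    using u by (simp add: equivariant_def affine_equivariant_def rep_add)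
  moreover have "\<forall>e\<in>arcs \<Gamma>. differential (\<lambda>x. u x + m) e = c e"
    using du by (simp add: differential_def)
  ultimately show "\<exists>w. equivariant w \<and> (\<forall>e\<in>arcs \<Gamma>. differential w e = c e)" by blast
next
  fix b assume onto: "\<forall>c. arc_cochain c \<longrightarrow> (\<exists>w. equivariant w \<and> (\<forall>e\<in>arcs \<Gamma>. differential w e = c e))"
    and b: "b \<in> cocycles G T \<pi>"
  obtain u where u: "affine_equivariant b u" using affine_exists[OF b] .
  obtain w where w: "equivariant w" "\<And>e. e \<in> arcs \<Gamma> \<Longrightarrow> differential w e = differential u e"
    using onto differential_affine[OF u] by blast
  obtain r where r: "r \<in> verts \<Gamma>"
    using tree_connected unfolding Digraph_Component.connected_def strongly_connected_def by auto
  have const: "w x - u x = w r - u r" if "x \<in> verts \<Gamma>" for x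
    by (rule constant_on_tree[OF _ that r]) (use w(2) in \<open>simp add: differential_def algebra_simps\<close>)
  have "b g = \<pi> g (w r - u r) - (w r - u r)" if g: "g \<in> carrier G" for g
    using const[OF vert_closed[OF g r]] w(1) u g r
    by (simp add: equivariant_def affine_equivariant_def rep_diff algebra_simps)
  then have "b = (\<lambda>g\<in>carrier G. \<pi> g (w r - u r) - (w r - u r))"
    using b by (intro extensionalityI[of b "carrier G"]) (auto simp: cocycles_def)
  then show "b \<in> coboundaries G \<pi>" unfolding coboundaries_def by blast
qed

text \<open>The open sets \<open>U y\<close> cover \<open>K\<close>, and a finite subcover lists all
  possible images of \<open>x\<close>.\<close>

lemma compact_orbit_finite:
  assumes K: "compactin T K" and x: "x \<in> verts \<Gamma>"
  shows "finite ((\<lambda>g. \<phi> g x) ` K)"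
proof -
  define U where "U = (\<lambda>y. {g \<in> carrier G. \<phi> g x = y})"
  have KG: "K \<subseteq> carrier G" using compactin_subset_topspace[OF K] topspace_eq by simp
  have "\<exists>F. finite F \<and> F \<subseteq> range U \<and> K \<subseteq> \<Union>F"
  proof (rule compactinD[OF K])
    show "K \<subseteq> \<Union>(range U)" using KG by (auto simp: U_def)
  qed (auto simp: U_def intro: transporter_open[OF x])
  then obtain Y where Y: "finite Y" "K \<subseteq> \<Union>(U ` Y)"
    by (metis finite_subset_image)
  then have "(\<lambda>g. \<phi> g x) ` K \<subseteq> Y" by (auto simp: U_def)
  then show ?thesis using Y(1) finite_subset by blast
qed

text \<open>\<open>K\<close> moves \<open>r\<close> to finitely many vertices, and walks to them
  meet finitely many arcs. Approximating the differential of \<open>u\<close> there by that of an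
  equivariant \<open>w\<close> makes \<open>u - w\<close> nearly constant on these vertices.\<close>

lemma closed_coboundary_if_differential_dense:
  assumes dense: "\<And>c F \<epsilon>. arc_cochain c \<Longrightarrow> finite F \<Longrightarrow> F \<subseteq> arcs \<Gamma> \<Longrightarrow> \<epsilon> > 0 \<Longrightarrow>
      \<exists>w. equivariant w \<and> (\<forall>e\<in>F. dist (differential w e) (c e) < \<epsilon>)"
    and b: "b \<in> cocycles G T \<pi>"
  shows "b \<in> closed_coboundaries G T \<pi>"
  unfolding closed_coboundaries_def
proof (intro CollectI conjI b allI impI)
  fix K and \<epsilon> :: real assume K: "compactin T K \<and> \<epsilon> > 0"
  then have KG: "K \<subseteq> carrier G" using compactin_subset_topspace topspace_eq by metis
  obtain u where u: "affine_equivariant b u" using affine_exists[OF b] .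
  obtain r where r: "r \<in> verts \<Gamma>"
    using tree_connected unfolding Digraph_Component.connected_def strongly_connected_def by auto
  define W where "W = (\<lambda>g. \<phi> g r) ` K"
  have W: "finite W" "W \<subseteq> verts \<Gamma>"
    using compact_orbit_finite[OF _ r] K vert_closed[OF _ r] KG by (auto simp: W_def)
  have "\<exists>p. awalk r p y" if "y \<in> W" for y
    using connected_awalk[OF tree_connected r] W(2) that by blast
  then obtain p where p: "\<And>y. y \<in> W \<Longrightarrow> awalk r (p y) y" by metis
  define F where "F = (\<Union>y\<in>W. set (p y))"
  have F: "finite F" "F \<subseteq> arcs \<Gamma>" using W(1) p by (auto simp: F_def)
  \<comment> \<open>The total length bounds the length of each walk, hence the number of errors
    \<delta> that add up; \<open>Suc N\<close> avoids division by zero and makes the final estimate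
    strict.\<close>
  define N where "N = (\<Sum>y\<in>W. length (p y))"
  define \<delta> where "\<delta> = \<epsilon> / real (Suc N)"
  have \<delta>: "\<delta> > 0" using K by (simp add: \<delta>_def)
  obtain w where w: "equivariant w" "\<And>e. e \<in> F \<Longrightarrow> dist (differential w e) (differential u e) < \<delta>"
    using dense[OF differential_affine[OF u] F \<delta>] by blast
  define d where "d = (\<lambda>x. u x - w x)"
  have near: "norm (d y - d r) < \<epsilon>" if y: "y \<in> W" for y
  proof -
    have "d y - d r = (\<Sum>e\<leftarrow>p y. d (head \<Gamma> e) - d (tail \<Gamma> e))"
      by (rule awalk_sum_difference[OF p[OF y], symmetric])
    also have "norm \<dots> \<le> (\<Sum>e\<leftarrow>p y. norm (d (head \<Gamma> e) - d (tail \<Gamma> e)))"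
      by (rule norm_sum_list_le)
    also have "\<dots> \<le> (\<Sum>e\<leftarrow>p y. \<delta>)"
    proof (rule sum_list_mono)
      fix e assume "e \<in> set (p y)"
      then have "dist (differential w e) (differential u e) < \<delta>" using y w(2) by (auto simp: F_def)
      then show "norm (d (head \<Gamma> e) - d (tail \<Gamma> e)) \<le> \<delta>"
        by (simp add: d_def differential_def dist_norm norm_minus_commute algebra_simps)
    qed
    also have "\<dots> = real (length (p y)) * \<delta>" by (simp add: sum_list_triv)
    also have "\<dots> \<le> real N * \<delta>"
      using W(1) y \<delta> unfolding N_def by (intro mult_right_mono) (auto intro: member_le_sum)
    also have "\<dots> < real (Suc N) * \<delta>" using \<delta> by simp
    also have "\<dots> = \<epsilon>" by (simp add: \<delta>_def)
    finally show ?thesis .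
  qed
  \<comment> \<open>The coboundary of \<open>- d r\<close> approximates \<open>b\<close>: their
    difference at \<open>g\<close> is \<open>d (\<phi> g r) - d r\<close>.\<close>
  have "dist (b g) ((\<lambda>g\<in>carrier G. \<pi> g (- d r) - - d r) g) < \<epsilon>" if g: "g \<in> K" for g
  proof -
    have gG: "g \<in> carrier G" using g KG by blast
    have "b g - (\<pi> g (- d r) - - d r) = d (\<phi> g r) - d r"
      using u w(1) gG r
      by (simp add: d_def equivariant_def affine_equivariant_def rep_minus rep_diff)
    moreover have "norm (d (\<phi> g r) - d r) < \<epsilon>" using near g by (simp add: W_def)
    ultimately show ?thesis using gG by (simp only: dist_norm restrict_apply if_True)
  qed
  then show "\<exists>c\<in>coboundaries G \<pi>. \<forall>g\<in>K. dist (b g) (c g) < \<epsilon>"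
    unfolding coboundaries_def by blast
qed

text \<open>Approximating \<open>b\<close> by a coboundary makes a translate \<open>v\<close> of the
  potential almost equivariant on a compact set. Property (T) then moves its values at orbit
  representatives to nearby fixed vectors, which extend to an equivariant \<open>w\<close>.\<close>

lemma differential_dense_if_closed_coboundaries:
  assumes B: "cocycles G T \<pi> \<subseteq> closed_coboundaries G T \<pi>"
    and c: "arc_cochain c" and F: "finite F" "F \<subseteq> arcs \<Gamma>" and \<epsilon>: "\<epsilon> > 0"
  shows "\<exists>w. equivariant w \<and> (\<forall>e\<in>F. dist (differential w e) (c e) < \<epsilon>)"
proof -
  obtain u b where b: "b \<in> cocycles G T \<pi>" and u: "affine_equivariant b u"
    and du: "\<And>e. e \<in> arcs \<Gamma> \<Longrightarrow> differential u e = c e"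
    using cochain_integral[OF c] by blast
  have carrier_eq: "carrier (G\<lparr>carrier := K\<rparr>) = K" for K by simp
  have "\<exists>Q \<eta>. compactin T Q \<and> Q \<subseteq> stabilizer G \<phi> x \<and> \<eta> > 0 \<and>
      (\<forall>m \<delta>. \<delta> > 0 \<longrightarrow> (\<forall>g\<in>Q. dist (\<pi> g m) m < \<eta> * \<delta>) \<longrightarrow>
        (\<exists>y\<in>fixed_vectors \<pi> (stabilizer G \<phi> x). dist m y < \<delta>))" if x: "x \<in> verts \<Gamma>" for x
  proof -
    obtain Q \<eta> where Q: "compactin (subtopology T (stabilizer G \<phi> x)) Q" "\<eta> > 0"
      "\<And>m \<delta>. \<delta> > 0 \<Longrightarrow> (\<And>g. g \<in> Q \<Longrightarrow> dist (\<pi> g m) m < \<eta> * \<delta>) \<Longrightarrow>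
        \<exists>y\<in>fixed_vectors \<pi> (stabilizer G \<phi> x). dist m y < \<delta>"
      using property_T_near_fixed_vectors[OF stabilizer_unitary[OF x] stabilizer_T[OF x], unfolded carrier_eq]
      by blast
    from Q(1) have "compactin T Q" "Q \<subseteq> stabilizer G \<phi> x"
      by (simp_all add: compactin_subtopology)
    with Q(2,3) show ?thesis by (intro exI[of _ Q] exI[of _ \<eta>]) simp
  qed
  then obtain Q \<eta> where Q: "\<And>x. x \<in> verts \<Gamma> \<Longrightarrow> compactin T (Q x)"
    "\<And>x. x \<in> verts \<Gamma> \<Longrightarrow> Q x \<subseteq> stabilizer G \<phi> x"
    and \<eta>: "\<And>x. x \<in> verts \<Gamma> \<Longrightarrow> \<eta> x > 0"
    and near: "\<And>x m \<delta>. x \<in> verts \<Gamma> \<Longrightarrow> \<delta> > 0 \<Longrightarrow> (\<forall>g\<in>Q x. dist (\<pi> g m) m < \<eta> x * \<delta>) \<Longrightarrow>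
      \<exists>y\<in>fixed_vectors \<pi> (stabilizer G \<phi> x). dist m y < \<delta>"
    by metis
  define l where "l = (\<lambda>X :: 'v set. SOME x. x \<in> X)"
  have l: "l X \<in> X" if "X \<in> orbits G (verts \<Gamma>) \<phi>" for X
  proof -
    have "\<exists>x. x \<in> X" using that vert.orbit_refl unfolding orbits_def by blast
    then show ?thesis unfolding l_def by (rule someI_ex)
  qed
  define rt where "rt = (\<lambda>x. l (orbit G \<phi> x))"
  have orb: "orbit G \<phi> x \<in> orbits G (verts \<Gamma>) \<phi>" if "x \<in> verts \<Gamma>" for x
    using that by (auto simp: orbits_def)
  have rt: "rt x \<in> verts \<Gamma>" if "x \<in> verts \<Gamma>" for x
    unfolding rt_def using vert.orbits_closed[OF orb l[OF orb]] that by blast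
  have "\<exists>g\<in>carrier G. \<phi> g (rt x) = x" if x: "x \<in> verts \<Gamma>" for x
  proof -
    have "orbit G \<phi> x = orbit G \<phi> (rt x)"
      unfolding rt_def by (rule vert.orbits_eq_orbit[OF orb[OF x] l[OF orb[OF x]]])
    then have "x \<in> orbit G \<phi> (rt x)" using vert.orbit_refl[OF x] by simp
    then obtain g where "g \<in> carrier G" "x = \<phi> g (rt x)" unfolding orbit_def by blast
    then show ?thesis by (intro bexI[of _ g]) (rule sym)
  qed
  then obtain k where k: "\<And>x. x \<in> verts \<Gamma> \<Longrightarrow> k x \<in> carrier G"
    "\<And>x. x \<in> verts \<Gamma> \<Longrightarrow> \<phi> (k x) (rt x) = x"
    by metis
  define W where "W = tail \<Gamma> ` F \<union> head \<Gamma> ` F"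
  have W: "finite W" "W \<subseteq> verts \<Gamma>" using F by (auto simp: W_def)
  \<comment> \<open>One tolerance for two purposes: the displacement by the Kazhdan sets, and the
    error of carrying values from \<open>rt x\<close> to \<open>x\<close>. The inserted
    \<open>\<epsilon> / 4\<close> also keeps the set nonempty.\<close>
  define \<kappa> where "\<kappa> = Min (insert (\<epsilon> / 4) ((\<lambda>x. \<eta> (rt x) * (\<epsilon> / 4)) ` W))"
  have "\<kappa> > 0"
    unfolding \<kappa>_def using W \<epsilon> \<eta> rt by (subst Min_gr_iff) auto
  moreover have "\<kappa> \<le> \<epsilon> / 4" "\<kappa> \<le> \<eta> (rt x) * (\<epsilon> / 4)" if "x \<in> W" for x
    unfolding \<kappa>_def using W(1) that by (blast intro: Min_le)+
  ultimately have \<kappa>: "\<kappa> > 0" "\<And>x. x \<in> W \<Longrightarrow> \<kappa> \<le> \<epsilon> / 4" "\<And>x. x \<in> W \<Longrightarrow> \<kappa> \<le> \<eta> (rt x) * (\<epsilon> / 4)"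
    by blast+
  \<comment> \<open>Besides the Kazhdan sets of the representatives, \<open>K\<close> contains the
    elements \<open>k x\<close> that carry them to the vertices in \<open>W\<close>.\<close>
  define K where "K = (\<Union>x\<in>W. insert (k x) (Q (rt x)))"
  have "compactin T K"
    unfolding K_def
  proof (rule compactin_Union)
    show "finite ((\<lambda>x. insert (k x) (Q (rt x))) ` W)" using W(1) by simp
    fix Z assume "Z \<in> (\<lambda>x. insert (k x) (Q (rt x))) ` W"
    then obtain x where x: "x \<in> W" "Z = {k x} \<union> Q (rt x)" by auto
    then have "x \<in> verts \<Gamma>" using W(2) by blast
    then show "compactin T Z"
      unfolding x(2) using k(1) topspace_eq Q(1) rt by (intro compactin_Un) simp_all
  qed
  moreover have "b \<in> closed_coboundaries G T \<pi>" using B b by blast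
  ultimately obtain a where a: "a \<in> coboundaries G \<pi>" "\<And>g. g \<in> K \<Longrightarrow> dist (b g) (a g) < \<kappa>"
    unfolding closed_coboundaries_def using \<kappa>(1) by blast
  then obtain m where m: "a = (\<lambda>g\<in>carrier G. \<pi> g m - m)" unfolding coboundaries_def by blast
  \<comment> \<open>With the constant \<open>m\<close> added, the failure of equivariance at
    \<open>g\<close> becomes \<open>b g - a g\<close>, which is small on \<open>K\<close>.\<close>
  define v where "v = (\<lambda>x. u x + m)"
  have v: "dist (\<pi> g (v x)) (v (\<phi> g x)) < \<kappa>" if "g \<in> K" "g \<in> carrier G" "x \<in> verts \<Gamma>" for g x
  proof -
    have "v (\<phi> g x) - \<pi> g (v x) = b g - a g"
      using u that by (simp add: v_def m affine_equivariant_def rep_add)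
    then show ?thesis
      using a(2)[OF that(1)] by (simp only: dist_norm norm_minus_commute[of "\<pi> g (v x)"])
  qed
  have "\<exists>y\<in>fixed_vectors \<pi> (stabilizer G \<phi> (rt x)). dist (v (rt x)) y < \<epsilon> / 4" if x: "x \<in> W" for x
  proof (rule near)
    show rx: "rt x \<in> verts \<Gamma>" using rt W(2) x by blast
    show "\<forall>g\<in>Q (rt x). dist (\<pi> g (v (rt x))) (v (rt x)) < \<eta> (rt x) * (\<epsilon> / 4)"
    proof
      fix g assume g: "g \<in> Q (rt x)"
      then have "g \<in> carrier G" "\<phi> g (rt x) = rt x" "g \<in> K"
        using Q(2)[OF rx] x by (auto simp: stabilizer_def K_def)
      then show "dist (\<pi> g (v (rt x))) (v (rt x)) < \<eta> (rt x) * (\<epsilon> / 4)"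
        using v[of g "rt x"] rx \<kappa>(3)[OF x] by simp
    qed
  qed (use \<epsilon> in simp)
  then have "\<exists>y\<in>fixed_vectors \<pi> (stabilizer G \<phi> z). dist (v z) y < \<epsilon> / 4" if "z \<in> rt ` W" for z
    using that by blast
  then obtain f where f: "\<And>z. z \<in> rt ` W \<Longrightarrow> f z \<in> fixed_vectors \<pi> (stabilizer G \<phi> z)"
    "\<And>z. z \<in> rt ` W \<Longrightarrow> dist (v z) (f z) < \<epsilon> / 4"
    by metis
  \<comment> \<open>Orbits that do not meet \<open>W\<close> receive the value 0, which every
    stabilizer fixes.\<close>
  have "(if l X \<in> rt ` W then f (l X) else 0) \<in> fixed_vectors \<pi> (stabilizer G \<phi> (l X))" for X
    using f(1) rep_zero by (simp add: fixed_vectors_def stabilizer_def)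
  then obtain w where w: "equivariant w"
    "\<And>X. X \<in> orbits G (verts \<Gamma>) \<phi> \<Longrightarrow> w (l X) = (if l X \<in> rt ` W then f (l X) else 0)"
    using equivariant_extension[of l "\<lambda>X. if l X \<in> rt ` W then f (l X) else 0"] l by blast
  have close: "dist (w x) (v x) < \<epsilon> / 2" if x: "x \<in> W" for x
  proof -
    have xv: "x \<in> verts \<Gamma>" using x W(2) by blast
    have rtx: "rt x = l (orbit G \<phi> x)" by (simp add: rt_def)
    have "l (orbit G \<phi> x) \<in> rt ` W" using x by (simp flip: rtx)
    then have "w (rt x) = f (rt x)"
      using w(2)[OF orb[OF xv]] unfolding rtx by (simp only: if_True)
    then have wx: "w x = \<pi> (k x) (f (rt x))"
      using w(1) k[OF xv] rt[OF xv] unfolding equivariant_def by metis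
    have "dist (\<pi> (k x) (f (rt x))) (\<pi> (k x) (v (rt x))) < \<epsilon> / 4"
      using f(2)[of "rt x"] x k(1)[OF xv] by (simp add: rep_dist dist_commute)
    moreover have "dist (\<pi> (k x) (v (rt x))) (v x) < \<kappa>"
      using v[of "k x" "rt x"] k[OF xv] rt[OF xv] x by (auto simp: K_def)
    ultimately show ?thesis
      using \<kappa>(2)[OF x] dist_triangle[of "w x" "v x" "\<pi> (k x) (v (rt x))"] wx by simp
  qed
  have "dist (differential w e) (c e) < \<epsilon>" if e: "e \<in> F" for e
  proof -
    have ce: "c e = v (head \<Gamma> e) - v (tail \<Gamma> e)"
      using du[of e] e F(2) by (auto simp: differential_def v_def)
    have "dist (differential w e) (c e)
        \<le> dist (w (head \<Gamma> e)) (v (head \<Gamma> e)) + dist (w (tail \<Gamma> e)) (v (tail \<Gamma> e))"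
      using norm_triangle_ineq4[of "w (head \<Gamma> e) - v (head \<Gamma> e)" "w (tail \<Gamma> e) - v (tail \<Gamma> e)"]
      by (simp add: ce differential_def dist_norm algebra_simps)
    then show ?thesis
      using close[of "head \<Gamma> e"] close[of "tail \<Gamma> e"] e by (simp add: W_def)
  qed
  then show ?thesis using w(1) by blast
qed

end

section \<open>The map iota\<close>

text \<open>Basic open sets of the product restrict only finitely many coordinates, so a single
  radius \<epsilon> serves them all.\<close>

lemma in_closure_of_product_iff:
  fixes B :: "'i \<Rightarrow> 'm::metric_space set"
  assumes S: "S \<subseteq> Pi\<^sub>E I B"
  shows "c \<in> product_topology (\<lambda>i. top_of_set (B i)) I closure_of S \<longleftrightarrow>
    c \<in> Pi\<^sub>E I B \<and> (\<forall>F \<epsilon>. finite F \<and> F \<subseteq> I \<and> \<epsilon> > 0 \<longrightarrow> (\<exists>s\<in>S. \<forall>i\<in>F. dist (s i) (c i) < \<epsilon>))"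
    (is "_ \<longleftrightarrow> ?R")
proof
  assume c: "c \<in> product_topology (\<lambda>i. top_of_set (B i)) I closure_of S"
  then have cB: "c \<in> Pi\<^sub>E I B"
    by (simp add: in_closure_of)
  moreover have "\<exists>s\<in>S. \<forall>i\<in>F. dist (s i) (c i) < \<epsilon>" if F: "finite F" "F \<subseteq> I" "\<epsilon> > 0" for F \<epsilon>
  proof -
    define U where "U = (\<lambda>i. if i \<in> F then B i \<inter> ball (c i) \<epsilon> else B i)"
    have "openin (product_topology (\<lambda>i. top_of_set (B i)) I) (Pi\<^sub>E I U)"
      unfolding openin_PiE_gen
    proof (intro disjI2 conjI ballI)
      have "{i \<in> I. U i \<noteq> topspace (top_of_set (B i))} \<subseteq> F" by (auto simp: U_def)
      then show "finite {i \<in> I. U i \<noteq> topspace (top_of_set (B i))}" using F(1) finite_subset by blast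
      show "openin (top_of_set (B i)) (U i)" for i
        by (auto simp: U_def intro: openin_open_Int)
    qed
    moreover have "c \<in> Pi\<^sub>E I U" using cB F by (auto simp: U_def PiE_iff)
    ultimately obtain s where "s \<in> S" "s \<in> Pi\<^sub>E I U" using c unfolding in_closure_of by blast
    then show ?thesis using F(2) by (intro bexI[of _ s]) (auto simp: U_def PiE_iff dist_commute subset_iff split: if_splits)
  qed
  ultimately show ?R by blast
next
  assume R: ?R
  show "c \<in> product_topology (\<lambda>i. top_of_set (B i)) I closure_of S"
    unfolding in_closure_of
  proof (intro conjI allI impI)
    show "c \<in> topspace (product_topology (\<lambda>i. top_of_set (B i)) I)" using R by simp
    fix W assume "c \<in> W \<and> openin (product_topology (\<lambda>i. top_of_set (B i)) I) W"
    then obtain U where U: "finite {i \<in> I. U i \<noteq> B i}" "\<And>i. i \<in> I \<Longrightarrow> openin (top_of_set (B i)) (U i)"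
      "c \<in> Pi\<^sub>E I U" "Pi\<^sub>E I U \<subseteq> W"
      unfolding openin_product_topology_alt by auto
    have "\<exists>r>0. B i \<inter> ball (c i) r \<subseteq> U i" if i: "i \<in> I" for i
    proof -
      have "c i \<in> U i" using U(3) i by (auto simp: PiE_iff)
      then obtain r where "r > 0" "ball (c i) r \<inter> B i \<subseteq> U i"
        using U(2)[OF i] unfolding openin_contains_ball by blast
      then show ?thesis by blast
    qed
    then obtain r where r: "\<And>i. i \<in> I \<Longrightarrow> r i > 0" "\<And>i. i \<in> I \<Longrightarrow> B i \<inter> ball (c i) (r i) \<subseteq> U i"
      by metis
    define F where "F = {i \<in> I. U i \<noteq> B i}"
    \<comment> \<open>The inserted 1 covers the case that no coordinate is restricted.\<close>
    define \<epsilon> where "\<epsilon> = Min (insert 1 (r ` F))"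
    have F: "finite F" "F \<subseteq> I" using U(1) by (auto simp: F_def)
    have "\<epsilon> > 0" unfolding \<epsilon>_def using F r(1) by (subst Min_gr_iff) auto
    then obtain s where s: "s \<in> S" "\<And>i. i \<in> F \<Longrightarrow> dist (s i) (c i) < \<epsilon>"
      using conjunct2[OF R, THEN spec, THEN spec, of F \<epsilon>] F by blast
    have "s i \<in> U i" if i: "i \<in> I" for i
    proof (cases "i \<in> F")
      case True
      have "\<epsilon> \<le> r i" unfolding \<epsilon>_def using F(1) True by (intro Min_le) auto
      then have "s i \<in> ball (c i) (r i)" using s(2)[OF True] by (simp add: dist_commute)
      moreover have "s i \<in> B i" using s(1) S i by (auto simp: PiE_iff)
      ultimately show ?thesis using r(2)[OF i] by blast
    next
      case False
      then show ?thesis using s(1) S i by (auto simp: F_def PiE_iff)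
    qed
    moreover have "s \<in> extensional I" using s(1) S by (auto simp: PiE_iff)
    ultimately have "s \<in> Pi\<^sub>E I U" by (simp add: PiE_iff)
    then show "\<exists>y. y \<in> S \<and> y \<in> W" using s(1) U(4) by blast
  qed
qed

section \<open>Evaluation of cochains at the lifts\<close>

locale bass_serre_module = tree_action_module G \<Gamma> arev \<phi> \<psi> T \<pi>
  for G :: "('g, 'x) monoid_scheme" (structure) and \<Gamma> :: "('v, 'e) pre_digraph" and arev \<phi> \<psi> T
    and \<pi> :: "'g \<Rightarrow> 'm::complex_hilbert \<Rightarrow> 'm" +
  fixes A :: "'e set set" and vlift elift t
  assumes orientation: "orientation (quotient_graph G \<Gamma> \<phi> \<psi>) (image arev) A"
    and vertex_lift: "Z \<in> orbits G (verts \<Gamma>) \<phi> \<Longrightarrow> vlift Z \<in> Z"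
    and arc_lift: "X \<in> A \<Longrightarrow> elift X \<in> X"
    and head_lift: "X \<in> A \<Longrightarrow> head \<Gamma> (elift X) = vlift (head \<Gamma> ` X)"
    and t_closed: "X \<in> A \<Longrightarrow> t X \<in> carrier G"
    and tail_lift: "X \<in> A \<Longrightarrow> tail \<Gamma> (elift X) = \<phi> (inv (t X)) (vlift (tail \<Gamma> ` X))"
begin

definition "quot = quotient_graph G \<Gamma> \<phi> \<psi>"

definition vertex_cochains :: "('v set \<Rightarrow> 'm) set" where
  "vertex_cochains = (\<Pi>\<^sub>E X\<in>verts quot. fixed_vectors \<pi> (stabilizer G \<phi> (vlift X)))"

definition edge_cochains :: "('e set \<Rightarrow> 'm) set" where
  "edge_cochains = (\<Pi>\<^sub>E X\<in>A. fixed_vectors \<pi> (stabilizer G \<psi> (elift X)))"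

lemma quot_simps:
  "verts quot = orbits G (verts \<Gamma>) \<phi>" "head quot X = head \<Gamma> ` X" "tail quot X = tail \<Gamma> ` X"
  by (simp_all add: quot_def quotient_graph_def)

lemma A_orbits: "X \<in> A \<Longrightarrow> X \<in> orbits G (arcs \<Gamma>) \<psi>"
  using orientation by (auto simp: orientation_def quotient_graph_def)

lemma A_iff: "X \<in> orbits G (arcs \<Gamma>) \<psi> \<Longrightarrow> X \<in> A \<longleftrightarrow> arev ` X \<notin> A"
  using orientation by (simp add: orientation_def quotient_graph_def)

lemma elift_arc: "X \<in> A \<Longrightarrow> elift X \<in> arcs \<Gamma>"
  using arc.orbits_closed[OF A_orbits arc_lift] by blast

lemma image_orbits:
  assumes e: "e \<in> arcs \<Gamma>"
  shows "head \<Gamma> ` orbit G \<psi> e = orbit G \<phi> (head \<Gamma> e)"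
    and "tail \<Gamma> ` orbit G \<psi> e = orbit G \<phi> (tail \<Gamma> e)"
    and "arev ` orbit G \<psi> e = orbit G \<psi> (arev e)"
proof -
  have orbit: "orbit G f x = (\<lambda>g. f g x) ` carrier G" for f :: "'g \<Rightarrow> 'z \<Rightarrow> 'z" and x
    by (auto simp: orbit_def)
  show "head \<Gamma> ` orbit G \<psi> e = orbit G \<phi> (head \<Gamma> e)"
    and "tail \<Gamma> ` orbit G \<psi> e = orbit G \<phi> (tail \<Gamma> e)"
    and "arev ` orbit G \<psi> e = orbit G \<psi> (arev e)"
    using e by (simp_all add: orbit image_image action_head action_tail action_arev cong: image_cong_simp)
qed

lemma orbit_in_orbits:
  "e \<in> arcs \<Gamma> \<Longrightarrow> orbit G \<psi> e \<in> orbits G (arcs \<Gamma>) \<psi>"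
  "x \<in> verts \<Gamma> \<Longrightarrow> orbit G \<phi> x \<in> orbits G (verts \<Gamma>) \<phi>"
  by (auto simp: orbits_def)

lemma A_ends:
  assumes "X \<in> A"
  shows "head \<Gamma> ` X \<in> orbits G (verts \<Gamma>) \<phi>" "tail \<Gamma> ` X \<in> orbits G (verts \<Gamma>) \<phi>"
proof -
  have "X = orbit G \<psi> (elift X)"
    by (rule arc.orbits_eq_orbit[OF A_orbits arc_lift]) (fact assms)+
  then have "head \<Gamma> ` X = orbit G \<phi> (head \<Gamma> (elift X))" "tail \<Gamma> ` X = orbit G \<phi> (tail \<Gamma> (elift X))"
    using image_orbits[OF elift_arc[OF assms]] by metis+
  then show "head \<Gamma> ` X \<in> orbits G (verts \<Gamma>) \<phi>" "tail \<Gamma> ` X \<in> orbits G (verts \<Gamma>) \<phi>"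
    using orbit_in_orbits(2) elift_arc[OF assms] by simp_all
qed

lemma vlift_vert: "X \<in> orbits G (verts \<Gamma>) \<phi> \<Longrightarrow> vlift X \<in> verts \<Gamma>"
  using vert.orbits_closed vertex_lift by blast

text \<open>The tail of the lifted arc is the translate of a lifted vertex by the inverse of
  \<open>t X\<close>; equivariance turns this translation into the operator occurring in
  \<open>iota\<close>.\<close>

lemma iota_apply:
  assumes w: "equivariant w" and f: "\<And>X. X \<in> verts quot \<Longrightarrow> f X = w (vlift X)" and X: "X \<in> A"
  shows "iota G quot A t \<pi> f X = differential w (elift X)"
proof -
  have "w (tail \<Gamma> (elift X)) = \<pi> (inv (t X)) (w (vlift (tail \<Gamma> ` X)))"
    using w t_closed[OF X] vlift_vert[OF A_ends(2)[OF X]] by (simp add: tail_lift[OF X] equivariant_def)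
  then show ?thesis
    using X A_ends[OF X] by (simp add: iota_def differential_def quot_simps f head_lift)
qed

text \<open>Equivariant functions restrict at the vertex lifts to families of vectors fixed by the
  vertex groups, and each such family extends back; \<open>iota_apply\<close> matches the
  maps.\<close>

lemma iota_image:
  "iota G quot A t \<pi> ` vertex_cochains = (\<lambda>w. \<lambda>X\<in>A. differential w (elift X)) ` {w. equivariant w}"
proof (intro equalityI subsetI)
  fix c assume "c \<in> iota G quot A t \<pi> ` vertex_cochains"
  then obtain f where f: "f \<in> vertex_cochains" "c = iota G quot A t \<pi> f" by blast
  obtain w where w: "equivariant w" "\<And>X. X \<in> orbits G (verts \<Gamma>) \<phi> \<Longrightarrow> w (vlift X) = f X"
    using equivariant_extension[OF vertex_lift, of f] f(1)
    by (auto simp: vertex_cochains_def PiE_iff quot_simps)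
  have "c = (\<lambda>X\<in>A. differential w (elift X))"
  proof (rule extensionalityI[of _ A])
    show "c X = (\<lambda>X\<in>A. differential w (elift X)) X" if "X \<in> A" for X
      using iota_apply[OF w(1) _ that, of f] w(2) that by (simp add: f(2) quot_simps)
  qed (simp_all add: f(2) iota_def)
  then show "c \<in> (\<lambda>w. \<lambda>X\<in>A. differential w (elift X)) ` {w. equivariant w}" using w(1) by blast
next
  fix c assume "c \<in> (\<lambda>w. \<lambda>X\<in>A. differential w (elift X)) ` {w. equivariant w}"
  then obtain w where w: "equivariant w" "c = (\<lambda>X\<in>A. differential w (elift X))" by blast
  define f where "f = (\<lambda>X\<in>verts quot. w (vlift X))"
  have "f X \<in> fixed_vectors \<pi> (stabilizer G \<phi> (vlift X))" if "X \<in> verts quot" for X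
  proof -
    have "\<pi> g (w (vlift X)) = w (vlift X)" if "g \<in> carrier G" "\<phi> g (vlift X) = vlift X" for g
      using w(1) that vlift_vert \<open>X \<in> verts quot\<close> unfolding equivariant_def quot_simps by metis
    then show ?thesis using that by (simp add: f_def fixed_vectors_def stabilizer_def)
  qed
  then have "f \<in> vertex_cochains" by (simp add: vertex_cochains_def f_def)
  moreover have "c = iota G quot A t \<pi> f"
  proof (rule extensionalityI[of _ A])
    show "c X = iota G quot A t \<pi> f X" if "X \<in> A" for X
      using iota_apply[OF w(1) _ that, of f] that by (simp add: f_def w(2))
  qed (simp_all add: w(2) iota_def)
  ultimately show "c \<in> iota G quot A t \<pi> ` vertex_cochains" by blast
qed

text \<open>Equivariance extends a family from the lifts to the orbits in \<open>A\<close>. Exactly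
  one of an orbit and its reverse belongs to \<open>A\<close>, so the alternating condition
  determines the remaining values.\<close>

lemma edge_cochains_eq:
  "edge_cochains = (\<lambda>c. \<lambda>X\<in>A. c (elift X)) ` {c. arc_cochain c}"
proof (intro equalityI subsetI)
  fix c assume c: "c \<in> edge_cochains"
  define l where "l = (\<lambda>X. if X \<in> A then elift X else (SOME e. e \<in> X))"
  have l: "l X \<in> X" if "X \<in> orbits G (arcs \<Gamma>) \<psi>" for X
  proof (cases "X \<in> A")
    case False
    have "\<exists>e. e \<in> X" using that arc.orbit_refl unfolding orbits_def by blast
    then show ?thesis using False someI_ex[of "\<lambda>e. e \<in> X"] by (simp add: l_def)
  qed (simp add: l_def arc_lift)
  have fixed: "\<pi> g (if X \<in> A then c X else 0) = (if X \<in> A then c X else 0)"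
    if "g \<in> stabilizer G \<psi> (l X)" for X g
    using c that by (auto simp: edge_cochains_def PiE_iff l_def fixed_vectors_def stabilizer_def rep_zero)
  obtain w where w: "\<And>g e. g \<in> carrier G \<Longrightarrow> e \<in> arcs \<Gamma> \<Longrightarrow> w (\<psi> g e) = \<pi> g (w e)"
    "\<And>X. X \<in> orbits G (arcs \<Gamma>) \<psi> \<Longrightarrow> w (l X) = (if X \<in> A then c X else 0)"
    using arc.equivariant_extension[of \<pi> l "\<lambda>X. if X \<in> A then c X else 0", OF rep_one rep_mult l fixed]
    by blast
  \<comment> \<open>Outside the orbits of \<open>A\<close> the default value 0 of \<open>w\<close>
    is discarded in favour of the negative of the value on the reversed arc.\<close>
  define d where "d = (\<lambda>e. if orbit G \<psi> e \<in> A then w e else - w (arev e))"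
  have orb_rev: "orbit G \<psi> (arev e) \<in> A \<longleftrightarrow> orbit G \<psi> e \<notin> A" if "e \<in> arcs \<Gamma>" for e
    using A_iff[OF orbit_in_orbits(1)[OF that]] image_orbits(3)[OF that] by simp
  have "arc_cochain d"
    unfolding arc_cochain_def
  proof (intro conjI ballI)
    fix e assume e: "e \<in> arcs \<Gamma>"
    then show "d (arev e) = - d e" using orb_rev[OF e] arev_arev[OF e] by (simp add: d_def)
    fix g assume g: "g \<in> carrier G"
    have "\<psi> g e \<in> orbit G \<psi> e" using g unfolding orbit_def by blast
    then have "orbit G \<psi> (\<psi> g e) = orbit G \<psi> e"
      using arc.orbits_eq_orbit[OF orbit_in_orbits(1)[OF e]] by simp
    then show "d (\<psi> g e) = \<pi> g (d e)"
      using w(1) g e arev_closed[OF e] by (simp add: d_def action_arev rep_minus)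
  qed
  moreover have "c = (\<lambda>X\<in>A. d (elift X))"
  proof (rule extensionalityI[of _ A])
    fix X assume X: "X \<in> A"
    have "orbit G \<psi> (elift X) = X"
      using arc.orbits_eq_orbit[OF A_orbits[OF X] arc_lift[OF X]] by simp
    then show "c X = (\<lambda>X\<in>A. d (elift X)) X"
      using X w(2)[OF A_orbits[OF X]] by (simp add: d_def l_def)
  qed (use c in \<open>simp_all add: edge_cochains_def PiE_iff\<close>)
  ultimately show "c \<in> (\<lambda>c. \<lambda>X\<in>A. c (elift X)) ` {c. arc_cochain c}" by blast
next
  fix c assume "c \<in> (\<lambda>c. \<lambda>X\<in>A. c (elift X)) ` {c. arc_cochain c}"
  then obtain d where d: "arc_cochain d" "c = (\<lambda>X\<in>A. d (elift X))" by blast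
  have "\<pi> g (d (elift X)) = d (elift X)" if "X \<in> A" "g \<in> carrier G" "\<psi> g (elift X) = elift X" for g X
    using d(1) that elift_arc unfolding arc_cochain_def by metis
  then show "c \<in> edge_cochains"
    by (simp add: d(2) edge_cochains_def fixed_vectors_def stabilizer_def)
qed

text \<open>Every arc or its reverse is a translate of a lifted arc, and negation and
  \<open>\<pi> g\<close> are isometries. The orbit \<open>X\<close> does not depend on the cochains,
  so finitely many arcs lead to finitely many coordinates.\<close>

lemma cochain_dist_lift:
  assumes e: "e \<in> arcs \<Gamma>"
  obtains X where "X \<in> A"
    "\<And>c d. arc_cochain c \<Longrightarrow> arc_cochain d \<Longrightarrow> dist (c e) (d e) = dist (c (elift X)) (d (elift X))"
proof -
  define e' where "e' = (if orbit G \<psi> e \<in> A then e else arev e)"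
  have e': "e' \<in> arcs \<Gamma>" "orbit G \<psi> e' \<in> A"
    using e A_iff[OF orbit_in_orbits(1)[OF e]] image_orbits(3)[OF e] arev_closed
    by (auto simp: e'_def)
  have "elift (orbit G \<psi> e') \<in> orbit G \<psi> e'" by (rule arc_lift[OF e'(2)])
  then obtain g where g: "g \<in> carrier G" "elift (orbit G \<psi> e') = \<psi> g e'" unfolding orbit_def by blast
  have "dist (c e) (d e) = dist (c (elift (orbit G \<psi> e'))) (d (elift (orbit G \<psi> e')))"
    if "arc_cochain c" "arc_cochain d" for c d
  proof -
    have "dist (c e) (d e) = dist (c e') (d e')"
      using that e by (simp add: e'_def arc_cochain_def dist_minus)
    then show ?thesis using that g e'(1) by (simp add: arc_cochain_def rep_dist)
  qed
  then show ?thesis using that e'(2) by blast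
qed

lemma differential_equivariant: "equivariant w \<Longrightarrow> arc_cochain (differential w)"
  by (rule differential_affine[of "\<lambda>_. 0"]) (simp add: affine_zero)

lemma iota_image_subset: "iota G quot A t \<pi> ` vertex_cochains \<subseteq> edge_cochains"
  unfolding iota_image edge_cochains_eq using differential_equivariant by blast

lemma iota_onto_iff:
  "iota G quot A t \<pi> ` vertex_cochains = edge_cochains \<longleftrightarrow>
     (\<forall>c. arc_cochain c \<longrightarrow> (\<exists>w. equivariant w \<and> (\<forall>e\<in>arcs \<Gamma>. differential w e = c e)))"
proof
  assume onto: "iota G quot A t \<pi> ` vertex_cochains = edge_cochains"
  show "\<forall>c. arc_cochain c \<longrightarrow> (\<exists>w. equivariant w \<and> (\<forall>e\<in>arcs \<Gamma>. differential w e = c e))"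
  proof (intro allI impI)
    fix c assume c: "arc_cochain c"
    then have "(\<lambda>X\<in>A. c (elift X)) \<in> iota G quot A t \<pi> ` vertex_cochains"
      unfolding onto edge_cochains_eq by blast
    then obtain w where w: "equivariant w" "(\<lambda>X\<in>A. c (elift X)) = (\<lambda>X\<in>A. differential w (elift X))"
      unfolding iota_image by blast
    have "differential w e = c e" if e: "e \<in> arcs \<Gamma>" for e
    proof -
      \<comment> \<open>The distance at the lift is zero, so it is zero at \<open>e\<close>.\<close>
      obtain X where "X \<in> A" "dist (differential w e) (c e) = dist (differential w (elift X)) (c (elift X))"
        using cochain_dist_lift[OF e] differential_equivariant[OF w(1)] c by metis
      then show ?thesis using fun_cong[OF w(2), of X] by simp
    qed
    then show "\<exists>w. equivariant w \<and> (\<forall>e\<in>arcs \<Gamma>. differential w e = c e)" using w(1) by blast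
  qed
next
  assume *: "\<forall>c. arc_cochain c \<longrightarrow> (\<exists>w. equivariant w \<and> (\<forall>e\<in>arcs \<Gamma>. differential w e = c e))"
  have "c \<in> iota G quot A t \<pi> ` vertex_cochains" if c: "c \<in> edge_cochains" for c
  proof -
    obtain d where d: "arc_cochain d" "c = (\<lambda>X\<in>A. d (elift X))"
      using c unfolding edge_cochains_eq by blast
    then obtain w where w: "equivariant w" "\<And>e. e \<in> arcs \<Gamma> \<Longrightarrow> differential w e = d e" using * by blast
    have "c = (\<lambda>X\<in>A. differential w (elift X))"
      unfolding d(2) using w(2) elift_arc by (intro restrict_ext) simp
    then show ?thesis unfolding iota_image using w(1) by blast
  qed
  then show "iota G quot A t \<pi> ` vertex_cochains = edge_cochains" using iota_image_subset by blast
qed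

text \<open>Closure in the product means approximation on finitely many elements of
  \<open>A\<close>. These become arcs by \<open>elift\<close>, and finite sets of arcs become finite
  subsets of \<open>A\<close> by \<open>cochain_dist_lift\<close>.\<close>

lemma iota_dense_iff:
  "product_topology (\<lambda>X. top_of_set (fixed_vectors \<pi> (stabilizer G \<psi> (elift X)))) A
      closure_of (iota G quot A t \<pi> ` vertex_cochains) = edge_cochains \<longleftrightarrow>
    (\<forall>c F \<epsilon>. arc_cochain c \<longrightarrow> finite F \<longrightarrow> F \<subseteq> arcs \<Gamma> \<longrightarrow> \<epsilon> > 0 \<longrightarrow>
      (\<exists>w. equivariant w \<and> (\<forall>e\<in>F. dist (differential w e) (c e) < \<epsilon>)))"
  (is "?cl = _ \<longleftrightarrow> ?R")
proof
  note closure = in_closure_of_product_iff[OF iota_image_subset[unfolded edge_cochains_def]]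
  {
    assume dense: "?cl = edge_cochains"
    show ?R
    proof (intro allI impI)
      fix c F and \<epsilon> :: real
      assume c: "arc_cochain c" and F: "finite F" "F \<subseteq> arcs \<Gamma>" and \<epsilon>: "\<epsilon> > 0"
      have "\<exists>X. X \<in> A \<and> (\<forall>c d. arc_cochain c \<longrightarrow> arc_cochain d \<longrightarrow>
          dist (c e) (d e) = dist (c (elift X)) (d (elift X)))" if "e \<in> F" for e
        using cochain_dist_lift[of e] that F(2) by (metis subsetD)
      then obtain X where X: "\<And>e. e \<in> F \<Longrightarrow> X e \<in> A"
        "\<And>e c d. e \<in> F \<Longrightarrow> arc_cochain c \<Longrightarrow> arc_cochain d \<Longrightarrow>
          dist (c e) (d e) = dist (c (elift (X e))) (d (elift (X e)))"
        by metis
      have "(\<lambda>X\<in>A. c (elift X)) \<in> ?cl" unfolding dense edge_cochains_eq using c by blast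
      moreover have "finite (X ` F)" "X ` F \<subseteq> A" using F(1) X(1) by auto
      moreover from calculation(1) have "\<forall>F \<epsilon>. finite F \<and> F \<subseteq> A \<and> \<epsilon> > 0 \<longrightarrow>
          (\<exists>s\<in>iota G quot A t \<pi> ` vertex_cochains.
            \<forall>Z\<in>F. dist (s Z) ((\<lambda>X\<in>A. c (elift X)) Z) < \<epsilon>)"
        unfolding closure by (rule conjunct2)
      note this[THEN spec, THEN spec, of "X ` F" \<epsilon>]
      ultimately obtain s where s: "s \<in> iota G quot A t \<pi> ` vertex_cochains"
        "\<And>Z. Z \<in> X ` F \<Longrightarrow> dist (s Z) ((\<lambda>X\<in>A. c (elift X)) Z) < \<epsilon>"
        using \<epsilon> by blast
      then obtain w where w: "equivariant w" "s = (\<lambda>X\<in>A. differential w (elift X))"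
        unfolding iota_image by blast
      have "dist (differential w e) (c e) < \<epsilon>" if "e \<in> F" for e
        using s(2)[of "X e"] X(1)[OF that] X(2)[OF that differential_equivariant[OF w(1)] c] that
        by (simp add: w(2))
      then show "\<exists>w. equivariant w \<and> (\<forall>e\<in>F. dist (differential w e) (c e) < \<epsilon>)" using w(1) by blast
    qed
  next
    assume R: ?R
    have "c \<in> ?cl" if c: "c \<in> edge_cochains" for c
      unfolding closure
    proof (intro conjI allI impI)
      show "c \<in> (\<Pi>\<^sub>E X\<in>A. fixed_vectors \<pi> (stabilizer G \<psi> (elift X)))"
        using c by (simp add: edge_cochains_def)
      fix F and \<epsilon> :: real assume F: "finite F \<and> F \<subseteq> A \<and> \<epsilon> > 0"
      obtain d where d: "arc_cochain d" "c = (\<lambda>X\<in>A. d (elift X))"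
        using c unfolding edge_cochains_eq by blast
      have "finite (elift ` F)" "elift ` F \<subseteq> arcs \<Gamma>" using F elift_arc by auto
      then obtain w where w: "equivariant w" "\<And>e. e \<in> elift ` F \<Longrightarrow> dist (differential w e) (d e) < \<epsilon>"
        using R d(1) F by metis
      have "(\<lambda>X\<in>A. differential w (elift X)) \<in> iota G quot A t \<pi> ` vertex_cochains"
        unfolding iota_image using w(1) by blast
      moreover have "dist ((\<lambda>X\<in>A. differential w (elift X)) X) (c X) < \<epsilon>" if "X \<in> F" for X
      proof -
        have "X \<in> A" using F that by blast
        then show ?thesis using w(2)[of "elift X"] that by (simp add: d(2))
      qed
      ultimately show "\<exists>s\<in>iota G quot A t \<pi> ` vertex_cochains. \<forall>X\<in>F. dist (s X) (c X) < \<epsilon>" by blast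
    qed
    moreover have "?cl \<subseteq> edge_cochains"
      using closure_of_subset_topspace[of "product_topology (\<lambda>X. top_of_set (fixed_vectors \<pi> (stabilizer G \<psi> (elift X)))) A"]
      by (simp add: edge_cochains_def)
    ultimately show "?cl = edge_cochains" by blast
  }
qed

lemma trivial_H1_iff_iota_onto:
  "trivial_group (H1 G T \<pi>) \<longleftrightarrow> iota G quot A t \<pi> ` vertex_cochains = edge_cochains"
  by (simp only: trivial_H1_iff coboundaries_iff_differential_onto iota_onto_iff)

lemma trivial_reduced_H1_iff_iota_dense:
  "trivial_group (reduced_H1 G T \<pi>) \<longleftrightarrow>
     product_topology (\<lambda>X. top_of_set (fixed_vectors \<pi> (stabilizer G \<psi> (elift X)))) A
       closure_of (iota G quot A t \<pi> ` vertex_cochains) = edge_cochains"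
  unfolding trivial_reduced_H1_iff iota_dense_iff
proof (intro iffI subsetI)
  fix b assume dense: "\<forall>c F \<epsilon>. arc_cochain c \<longrightarrow> finite F \<longrightarrow> F \<subseteq> arcs \<Gamma> \<longrightarrow> \<epsilon> > 0 \<longrightarrow>
      (\<exists>w. equivariant w \<and> (\<forall>e\<in>F. dist (differential w e) (c e) < \<epsilon>))"
    and b: "b \<in> cocycles G T \<pi>"
  show "b \<in> closed_coboundaries G T \<pi>"
    by (rule closed_coboundary_if_differential_dense[OF _ b]) (simp add: dense)
qed (intro allI impI differential_dense_if_closed_coboundaries)

end

theorem theorem3:
  fixes G :: "('g, 'x) monoid_scheme" and T :: "'g topology"
    and \<Gamma> :: "('v, 'e) pre_digraph" and arev :: "'e \<Rightarrow> 'e"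
    and \<phi> :: "'g \<Rightarrow> 'v \<Rightarrow> 'v" and \<psi> :: "'g \<Rightarrow> 'e \<Rightarrow> 'e"
    and S :: "('v set, 'e set) pre_digraph" and A :: "'e set set"
    and vlift :: "'v set \<Rightarrow> 'v" and elift :: "'e set \<Rightarrow> 'e" and t :: "'e set \<Rightarrow> 'g"
    and \<pi> :: "'g \<Rightarrow> 'm::complex_hilbert \<Rightarrow> 'm"
  defines "Y \<equiv> quotient_graph G \<Gamma> \<phi> \<psi>"
  defines "G\<^sub>v \<equiv> \<lambda>v. stabilizer G \<phi> (vlift v)"
    and "G\<^sub>e \<equiv> \<lambda>e. stabilizer G \<psi> (elift e)"
  defines "C\<^sub>0 \<equiv> \<Pi>\<^sub>E v\<in>verts Y. fixed_vectors \<pi> (G\<^sub>v v)"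
    and "C\<^sub>1 \<equiv> \<Pi>\<^sub>E e\<in>A. fixed_vectors \<pi> (G\<^sub>e e)"
  assumes "locally_compact_group G T"
    and "tree_action_without_inversion G \<Gamma> arev \<phi> \<psi>"
    and "\<And>x. x \<in> verts \<Gamma> \<Longrightarrow> openin T (stabilizer G \<phi> x)"
    and "\<And>x. x \<in> verts \<Gamma> \<Longrightarrow>
      property_T (G\<lparr>carrier := stabilizer G \<phi> x\<rparr>) (subtopology T (stabilizer G \<phi> x))"
    and "bass_serre_data G \<Gamma> arev \<phi> \<psi> S A vlift elift t"
    and "unitary_module G T \<pi>"
  shows "(trivial_group (H1 G T \<pi>) \<longleftrightarrow> iota G Y A t \<pi> ` C\<^sub>0 = C\<^sub>1) \<and>
    (trivial_group (reduced_H1 G T \<pi>) \<longleftrightarrow>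
       product_topology (\<lambda>e. top_of_set (fixed_vectors \<pi> (G\<^sub>e e))) A closure_of (iota G Y A t \<pi> ` C\<^sub>0)
         = C\<^sub>1)"
proof -
  interpret tree: tree_action_without_inversion G \<Gamma> arev \<phi> \<psi> by fact
  interpret data: bass_serre_data G \<Gamma> arev \<phi> \<psi> S A vlift elift t Y
    using assms(10) unfolding Y_def .
  have top: "topological_group G T"
    using assms(6) by (rule locally_compact_group.axioms(1))
  have Y: "verts Y = orbits G (verts \<Gamma>) \<phi>" "\<And>X. head Y X = head \<Gamma> ` X" "\<And>X. tail Y X = tail \<Gamma> ` X"
    by (simp_all add: Y_def quotient_graph_def)
  interpret bass_serre_module G \<Gamma> arev \<phi> \<psi> T \<pi> A vlift elift t
  proof (intro bass_serre_module.intro tree_action_module.intro unitary_module_action.intro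
      tree.tree_action_without_inversion_axioms top unitary_module_action_axioms.intro
      tree_action_module_axioms.intro bass_serre_module_axioms.intro)
    show "orientation (quotient_graph G \<Gamma> \<phi> \<psi>) (image arev) A"
      using data.orientation by (simp add: Y_def)
  qed (use assms(8,9,11) data.vertex_lift data.arc_lift data.head_lift data.t_closed data.tail_lift Y in simp_all)
  have "C\<^sub>0 = vertex_cochains" "C\<^sub>1 = edge_cochains"
    by (simp_all add: C\<^sub>0_def C\<^sub>1_def G\<^sub>v_def G\<^sub>e_def vertex_cochains_def edge_cochains_def
        Y_def quot_def)
  then show ?thesis
    using trivial_H1_iff_iota_onto trivial_reduced_H1_iff_iota_dense
    by (simp add: G\<^sub>e_def Y_def quot_def)
qed

end
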